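(* Let $n\ge 3$, let $Z\subset\mathbb{P}^{n-1}$ be a reduced finite set of points with the Uniform Position Property, and let $(1,h_1,\dots,h_t)$ be the $h$-vector of $Z$. Assume that $$h_d=h_{d+1}=s\ne 0$$ for some $d>r_2(R/I_Z)$. Then there exists an unmixed curve $C$ of degree $s$ such that (a) $Z\subset C$; (b) $I_C=\langle (I_Z)_{\le d}\rangle$; (c) $\Delta H(C,t)=h_t$ for all $t\le d+1$.
   Context: $K$ is a field of characteristic $0$, $R=K[x_1,\dots,x_n]$ with the standard grading, $\mathbb{P}^{n-1}=\operatorname{Proj} R$. For a closed subscheme $W$, $I_W\subset R$ is its saturated homogeneous ideal, $H(W,t)=H(R/I_W,t)=\dim_K(R/I_W)_t$, and $\Delta H(W,t)=H(W,t)-H(W,t-1)$. The $h$-vector of $Z$ is $h_i=\Delta H(R/I_Z,i)$ (the Hilbert function of the Artinian reduction of $R/I_Z$). A finite set of points has the Uniform Position Property (UPP) if any two of its subsets of the same cardinality have the same Hilbert function. For a homogeneous ideal $I$ and $s\ge\dim(R/I)$, $r_s(R/I)=\max\{k : H(R/(I+J),k)\ne 0\}$, where $J$ is generated by $s$ general linear forms. $\langle (I_Z)_{\le d}\rangle$ is the ideal generated by the elements of $I_Z$ of degree $\le d$. An unmixed curve is a one-dimensional closed subscheme (not necessarily reduced or irreducible) with no zero-dimensional (isolated or embedded) components. *)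

theory Defs
  imports
    Complex_Main
    "HOL-Library.Poly_Mapping"
    "HOL-Library.Cardinality"
    "HOL-Computational_Algebra.Polynomial"
begin

(* K[x_v : v in 'v], with monomials as exponent vectors. For finite 'v this is the ring R. *)
type_synonym ('v, 'k) mpoly = "('v \<Rightarrow>\<^sub>0 nat) \<Rightarrow>\<^sub>0 'k"

definition const_poly :: "'k \<Rightarrow> ('v, 'k::comm_ring_1) mpoly" where
  "const_poly c = Poly_Mapping.single 0 c"

definition var_poly :: "'v \<Rightarrow> ('v, 'k::comm_ring_1) mpoly" where
  "var_poly v = Poly_Mapping.single (Poly_Mapping.single v 1) 1"

definition eval_poly :: "('v \<Rightarrow> 'k) \<Rightarrow> ('v, 'k::comm_ring_1) mpoly \<Rightarrow> 'k" where
  "eval_poly a f = (\<Sum>m\<in>Poly_Mapping.keys f.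
     Poly_Mapping.lookup f m * (\<Prod>v\<in>Poly_Mapping.keys m. a v ^ Poly_Mapping.lookup m v))"

definition poly_vars :: "('v, 'k::comm_ring_1) mpoly \<Rightarrow> 'v set" where
  "poly_vars f = (\<Union>m\<in>Poly_Mapping.keys f. Poly_Mapping.keys m)"

definition mon_degree :: "('v \<Rightarrow>\<^sub>0 nat) \<Rightarrow> nat" where
  "mon_degree m = (\<Sum>v\<in>Poly_Mapping.keys m. Poly_Mapping.lookup m v)"

(* R_t, including 0 *)
definition forms :: "nat \<Rightarrow> ('v, 'k::comm_ring_1) mpoly set" where
  "forms t = {f. \<forall>m\<in>Poly_Mapping.keys f. mon_degree m = t}"

(* An ideal is a submodule of the ring regarded as a module over itself. *)
definition is_ideal :: "'a::comm_ring_1 set \<Rightarrow> bool" where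
  "is_ideal I \<longleftrightarrow> module.subspace (*) I"

definition ideal_generated :: "'a::comm_ring_1 set \<Rightarrow> 'a set" where
  "ideal_generated S = module.span (*) S"

definition prime_ideal :: "'a::comm_ring_1 set \<Rightarrow> bool" where
  "prime_ideal P \<longleftrightarrow>
     is_ideal P \<and> P \<noteq> UNIV \<and> (\<forall>a b. a * b \<in> P \<longrightarrow> a \<in> P \<or> b \<in> P)"

(* Ass(R/I): the prime ideals that are annihilators of elements of R/I *)
definition associated_primes :: "'a::comm_ring_1 set \<Rightarrow> 'a set set" where
  "associated_primes I = {P. prime_ideal P \<and> (\<exists>f. P = {g. g * f \<in> I})}"

definition homogeneous_ideal :: "('v, 'k::comm_ring_1) mpoly set \<Rightarrow> bool" where
  "homogeneous_ideal I \<longleftrightarrow> is_ideal I \<and> I = ideal_generated (I \<inter> (\<Union>t. forms t))"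

definition irrelevant_ideal :: "('v, 'k::comm_ring_1) mpoly set" where
  "irrelevant_ideal = ideal_generated (range var_poly)"

definition saturated :: "('v, 'k::comm_ring_1) mpoly set \<Rightarrow> bool" where
  "saturated I \<longleftrightarrow> (\<forall>f. (\<forall>g\<in>irrelevant_ideal. f * g \<in> I) \<longrightarrow> f \<in> I)"

(* A closed subscheme W of Proj R is represented throughout by its saturated homogeneous ideal
   I_W; inclusion of subschemes is reverse inclusion of ideals. *)
definition closed_subscheme :: "('v, 'k::comm_ring_1) mpoly set \<Rightarrow> bool" where
  "closed_subscheme I \<longleftrightarrow> homogeneous_ideal I \<and> saturated I"

definition Proj_points :: "('v, 'k::comm_ring_1) mpoly set set" where
  "Proj_points = {P. prime_ideal P \<and> homogeneous_ideal P \<and> \<not> irrelevant_ideal \<subseteq> P}"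

definition closed_points :: "('v, 'k::comm_ring_1) mpoly set set" where
  "closed_points = {P \<in> Proj_points. \<forall>Q\<in>Proj_points. P \<subseteq> Q \<longrightarrow> Q = P}"

definition support :: "('v, 'k::comm_ring_1) mpoly set \<Rightarrow> ('v, 'k) mpoly set set" where
  "support I = {P \<in> Proj_points. I \<subseteq> P}"

definition has_chain :: "'a set set \<Rightarrow> nat \<Rightarrow> bool" where
  "has_chain X k \<longleftrightarrow> (\<exists>p. (\<forall>i\<le>k. p i \<in> X) \<and> (\<forall>i<k. p i \<subset> p (Suc i)))"

(* Krull dimension of the closed subscheme; the empty subscheme has no dimension in this sense. *)
definition has_dimension :: "('v, 'k::comm_ring_1) mpoly set \<Rightarrow> nat \<Rightarrow> bool" where
  "has_dimension I k \<longleftrightarrow> has_chain (support I) k \<and> \<not> has_chain (support I) (Suc k)"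

(* The components, isolated and embedded, of the subscheme are the closures of the points of
   Ass(R/I); such a component is zero-dimensional iff the point is closed. *)
definition unmixed_curve :: "('v, 'k::comm_ring_1) mpoly set \<Rightarrow> bool" where
  "unmixed_curve I \<longleftrightarrow>
     closed_subscheme I \<and> has_dimension I 1 \<and> associated_primes I \<inter> closed_points = {}"

(* The residue classes of the elements of B are K-linearly independent in R/I. *)
definition independent_mod ::
  "('v, 'k::field) mpoly set \<Rightarrow> ('v, 'k) mpoly set \<Rightarrow> bool" where
  "independent_mod I B \<longleftrightarrow>
     finite B \<and> (\<forall>c. (\<Sum>b\<in>B. const_poly (c b) * b) \<in> I \<longrightarrow> (\<forall>b\<in>B. c b = 0))"

(* H(R/I,t): the dimension over K of (R/I)_t, for a homogeneous ideal I *)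
definition hilbert_fun :: "('v::finite, 'k::field) mpoly set \<Rightarrow> nat \<Rightarrow> nat" where
  "hilbert_fun I t = Max {card B | B. B \<subseteq> forms t \<and> independent_mod I B}"

(* At t = 0 this uses H(R/I,-1) = 0. *)
definition delta_hilbert :: "('v::finite, 'k::field) mpoly set \<Rightarrow> nat \<Rightarrow> int" where
  "delta_hilbert I t =
     int (hilbert_fun I t) - (if t = 0 then 0 else int (hilbert_fun I (t - 1)))"

definition hilbert_poly :: "('v::finite, 'k::field) mpoly set \<Rightarrow> rat poly" where
  "hilbert_poly I =
     (THE p. \<forall>\<^sub>F t in sequentially. of_nat (hilbert_fun I t) = poly p (of_nat t))"

definition scheme_degree :: "('v::finite, 'k::field) mpoly set \<Rightarrow> rat" where
  "scheme_degree I = fact (degree (hilbert_poly I)) * lead_coeff (hilbert_poly I)"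

(* The saturated ideal of a set of points with its reduced structure; it is the unit ideal
   for the empty set. *)
definition points_ideal :: "('v, 'k::comm_ring_1) mpoly set set \<Rightarrow> ('v, 'k) mpoly set" where
  "points_ideal Z = \<Inter>Z"

definition uniform_position :: "('v::finite, 'k::field) mpoly set set \<Rightarrow> bool" where
  "uniform_position Z \<longleftrightarrow>
     (\<forall>A B. A \<subseteq> Z \<and> B \<subseteq> Z \<and> card A = card B \<longrightarrow>
        hilbert_fun (points_ideal A) = hilbert_fun (points_ideal B))"

(* P holds on a nonempty Zariski open subset of the affine space K^S. The principal open sets
   {a. F(a) \<noteq> 0} form a basis, so a nonempty one of these suffices. *)
definition holds_generically :: "'i set \<Rightarrow> (('i \<Rightarrow> 'k::field) \<Rightarrow> bool) \<Rightarrow> bool" where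
  "holds_generically S P \<longleftrightarrow>
     (\<exists>F :: ('i, 'k) mpoly. poly_vars F \<subseteq> S \<and> (\<exists>a. eval_poly a F \<noteq> 0) \<and>
        (\<forall>a. eval_poly a F \<noteq> 0 \<longrightarrow> P a))"

definition linear_form :: "('v::finite \<Rightarrow> 'k::comm_ring_1) \<Rightarrow> ('v, 'k) mpoly" where
  "linear_form c = (\<Sum>v\<in>UNIV. const_poly (c v) * var_poly v)"

(* r_s(R/I): the value, for general a, of max {k. H(R/(I+J),k) \<noteq> 0}, where J is generated by
   the linear forms with coefficients a (i, _), i < s. It is meaningful for s \<ge> dim(R/I). *)
definition r_inv :: "nat \<Rightarrow> ('v::finite, 'k::field) mpoly set \<Rightarrow> nat" where
  "r_inv s I =
     (THE r. holds_generically ({..<s} \<times> UNIV) (\<lambda>a.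
        let J = (\<lambda>i. linear_form (\<lambda>v. a (i, v))) ` {..<s};
            N = {k. hilbert_fun (ideal_generated (I \<union> J)) k \<noteq> 0}
        in r \<in> N \<and> (\<forall>k\<in>N. k \<le> r)))"

(* \<langle>I\<^sub>\<le>\<^sub>d\<rangle> *)
definition truncation_ideal :: "nat \<Rightarrow> ('v, 'k::comm_ring_1) mpoly set \<Rightarrow> ('v, 'k) mpoly set" where
  "truncation_ideal d I = ideal_generated {f \<in> I. \<forall>m\<in>Poly_Mapping.keys f. mon_degree m \<le> d}"

end

theory Submission
  imports Defs "HOL-Library.FuncSet"
begin

text \<open>Let \<open>I\<close> be the ideal of \<open>Z\<close> and \<open>T\<close> the ideal generated by its elements of degree at most \<open>d\<close>,
  and let \<open>l\<close>, \<open>x\<close> be general linear forms. Since \<open>d\<close> exceeds \<open>r_inv 2 I\<close>, all forms of degree \<open>d\<close>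
  lie in \<open>I + (l, x)\<close>; comparing dimensions, \<open>x\<close> is injective on \<open>R/(I + (l))\<close> in degree \<open>d\<close>, hence
  so it is on \<open>R/(T + (l))\<close>, and \<open>l\<close> is injective on \<open>R/T\<close> in degree \<open>d\<close>. An argument with Koszul
  syzygies in the manner of Bayer and Stillman, in place of generic initial ideals, extends both
  injectivity statements to all higher degrees because \<open>T\<close> has no generators there. Therefore
  \<open>l\<close> is a nonzerodivisor on \<open>R/T\<close>, and \<open>R/(T + (l))\<close> has dimension \<open>s\<close> in every degree from \<open>d\<close> on:
  \<open>T\<close> is saturated of dimension one and degree \<open>s\<close>.

  If a closed point \<open>P\<close> were associated to \<open>T\<close>, then the elements of \<open>T : P\<close> could be divided by \<open>l\<close>
  modulo \<open>T\<close> as long as their degree is at least \<open>d\<close>. So \<open>P\<close> has a separator of degree less than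
  \<open>d\<close>, which makes it a point of \<open>Z\<close>, and the ideal of \<open>Z - {P}\<close> contains all forms of degree
  \<open>d - 1\<close> modulo \<open>P\<close>. This is a statement on Hilbert functions, hence by uniform position true at
  all points of \<open>Z\<close>, and it forces \<open>s = 0\<close>. No closed point needs to be rational for this.\<close>

section \<open>Ideals and homogeneous components\<close>

text \<open>The hypothesis speaks of degrees \<open>d\<close> and \<open>d + 1\<close>, while degree
  and unmixedness of a curve involve all degrees. Above \<open>d\<close> the inclusion of
  \<open>T\<close> in \<open>I\<close> may be strict, so dimensions known for \<open>I\<close> say
  nothing about \<open>T\<close> there. What remains is that \<open>T\<close> has no generators
  above degree \<open>d\<close>: an equation \<open>y k * f\<close> in
  \<open>T + (y 0, ..., y (k - 1))\<close> can be rewritten as a linear relation among the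
  coordinates with coefficients in the ideal. If these relations are Koszul relations whose entries
  again lie in the ideal, \<open>y k\<close> can be divided out. The recursion starts at level two
  because \<open>T + (l, x)\<close> contains every form of degree at least \<open>d\<close>. For
  this the two general forms must belong to a regular sequence generating the irrelevant ideal,
  hence the change of coordinates.

  The number \<open>r_inv\<close> is a generic value given by a description operator, so its
  existence has to be established: filling a whole degree is an open condition on the coefficients.

  The collapse to \<open>s = 0\<close> is interpolation: separators of degree \<open>d - 1\<close>
  at all points, times \<open>l\<close>, match any form of degree \<open>d\<close> on all of
  \<open>Z\<close>, so \<open>I + (l)\<close> contains that form.\<close>

lemma module_times: "module ((*) :: 'a::comm_ring_1 \<Rightarrow> 'a \<Rightarrow> 'a)"
  by unfold_locales (simp_all add: algebra_simps)

lemma is_ideal_iff: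
  "is_ideal I \<longleftrightarrow> 0 \<in> I \<and> (\<forall>x\<in>I. \<forall>y\<in>I. x + y \<in> I) \<and> (\<forall>c. \<forall>x\<in>I. c * x \<in> I)"
  by (simp add: is_ideal_def module.subspace_def[OF module_times])

lemma is_idealD:
  assumes "is_ideal I"
  shows ideal_zero: "0 \<in> I"
    and ideal_add: "x \<in> I \<Longrightarrow> y \<in> I \<Longrightarrow> x + y \<in> I"
    and ideal_mult_left: "x \<in> I \<Longrightarrow> c * x \<in> I"
    and ideal_mult_right: "x \<in> I \<Longrightarrow> x * c \<in> I"
    and ideal_uminus: "x \<in> I \<Longrightarrow> - x \<in> I"
    and ideal_diff: "x \<in> I \<Longrightarrow> y \<in> I \<Longrightarrow> x - y \<in> I"
proof -
  show *: "0 \<in> I" "x \<in> I \<Longrightarrow> y \<in> I \<Longrightarrow> x + y \<in> I" "\<And>c x. x \<in> I \<Longrightarrow> c * x \<in> I" for x y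
    using assms by (auto simp: is_ideal_iff)
  show "x \<in> I \<Longrightarrow> x * c \<in> I" using *(3)[of x c] by (simp add: mult.commute)
  show u: "x \<in> I \<Longrightarrow> - x \<in> I" for x using *(3)[of x "-1"] by simp
  show "x \<in> I \<Longrightarrow> y \<in> I \<Longrightarrow> x - y \<in> I" using *(2)[of x "-y"] u by simp
qed

lemma ideal_sum: "is_ideal I \<Longrightarrow> (\<And>x. x \<in> A \<Longrightarrow> f x \<in> I) \<Longrightarrow> sum f A \<in> I"
  by (induction A rule: infinite_finite_induct) (auto intro: ideal_zero ideal_add)

lemma ideal_diff_cancel: "is_ideal I \<Longrightarrow> x - y \<in> I \<Longrightarrow> y \<in> I \<Longrightarrow> x \<in> I"
  using ideal_add[of I "x - y" y] by simp

lemma is_ideal_generated: "is_ideal (ideal_generated S)"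
  by (simp add: is_ideal_def ideal_generated_def module.subspace_span[OF module_times])

lemma ideal_generated_superset: "S \<subseteq> ideal_generated S"
  by (simp add: ideal_generated_def module.span_superset[OF module_times])

lemma ideal_generated_minimal: "S \<subseteq> I \<Longrightarrow> is_ideal I \<Longrightarrow> ideal_generated S \<subseteq> I"
  by (simp add: is_ideal_def ideal_generated_def module.span_minimal[OF module_times])

lemma ideal_generated_mono: "S \<subseteq> T \<Longrightarrow> ideal_generated S \<subseteq> ideal_generated T"
  by (meson ideal_generated_minimal ideal_generated_superset is_ideal_generated subset_trans)

lemma ideal_generated_induct [consumes 1, case_names zero step]:
  assumes "x \<in> ideal_generated S" "P 0" "\<And>c s y. s \<in> S \<Longrightarrow> P y \<Longrightarrow> P (c * s + y)"
  shows "P x"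
  using module.span_induct_alt[OF module_times, of x S P] assms
  by (simp add: ideal_generated_def)

lemma is_ideal_Inter: "(\<And>I. I \<in> A \<Longrightarrow> is_ideal I) \<Longrightarrow> is_ideal (\<Inter>A)"
  by (auto simp: is_ideal_iff)

lemma is_ideal_UNIV: "is_ideal UNIV"
  by (simp add: is_ideal_iff)

lemma is_ideal_zero: "is_ideal {0}"
  by (simp add: is_ideal_iff)

lemma ideal_one_iff: "is_ideal I \<Longrightarrow> 1 \<in> I \<longleftrightarrow> I = UNIV"
  by (metis UNIV_I UNIV_eq_I ideal_mult_right mult_1)

text \<open>The ideal \<open>(I, g)\<close>, given by explicit sums instead of generators, so that
  membership yields a representation \<open>a + g * b\<close> that can be manipulated.\<close>

definition adjoin :: "'a::comm_ring_1 \<Rightarrow> 'a set \<Rightarrow> 'a set" where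
  "adjoin g I = {a + g * b | a b. a \<in> I}"

definition ideal_plus :: "'a::comm_ring_1 set \<Rightarrow> 'a set \<Rightarrow> 'a set" where
  "ideal_plus I J = {a + b | a b. a \<in> I \<and> b \<in> J}"

lemma adjoinI: "a \<in> I \<Longrightarrow> a + g * b \<in> adjoin g I"
  by (auto simp: adjoin_def)

lemma adjoinE:
  assumes "f \<in> adjoin g I" obtains a b where "a \<in> I" "f = a + g * b"
  using assms by (auto simp: adjoin_def)

lemma is_ideal_adjoin: assumes "is_ideal I" shows "is_ideal (adjoin g I)"
  unfolding is_ideal_iff
proof (intro conjI ballI allI)
  show "0 \<in> adjoin g I" using adjoinI[of 0 I g 0] ideal_zero[OF assms] by simp
  fix x assume "x \<in> adjoin g I"
  then obtain a b where x: "a \<in> I" "x = a + g * b" by (rule adjoinE)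
  show "c * x \<in> adjoin g I" for c
    using adjoinI[of "c * a" I g "c * b"] x assms
    by (simp add: ideal_mult_left distrib_left mult.left_commute)
  fix y assume "y \<in> adjoin g I"
  then obtain a' b' where y: "a' \<in> I" "y = a' + g * b'" by (rule adjoinE)
  show "x + y \<in> adjoin g I"
    using adjoinI[of "a + a'" I g "b + b'"] x y assms
    by (simp add: ideal_add algebra_simps)
qed

lemma subset_adjoin: "I \<subseteq> adjoin g I"
  using adjoinI[of _ I g 0] by auto

lemma mem_adjoin: "is_ideal I \<Longrightarrow> g * b \<in> adjoin g I"
  using adjoinI[of 0 I g b] by (simp add: ideal_zero)

lemma mem_adjoin_self: "is_ideal I \<Longrightarrow> g \<in> adjoin g I"
  using mem_adjoin[of I g 1] by simp

lemma adjoin_mono: "I \<subseteq> J \<Longrightarrow> adjoin g I \<subseteq> adjoin g J"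
  by (auto simp: adjoin_def)

lemma adjoin_minimal: "is_ideal J \<Longrightarrow> I \<subseteq> J \<Longrightarrow> g \<in> J \<Longrightarrow> adjoin g I \<subseteq> J"
  by (auto simp: adjoin_def ideal_add ideal_mult_right)

lemma is_ideal_plus: assumes "is_ideal I" "is_ideal J" shows "is_ideal (ideal_plus I J)"
  unfolding is_ideal_iff
proof (intro conjI ballI allI)
  show "0 \<in> ideal_plus I J"
    unfolding ideal_plus_def using ideal_zero[OF assms(1)] ideal_zero[OF assms(2)] by force
  fix x assume "x \<in> ideal_plus I J"
  then obtain a b where x: "a \<in> I" "b \<in> J" "x = a + b" by (auto simp: ideal_plus_def)
  show "c * x \<in> ideal_plus I J" for c
    using x assms unfolding ideal_plus_def by (auto simp: distrib_left intro: ideal_mult_left)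
  fix y assume "y \<in> ideal_plus I J"
  then obtain a' b' where y: "a' \<in> I" "b' \<in> J" "y = a' + b'" by (auto simp: ideal_plus_def)
  have "x + y = (a + a') + (b + b')" using x y by (simp add: algebra_simps)
  then show "x + y \<in> ideal_plus I J"
    using x y assms unfolding ideal_plus_def by (blast intro: ideal_add)
qed

lemma ideal_plus_upper:
  assumes "is_ideal I" "is_ideal J"
  shows ideal_plus_upper1: "I \<subseteq> ideal_plus I J" and ideal_plus_upper2: "J \<subseteq> ideal_plus I J"
  unfolding ideal_plus_def using ideal_zero[OF assms(1)] ideal_zero[OF assms(2)] by force+

lemma ideal_plus_mono: "I \<subseteq> I' \<Longrightarrow> J \<subseteq> J' \<Longrightarrow> ideal_plus I J \<subseteq> ideal_plus I' J'"
  unfolding ideal_plus_def by blast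

section \<open>Degrees of monomials and forms\<close>

lemma mon_degree_superset:
  "finite A \<Longrightarrow> Poly_Mapping.keys m \<subseteq> A \<Longrightarrow> mon_degree m = (\<Sum>v\<in>A. Poly_Mapping.lookup m v)"
  unfolding mon_degree_def by (rule sum.mono_neutral_left) (auto simp: in_keys_iff)

lemma mon_degree_add: "mon_degree (m + n) = mon_degree m + mon_degree n"
proof -
  let ?A = "Poly_Mapping.keys m \<union> Poly_Mapping.keys n"
  have "mon_degree (m + n) = (\<Sum>v\<in>?A. Poly_Mapping.lookup (m + n) v)"
    by (rule mon_degree_superset) (auto simp: keys_add)
  then show ?thesis
    using mon_degree_superset[of ?A m] mon_degree_superset[of ?A n]
    by (simp add: lookup_add sum.distrib)
qed

lemma mon_degree_zero [simp]: "mon_degree 0 = 0"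
  by (simp add: mon_degree_def)

lemma mon_degree_single [simp]: "mon_degree (Poly_Mapping.single v k) = k"
  by (simp add: mon_degree_def)

lemma poly_mapping_sum_single:
  "finite A \<Longrightarrow> Poly_Mapping.keys f \<subseteq> A \<Longrightarrow>
    f = (\<Sum>m\<in>A. Poly_Mapping.single m (Poly_Mapping.lookup f m))"
  by (rule poly_mapping_eqI)
    (auto simp: lookup_sum lookup_single when_def in_keys_iff sum.delta subset_iff)

lemma mon_degree_eq_0_iff: "mon_degree m = 0 \<longleftrightarrow> m = 0"
proof
  assume "mon_degree m = 0"
  then have "\<forall>v\<in>Poly_Mapping.keys m. Poly_Mapping.lookup m v = 0"
    by (simp add: mon_degree_def)
  then have "Poly_Mapping.lookup m v = 0" for v by (metis in_keys_iff)
  then show "m = 0" by (intro poly_mapping_eqI) simp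
qed simp

lemma mon_degree_Suc:
  assumes "mon_degree m = Suc t"
  obtains v m' where "m = Poly_Mapping.single v 1 + m'" "mon_degree m' = t"
proof -
  have "m \<noteq> 0" using assms by auto
  then obtain v where v: "Poly_Mapping.lookup m v \<noteq> 0"
    by (metis lookup_zero poly_mapping_eqI)
  define m' where "m' = m - Poly_Mapping.single v 1"
  have "m = Poly_Mapping.single v 1 + m'"
    by (rule poly_mapping_eqI)
      (use v in \<open>auto simp: m'_def lookup_add lookup_minus lookup_single when_def\<close>)
  then show ?thesis using that assms mon_degree_add[of "Poly_Mapping.single v 1" m'] by simp
qed

lemma mult_single_lookup:
  fixes g :: "('a::cancel_comm_monoid_add) \<Rightarrow>\<^sub>0 'b::comm_ring_1"
  shows "Poly_Mapping.lookup (Poly_Mapping.single m c * g) (m + n) = c * Poly_Mapping.lookup g n"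
proof -
  have "Poly_Mapping.single m c * g =
      (\<Sum>k\<in>Poly_Mapping.keys g. Poly_Mapping.single (m + k) (c * Poly_Mapping.lookup g k))"
    by (subst poly_mapping_sum_single[of "Poly_Mapping.keys g" g])
      (simp_all add: sum_distrib_left mult_single)
  then show ?thesis
    by (simp add: lookup_sum lookup_single when_def sum.delta in_keys_iff)
qed

lemma mult_as_sum:
  fixes f g :: "('a::cancel_comm_monoid_add) \<Rightarrow>\<^sub>0 'b::comm_ring_1"
  assumes "finite A" "Poly_Mapping.keys f \<subseteq> A" "finite B" "Poly_Mapping.keys g \<subseteq> B"
  shows "f * g = (\<Sum>m\<in>A. \<Sum>n\<in>B.
    Poly_Mapping.single (m + n) (Poly_Mapping.lookup f m * Poly_Mapping.lookup g n))"
proof -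
  have "f * g = (\<Sum>m\<in>A. Poly_Mapping.single m (Poly_Mapping.lookup f m)) *
      (\<Sum>m\<in>B. Poly_Mapping.single m (Poly_Mapping.lookup g m))"
    using poly_mapping_sum_single[of A f] poly_mapping_sum_single[of B g] assms by simp
  then show ?thesis by (simp add: sum_product mult_single)
qed

lemma forms_iff: "f \<in> forms t \<longleftrightarrow> (\<forall>m. Poly_Mapping.lookup f m \<noteq> 0 \<longrightarrow> mon_degree m = t)"
  by (auto simp: forms_def in_keys_iff)

lemma forms_zero [simp]: "0 \<in> forms t"
  by (simp add: forms_iff)

lemma forms_add: "f \<in> forms t \<Longrightarrow> g \<in> forms t \<Longrightarrow> f + g \<in> forms t"
  unfolding forms_iff lookup_add by (metis add.right_neutral)

lemma forms_uminus: "f \<in> forms t \<Longrightarrow> - f \<in> forms t"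
  unfolding forms_iff by simp

lemma forms_diff: "f \<in> forms t \<Longrightarrow> g \<in> forms t \<Longrightarrow> f - g \<in> forms t"
  using forms_add[of f t "-g"] forms_uminus[of g t] by simp

lemma forms_sum: "(\<And>x. x \<in> A \<Longrightarrow> f x \<in> forms t) \<Longrightarrow> sum f A \<in> forms t"
  by (induction A rule: infinite_finite_induct) (auto intro: forms_add)

lemma forms_mult: "f \<in> forms s \<Longrightarrow> g \<in> forms t \<Longrightarrow> f * g \<in> forms (s + t)"
  unfolding forms_def using keys_mult[of f g] by (fastforce simp: mon_degree_add)

lemma forms_single: "mon_degree m = t \<Longrightarrow> Poly_Mapping.single m c \<in> forms t"
  by (auto simp: forms_iff lookup_single when_def)

lemma forms_const [simp]: "const_poly c \<in> forms 0"
  unfolding const_poly_def by (rule forms_single) simp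

lemma forms_one [simp]: "1 \<in> forms 0"
  using forms_const[of 1] by (simp add: const_poly_def)

lemma forms_power: "f \<in> forms t \<Longrightarrow> f ^ k \<in> forms (t * k)"
  by (induction k) (auto dest: forms_mult[of f t] simp: add.commute)

lemma forms_power_1: "f \<in> forms 1 \<Longrightarrow> f ^ k \<in> forms k"
  using forms_power[of f 1 k] by simp

lemma forms_var [simp]: "var_poly v \<in> forms 1" "var_poly v \<in> forms (Suc 0)"
  unfolding var_poly_def by (auto intro!: forms_single)

lemma forms_const_mult: "f \<in> forms t \<Longrightarrow> const_poly c * f \<in> forms t"
  using forms_mult[of "const_poly c" 0 f t] by simp

section \<open>Homogeneous components\<close>

definition hcomp :: "nat \<Rightarrow> ('v, 'k::comm_ring_1) mpoly \<Rightarrow> ('v, 'k) mpoly" where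
  "hcomp t f = (\<Sum>m\<in>{m \<in> Poly_Mapping.keys f. mon_degree m = t}.
     Poly_Mapping.single m (Poly_Mapping.lookup f m))"

lemma lookup_hcomp:
  "Poly_Mapping.lookup (hcomp t f) m = (if mon_degree m = t then Poly_Mapping.lookup f m else 0)"
  by (auto simp: hcomp_def lookup_sum lookup_single when_def in_keys_iff sum.delta)

lemma hcomp_in_forms [simp]: "hcomp t f \<in> forms t"
  by (simp add: forms_iff lookup_hcomp)

lemma hcomp_zero [simp]: "hcomp t 0 = 0"
  by (rule poly_mapping_eqI) (simp add: lookup_hcomp)

lemma hcomp_add: "hcomp t (f + g) = hcomp t f + hcomp t g"
  by (rule poly_mapping_eqI) (simp add: lookup_hcomp lookup_add)

lemma hcomp_sum: "hcomp t (sum f A) = (\<Sum>x\<in>A. hcomp t (f x))"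
  by (induction A rule: infinite_finite_induct) (auto simp: hcomp_add)

lemma hcomp_forms: "f \<in> forms e \<Longrightarrow> hcomp t f = (if t = e then f else 0)"
  by (rule poly_mapping_eqI) (auto simp: lookup_hcomp forms_iff)

lemma sum_hcomp:
  assumes "finite A" "mon_degree ` Poly_Mapping.keys f \<subseteq> A"
  shows "f = (\<Sum>t\<in>A. hcomp t f)"
proof (rule poly_mapping_eqI)
  fix m
  have "Poly_Mapping.lookup (\<Sum>t\<in>A. hcomp t f) m =
      (if mon_degree m \<in> A then Poly_Mapping.lookup f m else 0)"
    using assms by (simp add: lookup_sum lookup_hcomp sum.delta')
  then show "Poly_Mapping.lookup f m = Poly_Mapping.lookup (\<Sum>t\<in>A. hcomp t f) m"
    using assms by (auto simp: in_keys_iff image_subset_iff)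
qed

lemma exists_sum_hcomp: "\<exists>N. f = (\<Sum>t\<le>N. hcomp t f)"
proof -
  obtain N where "\<forall>x\<in>mon_degree ` Poly_Mapping.keys f. x \<le> N"
    using finite_nat_set_iff_bounded_le[of "mon_degree ` Poly_Mapping.keys f"] by auto
  then have "f = (\<Sum>t\<in>{..N}. hcomp t f)" by (intro sum_hcomp) auto
  then show ?thesis by blast
qed

text \<open>A form only shifts degrees; the guard \<open>e \<le> t\<close> is there because
  \<open>t - e\<close> is truncated subtraction.\<close>

lemma hcomp_mult_forms:
  assumes g: "g \<in> forms e"
  shows "hcomp t (g * f) = (if e \<le> t then g * hcomp (t - e) f else 0)"
proof -
  obtain N where N: "f = (\<Sum>t\<le>N. hcomp t f)" using exists_sum_hcomp by blast
  have 1: "hcomp t (g * hcomp u f) = (if t = e + u then g * hcomp u f else 0)" for u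
    using hcomp_forms[OF forms_mult[OF g hcomp_in_forms[of u f]]] by simp
  have "hcomp t (g * f) = (\<Sum>u\<le>N. hcomp t (g * hcomp u f))"
    by (subst N) (simp add: sum_distrib_left hcomp_sum)
  also have "\<dots> = (\<Sum>u\<le>N. if u = t - e then if e \<le> t then g * hcomp u f else 0 else 0)"
    by (rule sum.cong) (auto simp: 1)
  also have "\<dots> = (if e \<le> t then if t - e \<le> N then g * hcomp (t - e) f else 0 else 0)"
    by (simp add: sum.delta)
  also have "\<dots> = (if e \<le> t then g * hcomp (t - e) f else 0)"
  proof -
    have "hcomp (t - e) f = 0" if "\<not> t - e \<le> N"
      by (subst N) (use that in \<open>simp add: hcomp_sum hcomp_forms[OF hcomp_in_forms]\<close>)
    then show ?thesis by auto
  qed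
  finally show ?thesis .
qed

text \<open>Trades generation by forms for closure under components, the shape in which homogeneity
  is used afterwards. The induction over \<open>c * s + y\<close> goes through because the form
  \<open>s\<close> merely shifts the components of \<open>c\<close>.\<close>

lemma homogeneous_ideal_iff:
  "homogeneous_ideal I \<longleftrightarrow> is_ideal I \<and> (\<forall>f\<in>I. \<forall>t. hcomp t f \<in> I)"
proof (intro iffI conjI ballI allI)
  assume h: "homogeneous_ideal I"
  then show I: "is_ideal I" by (simp add: homogeneous_ideal_def)
  fix f t assume "f \<in> I"
  then have "f \<in> ideal_generated (I \<inter> (\<Union>t. forms t))" using h by (simp add: homogeneous_ideal_def)
  then show "hcomp t f \<in> I"
  proof (induction rule: ideal_generated_induct)
    case zero then show ?case by (simp add: ideal_zero[OF I])
  next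
    case (step c s y)
    then obtain e where "s \<in> forms e" by auto
    with step show ?case
      by (auto simp: hcomp_add mult.commute[of c] hcomp_mult_forms
          intro!: ideal_add[OF I] ideal_mult_right[OF I])
  qed
next
  assume h: "is_ideal I \<and> (\<forall>f\<in>I. \<forall>t. hcomp t f \<in> I)"
  have "f \<in> ideal_generated (I \<inter> (\<Union>t. forms t))" if "f \<in> I" for f
  proof -
    obtain N where N: "f = (\<Sum>t\<le>N. hcomp t f)" using exists_sum_hcomp by blast
    have "hcomp t f \<in> ideal_generated (I \<inter> (\<Union>t. forms t))" for t
    proof -
      have "hcomp t f \<in> I \<inter> (\<Union>t. forms t)" using h that hcomp_in_forms[of t f] by blast
      then show ?thesis using ideal_generated_superset[of "I \<inter> (\<Union>t. forms t)"] by (rule rev_subsetD)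
    qed
    then show ?thesis by (subst N) (intro ideal_sum is_ideal_generated)
  qed
  then show "homogeneous_ideal I"
    using h by (auto simp: homogeneous_ideal_def dest: ideal_generated_minimal[OF Int_lower1, THEN subsetD, rotated])
qed

lemma homogeneous_is_ideal: "homogeneous_ideal I \<Longrightarrow> is_ideal I"
  by (simp add: homogeneous_ideal_def)

lemma homogeneous_hcomp: "homogeneous_ideal I \<Longrightarrow> f \<in> I \<Longrightarrow> hcomp t f \<in> I"
  by (simp add: homogeneous_ideal_iff)

lemma ideal_mem_hcompI: "is_ideal I \<Longrightarrow> (\<And>t. hcomp t f \<in> I) \<Longrightarrow> f \<in> I"
  using exists_sum_hcomp[of f] ideal_sum[of I] by metis

lemma homogeneous_ideal_generated:
  assumes "\<And>s. s \<in> S \<Longrightarrow> \<exists>e. s \<in> forms e"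
  shows "homogeneous_ideal (ideal_generated S)"
  unfolding homogeneous_ideal_iff
proof (intro conjI ballI allI is_ideal_generated)
  fix f t assume "f \<in> ideal_generated S"
  then show "hcomp t f \<in> ideal_generated S"
  proof (induction rule: ideal_generated_induct)
    case zero then show ?case by (simp add: ideal_zero[OF is_ideal_generated])
  next
    case (step c s y)
    from assms[OF step(1)] obtain e where "s \<in> forms e" by auto
    with step show ?case
      using ideal_generated_superset[of S]
      by (auto simp: hcomp_add mult.commute[of c] hcomp_mult_forms
          intro!: ideal_add[OF is_ideal_generated] ideal_mult_right[OF is_ideal_generated])
  qed
qed

lemma homogeneous_adjoin:
  assumes I: "homogeneous_ideal I" and g: "g \<in> forms e"
  shows "homogeneous_ideal (adjoin g I)"
  unfolding homogeneous_ideal_iff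
proof (intro conjI ballI allI is_ideal_adjoin homogeneous_is_ideal[OF I])
  fix f t assume "f \<in> adjoin g I"
  then obtain a b where "a \<in> I" "f = a + g * b" by (rule adjoinE)
  then show "hcomp t f \<in> adjoin g I"
    using adjoinI[of "hcomp t a" I g "hcomp (t - e) b"] adjoinI[of "hcomp t a" I g 0]
      homogeneous_hcomp[OF I]
    by (auto simp: hcomp_add hcomp_mult_forms[OF g])
qed

text \<open>Both summands can be replaced by their components in the degree of \<open>f\<close>, so
  cancellation in other degrees is removed from the representation.\<close>

lemma adjoin_formsE:
  assumes I: "homogeneous_ideal I" and g: "g \<in> forms e"
    and f: "f \<in> adjoin g I" "f \<in> forms (t + e)"
  obtains a b where "a \<in> I" "a \<in> forms (t + e)" "b \<in> forms t" "f = a + g * b"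
proof -
  obtain a b where ab: "a \<in> I" "f = a + g * b" using f(1) by (rule adjoinE)
  have "f = hcomp (t + e) f" using f(2) by (simp add: hcomp_forms)
  also have "\<dots> = hcomp (t + e) a + g * hcomp t b"
    by (simp add: ab(2) hcomp_add hcomp_mult_forms[OF g])
  finally show ?thesis using that homogeneous_hcomp[OF I ab(1)] hcomp_in_forms by blast
qed

lemma ideal_plus_formsE:
  assumes I: "homogeneous_ideal I" and J: "homogeneous_ideal J"
    and f: "f \<in> ideal_plus I J" "f \<in> forms t"
  obtains a b where "a \<in> I" "a \<in> forms t" "b \<in> J" "b \<in> forms t" "f = a + b"
proof -
  obtain a b where ab: "a \<in> I" "b \<in> J" "f = a + b" using f(1) by (auto simp: ideal_plus_def)
  have "f = hcomp t f" using f(2) by (simp add: hcomp_forms)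
  also have "\<dots> = hcomp t a + hcomp t b" by (simp add: ab(3) hcomp_add)
  finally show ?thesis
    using that homogeneous_hcomp[OF I ab(1)] homogeneous_hcomp[OF J ab(2)] hcomp_in_forms by blast
qed

lemma homogeneous_Inter:
  "(\<And>I. I \<in> A \<Longrightarrow> homogeneous_ideal I) \<Longrightarrow> homogeneous_ideal (\<Inter>A)"
  unfolding homogeneous_ideal_iff by (auto intro: is_ideal_Inter)

lemma forms_Suc_decompose:
  assumes "f \<in> forms (Suc t)"
  obtains g where "\<And>v. g v \<in> forms t" "f = (\<Sum>v\<in>(UNIV::'v::finite set). var_poly v * g v)"
proof -
  have "\<exists>v m'. m = Poly_Mapping.single v 1 + m' \<and> mon_degree m' = t"
    if "m \<in> Poly_Mapping.keys f" for m
  proof -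
    have "mon_degree m = Suc t" using that assms by (simp add: forms_def)
    then show ?thesis by (rule mon_degree_Suc) blast
  qed
  then obtain v m' where vm: "\<And>m. m \<in> Poly_Mapping.keys f \<Longrightarrow>
      m = Poly_Mapping.single (v m) 1 + m' m \<and> mon_degree (m' m) = t" by metis
  \<comment> \<open>Each monomial is charged to one chosen variable dividing it, so the fibres of
    \<open>v\<close> partition the keys of \<open>f\<close>.\<close>
  define g where "g w = (\<Sum>m\<in>{m\<in>Poly_Mapping.keys f. v m = w}.
      Poly_Mapping.single (m' m) (Poly_Mapping.lookup f m))" for w :: 'v
  have "g w \<in> forms t" for w
    unfolding g_def using vm by (intro forms_sum forms_single) auto
  moreover have "(\<Sum>w\<in>UNIV. var_poly w * g w) =
      (\<Sum>w\<in>UNIV. \<Sum>m\<in>{m\<in>Poly_Mapping.keys f. v m = w}. Poly_Mapping.single m (Poly_Mapping.lookup f m))"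
    unfolding g_def var_poly_def using vm
    by (intro sum.cong) (auto simp: sum_distrib_left mult_single intro!: sum.cong)
  then have "(\<Sum>w\<in>UNIV. var_poly w * g w) = f"
    using sum.group[of "Poly_Mapping.keys f" UNIV v "\<lambda>m. Poly_Mapping.single m (Poly_Mapping.lookup f m)"]
      poly_mapping_sum_single[of "Poly_Mapping.keys f" f] by simp
  ultimately show ?thesis using that[of g] by simp
qed

lemma forms_Suc_subset:
  fixes I :: "('v::finite, 'k::comm_ring_1) mpoly set"
  assumes I: "is_ideal I" and "forms t \<subseteq> I"
  shows "forms (Suc t) \<subseteq> I"
proof
  fix f :: "('v, 'k) mpoly" assume "f \<in> forms (Suc t)"
  then obtain g where "\<And>v. g v \<in> forms t" "f = (\<Sum>v\<in>UNIV. var_poly v * g v)"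
    by (rule forms_Suc_decompose) blast
  then show "f \<in> I" using assms by (auto intro!: ideal_sum[OF I] ideal_mult_left[OF I])
qed

lemma forms_subset_mono:
  fixes I :: "('v::finite, 'k::comm_ring_1) mpoly set"
  assumes "is_ideal I" "forms t \<subseteq> I" "t \<le> u"
  shows "forms u \<subseteq> I"
  using assms(3) by (induction rule: dec_induct) (simp_all add: assms forms_Suc_subset)

section \<open>Hilbert functions\<close>

lemma const_poly_simps:
  shows const_poly_0 [simp]: "const_poly 0 = 0"
    and const_poly_1 [simp]: "const_poly 1 = 1"
    and const_poly_add: "const_poly (a + b) = const_poly a + const_poly b"
    and const_poly_mult: "const_poly (a * b) = const_poly a * const_poly b"
    and const_poly_uminus: "const_poly (- a) = - const_poly a"
    and const_poly_diff: "const_poly (a - b) = const_poly a - const_poly b"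
  by (simp_all add: const_poly_def single_add mult_single single_uminus single_diff)

lemma lookup_const_poly_mult:
  "Poly_Mapping.lookup (const_poly c * f) m = c * Poly_Mapping.lookup f m"
  using mult_single_lookup[of 0 c f m] by (simp add: const_poly_def)

definition scale_poly :: "'k::field \<Rightarrow> ('v, 'k) mpoly \<Rightarrow> ('v, 'k) mpoly" where
  "scale_poly c f = const_poly c * f"

lemma vector_space_mpoly: "vector_space scale_poly"
  by unfold_locales (simp_all add: scale_poly_def const_poly_simps algebra_simps)

lemma const_poly_inverse_cancel:
  "c \<noteq> 0 \<Longrightarrow> const_poly (1 / c :: 'k::field) * (const_poly c * f) = f"
  by (simp add: mult.assoc[symmetric] const_poly_mult[symmetric])

lemma ideal_const_cancel:
  "is_ideal I \<Longrightarrow> c \<noteq> 0 \<Longrightarrow> const_poly (c :: 'k::field) * f \<in> I \<Longrightarrow> f \<in> I"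
  using const_poly_inverse_cancel[of c f] ideal_mult_left by metis

definition spans_mod :: "('v, 'k::field) mpoly set \<Rightarrow> ('v, 'k) mpoly set \<Rightarrow> ('v, 'k) mpoly set \<Rightarrow> bool" where
  "spans_mod I B S \<longleftrightarrow> finite B \<and> (\<forall>f\<in>S. \<exists>c. f - (\<Sum>b\<in>B. const_poly (c b) * b) \<in> I)"

lemma independent_mod_finite: "independent_mod I B \<Longrightarrow> finite B"
  unfolding independent_mod_def by (rule conjunct1)

lemma independent_modD:
  assumes "independent_mod I B" "(\<Sum>b\<in>B. const_poly (c b) * b) \<in> I" "b \<in> B"
  shows "c b = 0"
proof -
  from assms(1) have "\<forall>c. (\<Sum>b\<in>B. const_poly (c b) * b) \<in> I \<longrightarrow> (\<forall>b\<in>B. c b = 0)"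
    unfolding independent_mod_def by (rule conjunct2)
  from spec[OF this, of c] assms(2,3) show ?thesis by simp
qed

lemma spans_mod_subset: "spans_mod I B S \<Longrightarrow> S' \<subseteq> S \<Longrightarrow> spans_mod I B S'"
  unfolding spans_mod_def by blast

text \<open>Steinitz exchange without forming the quotient: each \<open>f\<close> in
  \<open>C\<close> is replaced by a congruent element \<open>p f\<close> of the span of
  \<open>B\<close>. Independence modulo \<open>I\<close> makes the elements \<open>p f\<close>
  distinct and independent in the polynomial ring itself, where the usual bound applies.\<close>

lemma card_independent_le_card_spanning:
  fixes I :: "('v, 'k::field) mpoly set"
  assumes I: "is_ideal I" and C: "independent_mod I C" and B: "spans_mod I B C"
  shows "card C \<le> card B"
proof -
  interpret V: vector_space "scale_poly :: 'k \<Rightarrow> ('v, 'k) mpoly \<Rightarrow> _"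
    by (rule vector_space_mpoly)
  have fC: "finite C" using C by (rule independent_mod_finite)
  from B have "\<forall>f\<in>C. \<exists>c. f - (\<Sum>b\<in>B. const_poly (c b) * b) \<in> I" by (simp add: spans_mod_def)
  from bchoice[OF this] obtain u
    where u: "\<And>f. f \<in> C \<Longrightarrow> f - (\<Sum>b\<in>B. const_poly (u f b) * b) \<in> I" by blast
  define p where "p f = (\<Sum>b\<in>B. const_poly (u f b) * b)" for f
  have key: "\<forall>f\<in>C. k f = 0" if "(\<Sum>f\<in>C. const_poly (k f) * p f) = 0" for k
  proof -
    have "(\<Sum>f\<in>C. const_poly (k f) * f) =
        (\<Sum>f\<in>C. const_poly (k f) * (f - p f)) + (\<Sum>f\<in>C. const_poly (k f) * p f)"
      unfolding sum.distrib[symmetric] by (rule sum.cong[OF refl]) (simp only: right_diff_distrib diff_add_cancel)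
    also have "\<dots> \<in> I"
      unfolding that using u by (auto simp: p_def intro!: ideal_sum[OF I] ideal_mult_left[OF I])
    finally show ?thesis using independent_modD[OF C] by blast
  qed
  have inj: "inj_on p C"
  proof (rule inj_onI, rule ccontr)
    fix a b assume ab: "a \<in> C" "b \<in> C" "p a = p b" "a \<noteq> b"
    have "(\<Sum>f\<in>C. const_poly (if f = a then 1 else if f = b then -1 else 0) * p f) =
        (\<Sum>f\<in>C. (if f = a then p f else 0) - (if f = b then p f else 0))"
      using ab by (intro sum.cong) (auto simp: const_poly_uminus)
    also have "\<dots> = 0" using ab fC by (simp add: sum_subtractf sum.delta)
    finally have "\<forall>f\<in>C. (if f = a then 1 else if f = b then -1 else 0 :: 'k) = 0" by (rule key)
    then show False using ab(1) by auto
  qed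
  have "V.independent (p ` C)"
  proof (rule ccontr)
    assume "\<not> V.independent (p ` C)"
    then obtain k where k: "\<exists>v\<in>p ` C. k v \<noteq> 0" "(\<Sum>v\<in>p ` C. const_poly (k v) * v) = 0"
      using V.dependent_finite[of "p ` C"] fC by (auto simp: scale_poly_def)
    then have "(\<Sum>f\<in>C. const_poly (k (p f)) * p f) = 0" by (simp add: sum.reindex[OF inj])
    from key[OF this] k(1) show False by auto
  qed
  moreover have "p ` C \<subseteq> V.span B"
    unfolding p_def scale_poly_def[symmetric]
    by (intro image_subsetI V.span_sum V.span_scale V.span_base)
  ultimately have "card (p ` C) \<le> card B"
    using V.independent_span_bound[of B "p ` C"] B by (simp add: spans_mod_def)
  then show ?thesis by (simp add: card_image[OF inj])
qed

lemma finite_monomials: "finite {m :: 'v::finite \<Rightarrow>\<^sub>0 nat. mon_degree m = t}"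
proof -
  have "Poly_Mapping.lookup ` {m :: 'v \<Rightarrow>\<^sub>0 nat. mon_degree m = t} \<subseteq> (UNIV :: 'v set) \<rightarrow>\<^sub>E {..t}"
  proof (clarsimp simp: PiE_UNIV_domain)
    fix m :: "'v \<Rightarrow>\<^sub>0 nat" and v
    have "mon_degree m = (\<Sum>v\<in>UNIV. Poly_Mapping.lookup m v)" by (rule mon_degree_superset) auto
    then show "Poly_Mapping.lookup m v \<le> mon_degree m" by (simp add: member_le_sum)
  qed
  then have "finite (Poly_Mapping.lookup ` {m :: 'v \<Rightarrow>\<^sub>0 nat. mon_degree m = t})"
    by (rule finite_subset) (simp add: finite_PiE)
  then show ?thesis by (rule finite_imageD) (intro inj_onI poly_mapping_eqI, simp)
qed

lemma forms_spanned:
  fixes I :: "('v::finite, 'k::field) mpoly set"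
  assumes I: "is_ideal I" and S: "S \<subseteq> forms t"
  shows "spans_mod I ((\<lambda>m. Poly_Mapping.single m 1) ` {m. mon_degree m = t}) S"
  unfolding spans_mod_def
proof (intro conjI ballI)
  let ?M = "{m :: 'v \<Rightarrow>\<^sub>0 nat. mon_degree m = t}"
  have inj: "inj_on (\<lambda>m. Poly_Mapping.single m (1::'k)) ?M"
    by (rule inj_onI) (metis keys_single one_neq_zero singleton_inject)
  show "finite ((\<lambda>m. Poly_Mapping.single m (1::'k)) ` ?M)" by (simp add: finite_monomials)
  fix f assume "f \<in> S"
  then have "Poly_Mapping.keys f \<subseteq> ?M" using S by (auto simp: forms_def)
  then have f: "f = (\<Sum>m\<in>?M. Poly_Mapping.single m (Poly_Mapping.lookup f m))"
    by (rule poly_mapping_sum_single[OF finite_monomials])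
  define c where "c b = Poly_Mapping.lookup f (THE m. b = Poly_Mapping.single m (1::'k))"
    for b :: "('v, 'k) mpoly"
  have c: "c (Poly_Mapping.single m 1) = Poly_Mapping.lookup f m" for m
  proof -
    have "(THE m'. Poly_Mapping.single m (1::'k) = Poly_Mapping.single m' 1) = m"
      by (rule the_equality) (auto, metis keys_single one_neq_zero singleton_inject)
    then show ?thesis by (simp add: c_def)
  qed
  have "(\<Sum>b\<in>(\<lambda>m. Poly_Mapping.single m (1::'k)) ` ?M. const_poly (c b) * b) =
      (\<Sum>m\<in>?M. Poly_Mapping.single m (Poly_Mapping.lookup f m))"
    by (subst sum.reindex[OF inj]) (simp add: c const_poly_def mult_single)
  then have "f - (\<Sum>b\<in>(\<lambda>m. Poly_Mapping.single m (1::'k)) ` ?M. const_poly (c b) * b) \<in> I"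
    using f ideal_zero[OF I] by simp
  then show "\<exists>c. f - (\<Sum>b\<in>(\<lambda>m. Poly_Mapping.single m (1::'k)) ` ?M. const_poly (c b) * b) \<in> I"
    by (rule exI[of _ c])
qed

lemma independent_mod_empty: "independent_mod I {}"
  unfolding independent_mod_def by simp

lemma bdd_independent_mod:
  fixes I :: "('v::finite, 'k::field) mpoly set"
  assumes I: "is_ideal I"
  shows "\<exists>N. \<forall>B. B \<subseteq> forms t \<and> independent_mod I B \<longrightarrow> card B \<le> N"
proof (intro exI allI impI, elim conjE)
  fix B assume "B \<subseteq> forms t" "independent_mod I B"
  then show "card B \<le> card ((\<lambda>m. Poly_Mapping.single m (1::'k)) ` {m :: 'v \<Rightarrow>\<^sub>0 nat. mon_degree m = t})"
    by (intro card_independent_le_card_spanning[OF I _ forms_spanned[OF I]])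
qed

text \<open>An independent set of largest cardinality spans; the cardinalities are bounded by the
  number of monomials. With \<open>S = UNIV\<close> this gives a basis of \<open>R/I\<close> in
  degree \<open>t\<close>, with an ideal \<open>S = J\<close> containing \<open>I\<close> a basis of
  \<open>J/I\<close>.\<close>

lemma exists_rel_basis:
  fixes I :: "('v::finite, 'k::field) mpoly set"
  assumes I: "is_ideal I"
  obtains D where "D \<subseteq> forms t \<inter> S" "independent_mod I D" "spans_mod I D (forms t \<inter> S)"
proof -
  let ?P = "\<lambda>D. D \<subseteq> forms t \<inter> S \<and> independent_mod I D"
  obtain N where "\<forall>B. B \<subseteq> forms t \<and> independent_mod I B \<longrightarrow> card B \<le> N"
    using bdd_independent_mod[OF I] by blast
  then have "\<forall>B. ?P B \<longrightarrow> card B < Suc N" by (simp add: less_Suc_eq_le)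
  moreover have "?P {}" by (simp add: independent_mod_empty)
  ultimately have "\<exists>D. ?P D \<and> (\<forall>B. ?P B \<longrightarrow> card B \<le> card D)"
    by (intro ex_has_greatest_nat)
  then obtain D where D: "?P D" and max: "\<And>B. ?P B \<Longrightarrow> card B \<le> card D"
    by blast
  have fin: "finite D" using D independent_mod_finite by blast
  have "\<exists>c. f - (\<Sum>b\<in>D. const_poly (c b) * b) \<in> I" if f: "f \<in> forms t \<inter> S" for f
  proof (cases "f \<in> D")
    case True
    have "(\<Sum>b\<in>D. const_poly (if b = f then 1 else 0) * b) = (\<Sum>b\<in>D. if b = f then b else 0)"
      by (rule sum.cong) auto
    then have "f - (\<Sum>b\<in>D. const_poly (if b = f then 1 else 0) * b) \<in> I"
      using True fin ideal_zero[OF I] by (simp add: sum.delta)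
    then show ?thesis by (intro exI)
  next
    case False
    have "\<not> independent_mod I (insert f D)"
    proof
      assume "independent_mod I (insert f D)"
      then have "card (insert f D) \<le> card D" using max[of "insert f D"] f D by blast
      then show False using False fin by simp
    qed
    then obtain c b0 where c: "(\<Sum>b\<in>insert f D. const_poly (c b) * b) \<in> I" "b0 \<in> insert f D" "c b0 \<noteq> 0"
      using fin unfolding independent_mod_def by auto
    have eq: "(\<Sum>b\<in>insert f D. const_poly (c b) * b) = const_poly (c f) * f + (\<Sum>b\<in>D. const_poly (c b) * b)"
      using False fin by simp
    have "c f \<noteq> 0"
    proof
      assume "c f = 0"
      then have "(\<Sum>b\<in>D. const_poly (c b) * b) \<in> I" using c(1) eq by simp
      then show False using independent_modD[of I D c b0] D c(2,3) \<open>c f = 0\<close> by blast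
    qed
    then have "const_poly (1 / c f) * (const_poly (c f) * f + (\<Sum>b\<in>D. const_poly (c b) * b)) =
        f - (\<Sum>b\<in>D. const_poly (- c b / c f) * b)"
      by (simp add: distrib_left const_poly_inverse_cancel sum_distrib_left
          mult.assoc[symmetric] const_poly_mult[symmetric] sum_negf[symmetric] const_poly_uminus)
    then have "f - (\<Sum>b\<in>D. const_poly (- c b / c f) * b) \<in> I"
      using ideal_mult_left[OF I c(1), of "const_poly (1 / c f)"] eq by simp
    then show ?thesis by (intro exI[of _ "\<lambda>b. - c b / c f"])
  qed
  then have "spans_mod I D (forms t \<inter> S)" using fin by (simp add: spans_mod_def)
  then show ?thesis using that D by blast
qed

lemma independent_mod_notin:
  assumes "independent_mod I B" "b \<in> B"
  shows "b \<notin> I"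
proof
  assume "b \<in> I"
  have "(\<Sum>x\<in>B. const_poly (if x = b then 1 else 0) * x) = (\<Sum>x\<in>B. if x = b then x else 0)"
    by (rule sum.cong) auto
  then have "(\<Sum>x\<in>B. const_poly (if x = b then 1 else 0) * x) \<in> I"
    using assms(2) independent_mod_finite[OF assms(1)] \<open>b \<in> I\<close> by (simp add: sum.delta)
  from independent_modD[OF assms(1) this assms(2)] show False by simp
qed

lemma hilbert_fun_eq:
  fixes I :: "('v::finite, 'k::field) mpoly set"
  assumes I: "is_ideal I" and B: "B \<subseteq> forms t" "independent_mod I B" "spans_mod I B (forms t)"
  shows "hilbert_fun I t = card B"
  unfolding hilbert_fun_def
proof (rule Max_eqI)
  have le: "card C \<le> card B" if "C \<subseteq> forms t" "independent_mod I C" for C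
    using card_independent_le_card_spanning[OF I that(2) spans_mod_subset[OF B(3) that(1)]] .
  then show "finite {card B | B. B \<subseteq> forms t \<and> independent_mod I B}"
    by (intro finite_subset[OF _ finite_atMost[of "card B"]]) auto
  show "\<And>y. y \<in> {card B | B. B \<subseteq> forms t \<and> independent_mod I B} \<Longrightarrow> y \<le> card B"
    using le by auto
qed (use B in auto)

text \<open>Exactness of \<open>0 -> J/I -> R/I -> R/J -> 0\<close> in degree \<open>t\<close>: the
  basis \<open>D\<close> of \<open>J/I\<close> and any basis of \<open>R/J\<close> together form a
  basis of \<open>R/I\<close>.\<close>

lemma hilbert_fun_extension:
  fixes I J :: "('v::finite, 'k::field) mpoly set"
  assumes I: "is_ideal I" and J: "is_ideal J" and "I \<subseteq> J"
    and D: "D \<subseteq> forms t \<inter> J" "independent_mod I D" "spans_mod I D (forms t \<inter> J)"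
  shows "hilbert_fun I t = hilbert_fun J t + card D"
proof -
  obtain E where E: "E \<subseteq> forms t" "independent_mod J E" "spans_mod J E (forms t)"
    using exists_rel_basis[OF J, of t UNIV] by auto
  have fin: "finite D" "finite E" using D(2) E(2) by (auto intro: independent_mod_finite)
  have disj: "D \<inter> E = {}" using independent_mod_notin[OF E(2)] D(1) by auto
  have split: "(\<Sum>b\<in>D \<union> E. g b) = (\<Sum>b\<in>D. g b) + (\<Sum>b\<in>E. g b)" for g :: "_ \<Rightarrow> ('v, 'k) mpoly"
    using fin disj by (rule sum.union_disjoint)
  have "hilbert_fun I t = card (D \<union> E)"
  proof (rule hilbert_fun_eq[OF I])
    show "D \<union> E \<subseteq> forms t" using D E by auto
    show "independent_mod I (D \<union> E)"
      unfolding independent_mod_def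
    proof (intro conjI allI impI)
      fix c assume c: "(\<Sum>b\<in>D \<union> E. const_poly (c b) * b) \<in> I"
      have DJ: "(\<Sum>b\<in>D. const_poly (c b) * b) \<in> J"
        using D(1) by (auto intro!: ideal_sum[OF J] ideal_mult_left[OF J])
      have "(\<Sum>b\<in>E. const_poly (c b) * b) \<in> J"
        using c \<open>I \<subseteq> J\<close> ideal_diff[OF J _ DJ, of "\<Sum>b\<in>D \<union> E. const_poly (c b) * b"]
        unfolding split by auto
      then have 0: "\<And>b. b \<in> E \<Longrightarrow> c b = 0" using independent_modD[OF E(2)] by blast
      then have "(\<Sum>b\<in>D. const_poly (c b) * b) \<in> I" using c unfolding split by simp
      then show "\<forall>b\<in>D \<union> E. c b = 0" using 0 independent_modD[OF D(2)] by blast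
    qed (use fin in auto)
    show "spans_mod I (D \<union> E) (forms t)"
      unfolding spans_mod_def
    proof (intro conjI ballI)
      fix f :: "('v, 'k) mpoly" assume f: "f \<in> forms t"
      then obtain c where c: "f - (\<Sum>b\<in>E. const_poly (c b) * b) \<in> J"
        using E(3) by (auto simp: spans_mod_def)
      have "f - (\<Sum>b\<in>E. const_poly (c b) * b) \<in> forms t"
        using f E(1) by (auto intro!: forms_diff forms_sum forms_const_mult)
      then obtain c' where c': "f - (\<Sum>b\<in>E. const_poly (c b) * b) - (\<Sum>b\<in>D. const_poly (c' b) * b) \<in> I"
        using D(3) c by (auto simp: spans_mod_def)
      have "(\<Sum>b\<in>D. const_poly (if b \<in> D then c' b else c b) * b) = (\<Sum>b\<in>D. const_poly (c' b) * b)"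
        by (rule sum.cong) auto
      moreover have "(\<Sum>b\<in>E. const_poly (if b \<in> D then c' b else c b) * b) = (\<Sum>b\<in>E. const_poly (c b) * b)"
        using disj by (intro sum.cong) auto
      ultimately have "f - (\<Sum>b\<in>D \<union> E. const_poly (if b \<in> D then c' b else c b) * b) \<in> I"
        using c' unfolding split by (simp add: algebra_simps)
      then show "\<exists>c. f - (\<Sum>b\<in>D \<union> E. const_poly (c b) * b) \<in> I"
        by (intro exI[of _ "\<lambda>b. if b \<in> D then c' b else c b"])
    qed (use fin in auto)
  qed
  also have "\<dots> = hilbert_fun J t + card D"
    using hilbert_fun_eq[OF J E] card_Un_disjoint[OF fin disj] by simp
  finally show ?thesis .
qed

lemma hilbert_fun_antimono:
  fixes I J :: "('v::finite, 'k::field) mpoly set"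
  assumes "is_ideal I" "is_ideal J" "I \<subseteq> J"
  shows "hilbert_fun J t \<le> hilbert_fun I t"
proof -
  obtain D where D: "D \<subseteq> forms t \<inter> J" "independent_mod I D" "spans_mod I D (forms t \<inter> J)"
    by (rule exists_rel_basis[OF assms(1)])
  then show ?thesis using hilbert_fun_extension[OF assms D] by simp
qed

text \<open>Equal dimensions leave an empty basis for \<open>J/I\<close> in degree \<open>t\<close>.
  Dimension counts are turned back into membership through this.\<close>

lemma hilbert_fun_eq_imp_subset:
  fixes I J :: "('v::finite, 'k::field) mpoly set"
  assumes "is_ideal I" "is_ideal J" "I \<subseteq> J" "hilbert_fun I t = hilbert_fun J t"
    and f: "f \<in> J" "f \<in> forms t"
  shows "f \<in> I"
proof -
  obtain D where D: "D \<subseteq> forms t \<inter> J" "independent_mod I D" "spans_mod I D (forms t \<inter> J)"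
    by (rule exists_rel_basis[OF assms(1)])
  then have "card D = 0" using hilbert_fun_extension[OF assms(1-3) D] assms(4) by simp
  then have "D = {}" using independent_mod_finite[OF D(2)] by simp
  then show ?thesis using D(3) f by (auto simp: spans_mod_def)
qed

lemma hilbert_fun_cong:
  fixes I J :: "('v::finite, 'k::field) mpoly set"
  assumes "I \<inter> forms t = J \<inter> forms t"
  shows "hilbert_fun I t = hilbert_fun J t"
proof -
  have "(\<Sum>b\<in>B. const_poly (c b) * b) \<in> I \<longleftrightarrow> (\<Sum>b\<in>B. const_poly (c b) * b) \<in> J"
    if "B \<subseteq> forms t" for B c
  proof -
    have "(\<Sum>b\<in>B. const_poly (c b) * b) \<in> forms t"
      using that by (auto intro!: forms_sum forms_const_mult)
    then show ?thesis using assms by auto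
  qed
  then have "{card B | B. B \<subseteq> forms t \<and> independent_mod I B} = {card B | B. B \<subseteq> forms t \<and> independent_mod J B}"
    unfolding independent_mod_def by auto
  then show ?thesis by (simp add: hilbert_fun_def)
qed

lemma hilbert_fun_UNIV: "hilbert_fun (UNIV :: ('v::finite, 'k::field) mpoly set) t = 0"
  using hilbert_fun_eq[OF is_ideal_UNIV, of "{}" t]
  by (simp add: independent_mod_empty spans_mod_def)

lemma hilbert_fun_eq_0_iff:
  fixes I :: "('v::finite, 'k::field) mpoly set"
  assumes I: "is_ideal I"
  shows "hilbert_fun I t = 0 \<longleftrightarrow> forms t \<subseteq> I"
proof
  assume "hilbert_fun I t = 0"
  then show "forms t \<subseteq> I"
    using hilbert_fun_eq_imp_subset[OF I is_ideal_UNIV] by (auto simp: hilbert_fun_UNIV)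
next
  assume "forms t \<subseteq> I"
  then have "I \<inter> forms t = UNIV \<inter> forms t" by auto
  from hilbert_fun_cong[OF this] show "hilbert_fun I t = 0" by (simp add: hilbert_fun_UNIV)
qed

section \<open>Colon ideals and exact sequences of Hilbert functions\<close>

definition colon :: "'a::comm_ring_1 set \<Rightarrow> 'a \<Rightarrow> 'a set" where
  "colon I g = {f. g * f \<in> I}"

lemma is_ideal_colon: "is_ideal I \<Longrightarrow> is_ideal (colon I g)"
  unfolding is_ideal_iff[of "colon I g"]
  by (auto simp: colon_def distrib_left mult.left_commute ideal_zero ideal_add ideal_mult_left)

lemma subset_colon: "is_ideal I \<Longrightarrow> I \<subseteq> colon I g"
  by (auto simp: colon_def ideal_mult_left)

text \<open>The sequence \<open>0 -> R/(I : g) -> R/I -> R/(I, g) -> 0\<close>, whose first map is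
  multiplication by \<open>g\<close> and raises degrees by \<open>e\<close>: the products of
  \<open>g\<close> with a basis of \<open>R/(I : g)\<close> form a basis of
  \<open>(I, g)/I\<close>.\<close>

lemma hilbert_fun_colon:
  fixes I :: "('v::finite, 'k::field) mpoly set"
  assumes I: "homogeneous_ideal I" and g: "g \<in> forms e"
  shows "hilbert_fun I (t + e) = hilbert_fun (colon I g) t + hilbert_fun (adjoin g I) (t + e)"
proof -
  note I' = homogeneous_is_ideal[OF I]
  note C = is_ideal_colon[OF I', of g]
  obtain B where B: "B \<subseteq> forms t" "independent_mod (colon I g) B" "spans_mod (colon I g) B (forms t)"
    using exists_rel_basis[OF C, of t UNIV] by auto
  have fin: "finite B" using B(2) by (rule independent_mod_finite)
  have inj: "inj_on ((*) g) B"
  proof (rule inj_onI, rule ccontr)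
    fix a b assume ab: "a \<in> B" "b \<in> B" "g * a = g * b" "a \<noteq> b"
    have "(\<Sum>x\<in>B. const_poly (if x = a then 1 else if x = b then -1 else 0) * x) =
        (\<Sum>x\<in>B. (if x = a then x else 0) - (if x = b then x else 0))"
      using ab by (intro sum.cong) (auto simp: const_poly_uminus)
    also have "\<dots> = a - b" using ab fin by (simp add: sum_subtractf sum.delta)
    also have "\<dots> \<in> colon I g" using ab ideal_zero[OF I'] by (simp add: colon_def right_diff_distrib)
    finally show False using independent_modD[OF B(2) _ ab(1)] by fastforce
  qed
  have image: "(\<Sum>b\<in>(*) g ` B. const_poly (c b) * b) = g * (\<Sum>b\<in>B. const_poly (c (g * b)) * b)" for c
    by (simp add: sum.reindex[OF inj] sum_distrib_left mult.left_commute)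
  have "hilbert_fun I (t + e) = hilbert_fun (adjoin g I) (t + e) + card ((*) g ` B)"
  proof (rule hilbert_fun_extension[OF I' is_ideal_adjoin[OF I'] subset_adjoin])
    show "(*) g ` B \<subseteq> forms (t + e) \<inter> adjoin g I"
      using B(1) forms_mult[OF g, of _ t] mem_adjoin[OF I'] by (auto simp: add.commute[of t])
    show "independent_mod I ((*) g ` B)"
      unfolding independent_mod_def
    proof (intro conjI allI impI)
      fix c assume "(\<Sum>b\<in>(*) g ` B. const_poly (c b) * b) \<in> I"
      then have "(\<Sum>b\<in>B. const_poly (c (g * b)) * b) \<in> colon I g"
        unfolding image by (simp add: colon_def)
      then show "\<forall>b\<in>(*) g ` B. c b = 0"
        using independent_modD[OF B(2), of "\<lambda>b. c (g * b)"] by auto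
    qed (use fin in simp)
    show "spans_mod I ((*) g ` B) (forms (t + e) \<inter> adjoin g I)"
      unfolding spans_mod_def
    proof (intro conjI ballI)
      fix f assume "f \<in> forms (t + e) \<inter> adjoin g I"
      then obtain a b where ab: "a \<in> I" "b \<in> forms t" "f = a + g * b"
        using adjoin_formsE[OF I g] by blast
      then obtain c where c: "b - (\<Sum>b\<in>B. const_poly (c b) * b) \<in> colon I g"
        using B(3) by (auto simp: spans_mod_def)
      \<comment> \<open>Coefficients are indexed by the products \<open>g * b\<close>, so those
        found for \<open>B\<close> are reindexed along the injection.\<close>
      define c' where "c' x = c (the_inv_into B ((*) g) x)" for x
      have "(\<Sum>b\<in>B. const_poly (c' (g * b)) * b) = (\<Sum>b\<in>B. const_poly (c b) * b)"
        by (rule sum.cong) (auto simp: c'_def the_inv_into_f_f[OF inj])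
      then have "f - (\<Sum>b\<in>(*) g ` B. const_poly (c' b) * b) = a + g * (b - (\<Sum>b\<in>B. const_poly (c b) * b))"
        unfolding image ab(3) by (simp add: algebra_simps)
      also have "\<dots> \<in> I" using c ab(1) by (auto simp: colon_def intro: ideal_add[OF I'])
      finally show "\<exists>c. f - (\<Sum>b\<in>(*) g ` B. const_poly (c b) * b) \<in> I" by (rule exI[of _ c'])
    qed (use fin in simp)
  qed
  then show ?thesis using hilbert_fun_eq[OF C B] card_image[OF inj] by simp
qed

lemma hilbert_fun_nonzerodivisor:
  fixes I :: "('v::finite, 'k::field) mpoly set"
  assumes I: "homogeneous_ideal I" and g: "g \<in> forms e"
    and inj: "\<And>f. f \<in> forms t \<Longrightarrow> g * f \<in> I \<Longrightarrow> f \<in> I"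
  shows "hilbert_fun I (t + e) = hilbert_fun I t + hilbert_fun (adjoin g I) (t + e)"
proof -
  have "colon I g \<inter> forms t = I \<inter> forms t"
    using inj subset_colon[OF homogeneous_is_ideal[OF I], of g] by (auto simp: colon_def)
  from hilbert_fun_cong[OF this] show ?thesis using hilbert_fun_colon[OF I g, of t] by simp
qed

text \<open>Second isomorphism theorem: one and the same set \<open>D\<close> is a basis of
  \<open>J\<close> modulo \<open>I \<inter> J\<close> and of \<open>I + J\<close> modulo
  \<open>I\<close> in degree \<open>t\<close>.\<close>

lemma hilbert_fun_modular:
  fixes I J :: "('v::finite, 'k::field) mpoly set"
  assumes I: "homogeneous_ideal I" and J: "homogeneous_ideal J"
  shows "hilbert_fun (I \<inter> J) t + hilbert_fun (ideal_plus I J) t = hilbert_fun I t + hilbert_fun J t"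
proof -
  note I' = homogeneous_is_ideal[OF I] and J' = homogeneous_is_ideal[OF J]
  have IJ: "is_ideal (I \<inter> J)" using I' J' is_ideal_Inter[of "{I, J}"] by auto
  obtain D where D: "D \<subseteq> forms t \<inter> J" "independent_mod (I \<inter> J) D" "spans_mod (I \<inter> J) D (forms t \<inter> J)"
    by (rule exists_rel_basis[OF IJ])
  have 1: "hilbert_fun (I \<inter> J) t = hilbert_fun J t + card D"
    by (rule hilbert_fun_extension[OF IJ J' _ D]) auto
  have "hilbert_fun I t = hilbert_fun (ideal_plus I J) t + card D"
  proof (rule hilbert_fun_extension[OF I' is_ideal_plus[OF I' J'] ideal_plus_upper1[OF I' J']])
    show "D \<subseteq> forms t \<inter> ideal_plus I J" using D ideal_plus_upper2[OF I' J'] by auto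
    show "independent_mod I D"
      unfolding independent_mod_def
    proof (intro conjI allI impI)
      fix c assume "(\<Sum>b\<in>D. const_poly (c b) * b) \<in> I"
      moreover have "(\<Sum>b\<in>D. const_poly (c b) * b) \<in> J"
        using D(1) by (auto intro!: ideal_sum[OF J'] ideal_mult_left[OF J'])
      ultimately have "(\<Sum>b\<in>D. const_poly (c b) * b) \<in> I \<inter> J" by blast
      then show "\<forall>b\<in>D. c b = 0" using independent_modD[OF D(2), of c] by auto
    qed (rule independent_mod_finite[OF D(2)])
    show "spans_mod I D (forms t \<inter> ideal_plus I J)"
      unfolding spans_mod_def
    proof (intro conjI ballI)
      fix f assume "f \<in> forms t \<inter> ideal_plus I J"
      then obtain a b where ab: "a \<in> I" "b \<in> J" "b \<in> forms t" "f = a + b"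
        using ideal_plus_formsE[OF I J] by blast
      then obtain c where "b - (\<Sum>b\<in>D. const_poly (c b) * b) \<in> I" using D(3) by (auto simp: spans_mod_def)
      then have "f - (\<Sum>b\<in>D. const_poly (c b) * b) \<in> I"
        unfolding ab(4) add_diff_eq[symmetric] by (rule ideal_add[OF I' ab(1)])
      then show "\<exists>c. f - (\<Sum>b\<in>D. const_poly (c b) * b) \<in> I" by (rule exI[of _ c])
    qed (rule independent_mod_finite[OF D(2)])
  qed
  then show ?thesis using 1 by simp
qed

section \<open>Homogeneous primes and closed points\<close>

lemma prime_idealD:
  assumes "prime_ideal P"
  shows prime_is_ideal: "is_ideal P" and prime_neq_UNIV: "P \<noteq> UNIV"
    and prime_mult: "a * b \<in> P \<Longrightarrow> a \<in> P \<or> b \<in> P"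
  using assms unfolding prime_ideal_def by auto

lemma prime_power: "prime_ideal P \<Longrightarrow> a ^ k \<in> P \<Longrightarrow> a \<in> P"
proof (induction k)
  case 0
  then show ?case using ideal_one_iff[OF prime_is_ideal] prime_neq_UNIV by fastforce
next
  case (Suc k) then show ?case using prime_mult[of P a "a ^ k"] by auto
qed

text \<open>Take the lowest components of \<open>a\<close> and \<open>b\<close> outside
  \<open>P\<close>, of degrees \<open>i\<close> and \<open>j\<close>. In the component of
  \<open>a * b\<close> of degree \<open>i + j\<close>, every term except their product lies in
  \<open>P\<close>.\<close>

lemma prime_ideal_forms:
  fixes P :: "('v, 'k::comm_ring_1) mpoly set"
  assumes P: "homogeneous_ideal P" "P \<noteq> UNIV"
    and prime: "\<And>s t f g. f \<in> forms s \<Longrightarrow> g \<in> forms t \<Longrightarrow> f * g \<in> P \<Longrightarrow> f \<in> P \<or> g \<in> P"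
  shows "prime_ideal P"
  unfolding prime_ideal_def
proof (intro conjI allI impI)
  show I: "is_ideal P" using P(1) by (rule homogeneous_is_ideal)
  show "P \<noteq> UNIV" by (rule P(2))
  fix a b assume ab: "a * b \<in> P"
  show "a \<in> P \<or> b \<in> P"
  proof (rule ccontr)
    assume "\<not> (a \<in> P \<or> b \<in> P)"
    then obtain i0 j0 where "hcomp i0 a \<notin> P" "hcomp j0 b \<notin> P"
      using ideal_mem_hcompI[OF I] by blast
    then obtain i j where i: "hcomp i a \<notin> P" "\<And>k. k < i \<Longrightarrow> hcomp k a \<in> P"
      and j: "hcomp j b \<notin> P" "\<And>k. k < j \<Longrightarrow> hcomp k b \<in> P"
      using exists_least_iff[of "\<lambda>i. hcomp i a \<notin> P"] exists_least_iff[of "\<lambda>i. hcomp i b \<notin> P"]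
      by blast
    obtain N where N: "a = (\<Sum>k\<le>N. hcomp k a)" using exists_sum_hcomp by blast
    have iN: "i \<le> N"
    proof (rule ccontr)
      assume "\<not> i \<le> N"
      then have "hcomp i (\<Sum>k\<le>N. hcomp k a) = 0"
        by (simp add: hcomp_sum hcomp_forms[OF hcomp_in_forms])
      then show False using i(1) N ideal_zero[OF I] by simp
    qed
    have "hcomp (i + j) (a * b) = (\<Sum>k\<le>N. hcomp (i + j) (hcomp k a * b))"
      by (subst N) (simp add: sum_distrib_right hcomp_sum)
    also have "\<dots> = hcomp (i + j) (hcomp i a * b) + (\<Sum>k\<in>{..N} - {i}. hcomp (i + j) (hcomp k a * b))"
      using iN by (simp add: sum.remove)
    also have "hcomp (i + j) (hcomp i a * b) = hcomp i a * hcomp j b"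
      by (simp add: hcomp_mult_forms[OF hcomp_in_forms])
    finally have eq: "hcomp (i + j) (a * b) =
      hcomp i a * hcomp j b + (\<Sum>k\<in>{..N} - {i}. hcomp (i + j) (hcomp k a * b))" .
    have "(\<Sum>k\<in>{..N} - {i}. hcomp (i + j) (hcomp k a * b)) \<in> P"
    proof (rule ideal_sum[OF I])
      fix k assume k: "k \<in> {..N} - {i}"
      show "hcomp (i + j) (hcomp k a * b) \<in> P"
      proof (cases "k < i")
        case True
        then show ?thesis using i(2) homogeneous_hcomp[OF P(1) ideal_mult_right[OF I]] by blast
      next
        \<comment> \<open>Now \<open>k > i\<close>: the matching component of \<open>b\<close> has
          degree below \<open>j\<close> and lies in \<open>P\<close>, or \<open>k > i + j\<close>
          and the term is zero.\<close>
        case False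
        then show ?thesis
          using k j(2)[of "i + j - k"] ideal_zero[OF I]
          by (auto simp: hcomp_mult_forms[OF hcomp_in_forms] intro!: ideal_mult_left[OF I])
      qed
    qed
    then have "hcomp i a * hcomp j b \<in> P"
      using ideal_diff[OF I homogeneous_hcomp[OF P(1) ab]] eq by (metis add_diff_cancel_right')
    then show False using prime[OF hcomp_in_forms hcomp_in_forms] i(1) j(1) by blast
  qed
qed

text \<open>Krull's argument with Zorn's lemma over homogeneous ideals only. A maximal one is still
  prime, because primality may be tested on forms and adjoining a form preserves homogeneity. The
  set \<open>T\<close> may contain inhomogeneous elements, which matters when a chain of length one
  is constructed.\<close>

lemma exists_prime_avoiding:
  fixes I :: "('v, 'k::comm_ring_1) mpoly set"
  assumes I: "homogeneous_ideal I" and T: "1 \<in> T" "\<And>x y. x \<in> T \<Longrightarrow> y \<in> T \<Longrightarrow> x * y \<in> T"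
    and disj: "I \<inter> T = {}"
  obtains P where "prime_ideal P" "homogeneous_ideal P" "I \<subseteq> P" "P \<inter> T = {}"
proof -
  define \<A> where "\<A> = {P. homogeneous_ideal P \<and> I \<subseteq> P \<and> P \<inter> T = {}}"
  have "\<exists>M\<in>\<A>. \<forall>X\<in>\<A>. M \<subseteq> X \<longrightarrow> X = M"
  proof (rule subset_Zorn_nonempty)
    show "\<A> \<noteq> {}" using I disj by (auto simp: \<A>_def)
    fix C assume C: "C \<noteq> {}" "subset.chain \<A> C"
    then have CA: "X \<in> \<A>" if "X \<in> C" for X using that by (auto simp: subset.chain_def)
    have "is_ideal (\<Union>C)"
      unfolding is_ideal_iff
    proof (intro conjI ballI allI)
      have X: "is_ideal X" if "X \<in> C" for X
        using CA[OF that] by (simp add: \<A>_def homogeneous_is_ideal)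
      then show "0 \<in> \<Union>C" using C(1) ideal_zero by blast
      show "c * x \<in> \<Union>C" if "x \<in> \<Union>C" for c x using that X ideal_mult_left by blast
      fix x y assume "x \<in> \<Union>C" "y \<in> \<Union>C"
      then obtain X Y where XY: "X \<in> C" "Y \<in> C" "x \<in> X" "y \<in> Y" by blast
      then consider "X \<subseteq> Y" | "Y \<subseteq> X" using C(2) by (auto simp: subset_chain_def)
      then show "x + y \<in> \<Union>C"
        using XY X[OF XY(1)] X[OF XY(2)] by cases (blast intro: ideal_add)+
    qed
    moreover have "hcomp t f \<in> \<Union>C" if f: "f \<in> \<Union>C" for f t
    proof -
      obtain X where "X \<in> C" "f \<in> X" using f by blast
      then show ?thesis using CA[of X] homogeneous_hcomp[of X f t] by (auto simp: \<A>_def)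
    qed
    ultimately have "homogeneous_ideal (\<Union>C)" by (simp add: homogeneous_ideal_iff)
    moreover have "I \<subseteq> \<Union>C" using C(1) CA by (auto simp: \<A>_def)
    moreover have "\<Union>C \<inter> T = {}" using CA by (auto simp: \<A>_def)
    ultimately show "\<Union>C \<in> \<A>" by (simp add: \<A>_def)
  qed
  then obtain P where PA: "P \<in> \<A>" and PX: "\<forall>X\<in>\<A>. P \<subseteq> X \<longrightarrow> X = P" by (elim bexE)
  from PA have P: "homogeneous_ideal P" "I \<subseteq> P" "P \<inter> T = {}" by (simp_all add: \<A>_def)
  have max: "X = P" if "homogeneous_ideal X" "P \<subseteq> X" "X \<inter> T = {}" for X
    using PX that P(2) by (auto simp: \<A>_def)
  note P' = homogeneous_is_ideal[OF P(1)]
  have meets: "\<exists>a b. a \<in> P \<and> a + f * b \<in> T" if "f \<in> forms s" "f \<notin> P" for f s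
  proof -
    have "adjoin f P \<noteq> P" using mem_adjoin_self[OF P', of f] that(2) by auto
    then have "adjoin f P \<inter> T \<noteq> {}"
      using max[OF homogeneous_adjoin[OF P(1) that(1)] subset_adjoin] by blast
    then show ?thesis by (auto simp: adjoin_def)
  qed
  have "prime_ideal P"
  proof (rule prime_ideal_forms[OF P(1)])
    show "P \<noteq> UNIV" using P(3) T(1) by auto
    fix s t f g assume fg: "f \<in> forms s" "g \<in> forms t" "f * g \<in> P"
    show "f \<in> P \<or> g \<in> P"
    proof (rule ccontr)
      assume "\<not> (f \<in> P \<or> g \<in> P)"
      then obtain a b a' b' where
        ab: "a \<in> P" "a + f * b \<in> T" "a' \<in> P" "a' + g * b' \<in> T"
        using meets[OF fg(1)] meets[OF fg(2)] by blast
      have "(a + f * b) * (a' + g * b') = a * (a' + g * b') + (f * b) * a' + (f * g) * (b * b')"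
        by (simp add: algebra_simps)
      also have "\<dots> \<in> P"
        using ab(1,3) fg(3) by (intro ideal_add[OF P'] ideal_mult_right[OF P' ab(1)]
            ideal_mult_left[OF P' ab(3)] ideal_mult_right[OF P' fg(3)])
      finally show False using T(2)[OF ab(2,4)] P(3) by auto
    qed
  qed
  with P show ?thesis using that by blast
qed

lemma irrelevant_subset_iff:
  "is_ideal P \<Longrightarrow> irrelevant_ideal \<subseteq> P \<longleftrightarrow> (\<forall>v. var_poly v \<in> P)"
  unfolding irrelevant_ideal_def
  using ideal_generated_superset[of "range var_poly"] ideal_generated_minimal[of "range var_poly" P]
  by (metis image_subset_iff subset_trans UNIV_I)

lemma Proj_points_iff:
  "P \<in> Proj_points \<longleftrightarrow> prime_ideal P \<and> homogeneous_ideal P \<and> (\<exists>v. var_poly v \<notin> P)"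
  using irrelevant_subset_iff[of P] prime_is_ideal[of P] by (auto simp: Proj_points_def)

lemma Proj_pointsD:
  assumes "P \<in> Proj_points"
  shows Proj_prime: "prime_ideal P" and Proj_homogeneous: "homogeneous_ideal P"
    and Proj_ideal: "is_ideal P"
  using assms by (auto simp: Proj_points_iff prime_is_ideal)

lemma closed_points_Proj: "P \<in> closed_points \<Longrightarrow> P \<in> Proj_points"
  by (simp add: closed_points_def)

lemma Proj_forms_not_subset: "P \<in> Proj_points \<Longrightarrow> \<not> forms t \<subseteq> P"
  by (metis Proj_points_iff forms_power_1 forms_var(1) prime_power subsetD)

lemma var_power: "var_poly v ^ k = Poly_Mapping.single (Poly_Mapping.single v k) 1"
  by (induction k) (simp_all add: var_poly_def mult_single single_add[symmetric])

text \<open>Pigeonhole: in a degree above the sum of all \<open>N v\<close>, a monomial must be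
  divisible by some \<open>var_poly v ^ N v\<close>.\<close>

lemma forms_subset_if_var_powers:
  fixes I :: "('v::finite, 'k::comm_ring_1) mpoly set"
  assumes I: "is_ideal I" and N: "\<And>v. var_poly v ^ N v \<in> I"
  shows "forms (Suc (\<Sum>v\<in>UNIV. N v)) \<subseteq> I"
proof
  fix f :: "('v, 'k) mpoly" assume f: "f \<in> forms (Suc (\<Sum>v\<in>UNIV. N v))"
  have "Poly_Mapping.single m (Poly_Mapping.lookup f m) \<in> I" if m: "m \<in> Poly_Mapping.keys f" for m
  proof -
    have "(\<Sum>v\<in>UNIV. Poly_Mapping.lookup m v) = Suc (\<Sum>v\<in>UNIV. N v)"
      using f m mon_degree_superset[of UNIV m] by (simp add: forms_def)
    then have "\<not> (\<forall>v\<in>UNIV. Poly_Mapping.lookup m v \<le> N v)"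
      using sum_mono[of UNIV "Poly_Mapping.lookup m" N] by auto
    then obtain v where v: "N v \<le> Poly_Mapping.lookup m v" by (meson nat_le_linear)
    have "m = Poly_Mapping.single v (N v) + (m - Poly_Mapping.single v (N v))"
      by (rule poly_mapping_eqI) (use v in \<open>auto simp: lookup_add lookup_minus lookup_single when_def\<close>)
    then have "Poly_Mapping.single m (Poly_Mapping.lookup f m) =
        var_poly v ^ N v * Poly_Mapping.single (m - Poly_Mapping.single v (N v)) (Poly_Mapping.lookup f m)"
      by (simp add: var_power mult_single)
    then show ?thesis using ideal_mult_right[OF I N] by simp
  qed
  then show "f \<in> I"
    by (subst poly_mapping_sum_single[of "Poly_Mapping.keys f" f]) (auto intro: ideal_sum[OF I])
qed

text \<open>A weak Nullstellensatz. If no power of some variable lay in \<open>(P, g)\<close>, a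
  homogeneous prime containing \<open>(P, g)\<close> and avoiding these powers would be a point
  strictly above \<open>P\<close>, against maximality. No residue field is involved.\<close>

lemma closed_point_forms:
  fixes P :: "('v::finite, 'k::comm_ring_1) mpoly set"
  assumes P: "P \<in> closed_points" and g: "g \<in> forms e" "g \<notin> P"
  obtains N where "forms N \<subseteq> adjoin g P"
proof -
  note Pr = closed_points_Proj[OF P]
  have A: "homogeneous_ideal (adjoin g P)"
    by (rule homogeneous_adjoin[OF Proj_homogeneous[OF Pr] g(1)])
  have "\<exists>k. var_poly v ^ k \<in> adjoin g P" for v
  proof (rule ccontr)
    assume no: "\<not> (\<exists>k. var_poly v ^ k \<in> adjoin g P)"
    obtain Q where Q: "prime_ideal Q" "homogeneous_ideal Q" "adjoin g P \<subseteq> Q"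
      "Q \<inter> range (\<lambda>k. var_poly v ^ k) = {}"
    proof (rule exists_prime_avoiding[OF A])
      show "1 \<in> range (\<lambda>k. var_poly v ^ k)" by (auto intro: image_eqI[of _ _ 0])
      show "x * y \<in> range (\<lambda>k. var_poly v ^ k)"
        if "x \<in> range (\<lambda>k. var_poly v ^ k)" "y \<in> range (\<lambda>k. var_poly v ^ k)" for x y :: "('v, 'k) mpoly"
        using that by (auto simp: power_add[symmetric])
      show "adjoin g P \<inter> range (\<lambda>k. var_poly v ^ k) = {}" using no by auto
    qed blast
    have "var_poly v \<notin> Q" using Q(4) by (metis disjoint_iff power_one_right rangeI)
    then have "Q \<in> Proj_points" using Q by (auto simp: Proj_points_iff)
    moreover have "P \<subseteq> Q" using Q(3) subset_adjoin by blast
    ultimately have "Q = P" using P by (auto simp: closed_points_def)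
    then show False using Q(3) g(2) mem_adjoin_self[OF Proj_ideal[OF Pr]] by auto
  qed
  then obtain N where "\<And>v. var_poly v ^ N v \<in> adjoin g P" by metis
  from forms_subset_if_var_powers[OF homogeneous_is_ideal[OF A] this] show ?thesis by (rule that)
qed

lemma Proj_one_notin: "P \<in> Proj_points \<Longrightarrow> 1 \<notin> P"
  using ideal_one_iff[OF Proj_ideal] prime_neq_UNIV[OF Proj_prime] by blast

lemma closed_points_eqI:
  "P \<in> closed_points \<Longrightarrow> Q \<in> Proj_points \<Longrightarrow> P \<subseteq> Q \<Longrightarrow> Q = P"
  by (auto simp: closed_points_def)

lemma homogeneous_points_ideal: "Z \<subseteq> closed_points \<Longrightarrow> homogeneous_ideal (points_ideal Z)"
  unfolding points_ideal_def
  by (rule homogeneous_Inter) (auto intro: Proj_homogeneous closed_points_Proj)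

lemma points_nonzerodivisor:
  assumes "Z \<subseteq> closed_points" "\<And>p. p \<in> Z \<Longrightarrow> g \<notin> p" "g * f \<in> points_ideal Z"
  shows "f \<in> points_ideal Z"
  using assms prime_mult[OF Proj_prime[OF closed_points_Proj]] unfolding points_ideal_def by blast

text \<open>Induction over the points: a product of an element of \<open>(I, g)\<close> and one of
  \<open>(p, g)\<close> lies in the ideal generated by \<open>I \<inter> p\<close> and
  \<open>g\<close>, so the degrees \<open>M\<close> and \<open>N\<close> add up.\<close>

lemma points_forms:
  fixes Z :: "('v::finite, 'k::comm_ring_1) mpoly set set"
  assumes "finite Z" "Z \<subseteq> closed_points" and g: "g \<in> forms e" "\<And>p. p \<in> Z \<Longrightarrow> g \<notin> p"
  obtains N where "forms N \<subseteq> adjoin g (points_ideal Z)"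
  using assms(1,2) g(2)
proof (induction Z arbitrary: thesis rule: finite_induct)
  case empty
  show ?case
    by (rule empty(1)[of 0]) (use subset_adjoin[of UNIV g] in \<open>auto simp: points_ideal_def\<close>)
next
  case (insert p Z)
  obtain M where M: "forms M \<subseteq> adjoin g (points_ideal Z)" using insert by blast
  have p: "p \<in> closed_points" "g \<notin> p" using insert by auto
  obtain N where N: "forms N \<subseteq> adjoin g p" by (rule closed_point_forms[OF p(1) g(1) p(2)])
  have I: "is_ideal (points_ideal (insert p Z))"
    using homogeneous_points_ideal[OF insert(5)] by (rule homogeneous_is_ideal)
  have prod: "x * y \<in> adjoin g (points_ideal (insert p Z))"
    if xy: "x \<in> adjoin g (points_ideal Z)" "y \<in> adjoin g p" for x y
  proof -
    obtain a b where ab: "a \<in> points_ideal Z" "x = a + g * b" using xy(1) by (rule adjoinE)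
    obtain c d where cd: "c \<in> p" "y = c + g * d" using xy(2) by (rule adjoinE)
    have "a * c \<in> points_ideal (insert p Z)"
      using ab(1) cd(1) insert(5) unfolding points_ideal_def
      by (auto intro: ideal_mult_left ideal_mult_right dest!: Proj_ideal[OF closed_points_Proj])
    moreover have "x * y = a * c + g * (a * d + b * c + b * (g * d))"
      by (simp add: ab(2) cd(2) algebra_simps)
    ultimately show ?thesis by (simp only: adjoinI)
  qed
  have "forms (M + N) \<subseteq> adjoin g (points_ideal (insert p Z))"
  proof
    fix f :: "('v, 'k) mpoly" assume f: "f \<in> forms (M + N)"
    have "Poly_Mapping.single m (Poly_Mapping.lookup f m) \<in> adjoin g (points_ideal (insert p Z))"
      if m: "m \<in> Poly_Mapping.keys f" for m
    proof -
      have "mon_degree m = M + N" using f m by (simp add: forms_def)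
      then obtain m1 m2 where "m = m1 + m2" "mon_degree m1 = M" "mon_degree m2 = N"
      proof (induction M arbitrary: m thesis)
        case 0
        then show ?case using mon_degree_zero by (metis add.left_neutral add_0)
      next
        case (Suc M)
        from Suc(3) obtain v m' where m': "m = Poly_Mapping.single v 1 + m'" "mon_degree m' = M + N"
          using mon_degree_Suc[of m "M + N"] by auto
        obtain m1 m2 where m12: "m' = m1 + m2" "mon_degree m1 = M" "mon_degree m2 = N"
          using Suc(1)[OF _ m'(2)] by blast
        show ?case
          by (rule Suc(2)[of "Poly_Mapping.single v 1 + m1" m2])
            (simp_all add: m'(1) m12 mon_degree_add add.assoc)
      qed
      then have "Poly_Mapping.single m (Poly_Mapping.lookup f m) =
          Poly_Mapping.single m1 1 * Poly_Mapping.single m2 (Poly_Mapping.lookup f m)"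
        "Poly_Mapping.single m1 (1::'k) \<in> forms M"
        "Poly_Mapping.single m2 (Poly_Mapping.lookup f m) \<in> forms N"
        by (auto simp: mult_single intro!: forms_single)
      then show ?thesis using prod M N by (metis subsetD)
    qed
    then show "f \<in> adjoin g (points_ideal (insert p Z))"
      by (subst poly_mapping_sum_single[of "Poly_Mapping.keys f" f])
        (auto intro: ideal_sum[OF is_ideal_adjoin[OF I]])
  qed
  then show ?case by (rule insert(4))
qed

section \<open>Koszul syzygies\<close>

text \<open>The flag of ideals \<open>I + (y 0, ..., y (k - 1))\<close>. Started from
  \<open>{0}\<close> it gives the ideals of the sequence alone, so that both flags share their
  lemmas.\<close>

primrec adjoin_seq :: "(nat \<Rightarrow> 'a::comm_ring_1) \<Rightarrow> 'a set \<Rightarrow> nat \<Rightarrow> 'a set" where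
  "adjoin_seq y I 0 = I"
| "adjoin_seq y I (Suc k) = adjoin (y k) (adjoin_seq y I k)"

lemma is_ideal_adjoin_seq: "is_ideal I \<Longrightarrow> is_ideal (adjoin_seq y I k)"
  by (induction k) (simp_all add: is_ideal_adjoin)

lemma homogeneous_adjoin_seq:
  "homogeneous_ideal I \<Longrightarrow> (\<And>i. y i \<in> forms e) \<Longrightarrow> homogeneous_ideal (adjoin_seq y I k)"
  by (induction k) (auto intro: homogeneous_adjoin)

lemma adjoin_seq_mono: "I \<subseteq> J \<Longrightarrow> adjoin_seq y I k \<subseteq> adjoin_seq y J k"
  by (induction k) (simp_all add: adjoin_mono)

lemma subset_adjoin_seq: "I \<subseteq> adjoin_seq y I k"
  by (induction k) (use subset_adjoin in \<open>auto simp: subset_iff\<close>)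

lemma mem_adjoin_seq: "is_ideal I \<Longrightarrow> i < k \<Longrightarrow> y i \<in> adjoin_seq y I k"
proof (induction k)
  case (Suc k)
  then show ?case
    using mem_adjoin_self[OF is_ideal_adjoin_seq[OF Suc(2)], of "y k" y k]
      subset_adjoin[of "adjoin_seq y I k" "y k"] by (auto simp: less_Suc_eq)
qed simp

lemma adjoin_seq_split:
  "is_ideal I \<Longrightarrow> f \<in> adjoin_seq y I k \<Longrightarrow> \<exists>a l. a \<in> I \<and> l \<in> adjoin_seq y {0} k \<and> f = a + l"
proof (induction k arbitrary: f)
  case 0 then show ?case by (intro exI[of _ f] exI[of _ 0]) auto
next
  case (Suc k)
  from Suc(3) obtain b c where bc: "b \<in> adjoin_seq y I k" "f = b + y k * c"
    by (auto elim: adjoinE)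
  obtain a l where al: "a \<in> I" "l \<in> adjoin_seq y {0} k" "b = a + l"
    using Suc(1)[OF Suc(2) bc(1)] by blast
  have "l + y k * c \<in> adjoin_seq y {0} (Suc k)" using al(2) by (simp add: adjoinI)
  then show ?case using al(1,3) bc(2) by (metis add.assoc)
qed

lemma adjoin_seq_zero_iff:
  "f \<in> adjoin_seq y {0} k \<longleftrightarrow> (\<exists>c. f = (\<Sum>i<k. y i * c i))"
proof
  assume "f \<in> adjoin_seq y {0} k"
  then show "\<exists>c. f = (\<Sum>i<k. y i * c i)"
  proof (induction k arbitrary: f)
    case (Suc k)
    then obtain b c where bc: "b \<in> adjoin_seq y {0} k" "f = b + y k * c"
      by (auto elim: adjoinE)
    obtain c' where "b = (\<Sum>i<k. y i * c' i)" using Suc(1)[OF bc(1)] by blast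
    then have "f = (\<Sum>i<Suc k. y i * (c'(k := c)) i)" using bc(2) by simp
    then show ?case by blast
  qed simp
next
  assume "\<exists>c. f = (\<Sum>i<k. y i * c i)"
  then show "f \<in> adjoin_seq y {0} k"
    using is_ideal_adjoin_seq[OF is_ideal_zero, of y k] mem_adjoin_seq[OF is_ideal_zero, of _ k y]
    by (auto intro!: ideal_sum ideal_mult_right)
qed

text \<open>This version admits degrees below that of \<open>g\<close>, where the multiple of
  \<open>g\<close> disappears, and therefore says nothing on the degree of \<open>b\<close>.\<close>

lemma adjoin_forms_repE:
  assumes I: "homogeneous_ideal I" and g: "g \<in> forms e"
    and f: "f \<in> adjoin g I" "f \<in> forms t"
  obtains a b where "a \<in> I" "a \<in> forms t" "f = a + g * b"
proof -
  obtain a b where ab: "a \<in> I" "f = a + g * b" using f(1) by (rule adjoinE)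
  have "f = hcomp t f" using f(2) by (simp add: hcomp_forms)
  also have "\<dots> = hcomp t a + g * (if e \<le> t then hcomp (t - e) b else 0)"
    by (simp add: ab(2) hcomp_add hcomp_mult_forms[OF g])
  finally show ?thesis using that homogeneous_hcomp[OF I ab(1)] hcomp_in_forms by blast
qed

lemma homogeneous_zero: "homogeneous_ideal {0}"
  by (simp add: homogeneous_ideal_iff is_ideal_zero)

text \<open>Koszul syzygies are trivial. Writing the matrix entries as \<open>a i j - a j i\<close>
  builds in antisymmetry with zero diagonal and leaves \<open>a\<close> unconstrained.\<close>

lemma sum_antisymmetric_eq_0:
  fixes y :: "nat \<Rightarrow> 'a::comm_ring_1"
  shows "(\<Sum>i\<in>A. y i * (\<Sum>j\<in>A. (a i j - a j i) * y j)) = 0"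
proof -
  have "(\<Sum>i\<in>A. y i * (\<Sum>j\<in>A. (a i j - a j i) * y j)) =
      (\<Sum>i\<in>A. \<Sum>j\<in>A. a i j * (y i * y j)) - (\<Sum>i\<in>A. \<Sum>j\<in>A. a j i * (y i * y j))"
    by (simp add: sum_distrib_left sum_subtractf[symmetric] algebra_simps)
  also have "(\<Sum>i\<in>A. \<Sum>j\<in>A. a j i * (y i * y j)) = (\<Sum>i\<in>A. \<Sum>j\<in>A. a i j * (y i * y j))"
    by (subst sum.swap) (simp add: mult.commute[of "y _" "y _"])
  finally show ?thesis by simp
qed

text \<open>Here \<open>regular\<close> concerns the polynomial ring, not its quotient by
  \<open>I\<close>, while \<open>generated\<close> says that \<open>I\<close> acquires no generators
  above degree \<open>d\<close>. The purpose is to derive regularity of \<open>y 0\<close> and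
  \<open>y 1\<close> modulo \<open>I\<close> in high degrees.\<close>

locale koszul =
  fixes y :: "nat \<Rightarrow> ('v, 'k::comm_ring_1) mpoly" and n d :: nat and I :: "('v, 'k) mpoly set"
  assumes I: "homogeneous_ideal I"
    and y: "\<And>i. y i \<in> forms 1"
    and regular: "\<And>k f. k < n \<Longrightarrow> y k * f \<in> adjoin_seq y {0} k \<Longrightarrow> f \<in> adjoin_seq y {0} k"
    and generated: "\<And>t f. d \<le> t \<Longrightarrow> f \<in> I \<Longrightarrow> f \<in> forms (Suc t) \<Longrightarrow>
      \<exists>g. (\<forall>i. g i \<in> I \<inter> forms t) \<and> f = (\<Sum>i<n. y i * g i)"
begin

abbreviation "J k \<equiv> adjoin_seq y I k"
abbreviation "L k \<equiv> adjoin_seq y {0} k"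

definition inj_at :: "nat \<Rightarrow> nat \<Rightarrow> bool" where
  "inj_at k u \<longleftrightarrow> (\<forall>f\<in>forms u. y k * f \<in> J k \<longrightarrow> f \<in> J k)"

text \<open>Vanishing of the first Koszul homology of \<open>J k / L k\<close> with respect to
  \<open>y k, ..., y (n - 1)\<close>, at coefficients of degree \<open>Suc u\<close>. The essential
  point is that the entries of the Koszul relation are taken from \<open>J k\<close>, not just from
  the ring.\<close>

definition syz_at :: "nat \<Rightarrow> nat \<Rightarrow> bool" where
  "syz_at k u \<longleftrightarrow> (\<forall>g. (\<forall>i\<in>{k..<n}. g i \<in> J k \<inter> forms (Suc u)) \<longrightarrow>
     (\<Sum>i\<in>{k..<n}. y i * g i) \<in> L k \<longrightarrow>
     (\<exists>a. (\<forall>i j. a i j \<in> J k \<inter> forms u) \<and>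
       (\<forall>i\<in>{k..<n}. g i - (\<Sum>j\<in>{k..<n}. (a i j - a j i) * y j) \<in> L k)))"

lemma J_ideal: "is_ideal (J k)" and L_ideal: "is_ideal (L k)"
  by (simp_all add: is_ideal_adjoin_seq homogeneous_is_ideal[OF I] is_ideal_zero)

lemma J_homogeneous: "homogeneous_ideal (J k)" and L_homogeneous: "homogeneous_ideal (L k)"
  by (simp_all add: homogeneous_adjoin_seq[OF I y] homogeneous_adjoin_seq[OF homogeneous_zero y])

lemma L_subset_J: "L k \<subseteq> J k"
  using homogeneous_is_ideal[OF I] by (intro adjoin_seq_mono) (auto intro: ideal_zero)

text \<open>Lifts a Koszul representation from level \<open>Suc k\<close> to level \<open>k\<close>.
  Its entries lie in \<open>J k\<close> up to multiples of \<open>y k\<close>; these multiples are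
  collected in the error terms \<open>b i * y k\<close>, and \<open>inj_at k u\<close> is what
  places \<open>b i\<close> in \<open>J k\<close>. Summing against \<open>y\<close> removes the
  antisymmetric part and leaves the last claim. Both induction steps below rest on this.\<close>

lemma syz_reduce:
  assumes k: "k < n" and syz: "syz_at (Suc k) u" and inj: "inj_at k u"
    and g: "\<forall>i\<in>{Suc k..<n}. g i \<in> J k \<inter> forms (Suc u)"
    and sum: "(\<Sum>i\<in>{Suc k..<n}. y i * g i) \<in> L (Suc k)"
  shows "\<exists>a b. (\<forall>i j. a i j \<in> J k \<inter> forms u) \<and> (\<forall>i. b i \<in> J k \<inter> forms u) \<and>
    (\<forall>i\<in>{Suc k..<n}. g i - (\<Sum>j\<in>{Suc k..<n}. (a i j - a j i) * y j) - b i * y k \<in> L k) \<and>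
    (\<Sum>i\<in>{Suc k..<n}. y i * g i) - y k * (\<Sum>i\<in>{Suc k..<n}. y i * b i) \<in> L k"
proof -
  let ?A = "{Suc k..<n}"
  have "\<forall>i\<in>?A. g i \<in> J (Suc k) \<inter> forms (Suc u)"
    using g subset_adjoin[of "J k" "y k"] by auto
  then obtain a0 where a0: "\<forall>i j. a0 i j \<in> J (Suc k) \<inter> forms u"
    "\<forall>i\<in>?A. g i - (\<Sum>j\<in>?A. (a0 i j - a0 j i) * y j) \<in> L (Suc k)"
    using syz sum unfolding syz_at_def by blast
  have "\<forall>i j. \<exists>a c. a \<in> J k \<inter> forms u \<and> a0 i j = a + y k * c"
  proof (intro allI)
    fix i j
    have "a0 i j \<in> adjoin (y k) (J k)" "a0 i j \<in> forms u" using a0(1) by auto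
    then obtain a c where "a \<in> J k" "a \<in> forms u" "a0 i j = a + y k * c"
      by (rule adjoin_forms_repE[OF J_homogeneous y])
    then show "\<exists>a c. a \<in> J k \<inter> forms u \<and> a0 i j = a + y k * c" by blast
  qed
  then obtain a c where a: "\<And>i j. a i j \<in> J k \<inter> forms u" "\<And>i j. a0 i j = a i j + y k * c i j"
    by metis
  \<comment> \<open>The defect after the multiples of \<open>y k\<close> in \<open>a0\<close> are
    dropped: it lies in \<open>L (Suc k)\<close>, so modulo \<open>L k\<close> it is a multiple of
    \<open>y k\<close>.\<close>
  define r where "r i = g i - (\<Sum>j\<in>?A. (a i j - a j i) * y j)" for i
  have "\<exists>b. b \<in> J k \<inter> forms u \<and> r i - b * y k \<in> L k" if i: "i \<in> ?A" for i
  proof -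
    have "(\<Sum>j\<in>?A. (a0 i j - a0 j i) * y j) =
        (\<Sum>j\<in>?A. (a i j - a j i) * y j) + y k * (\<Sum>j\<in>?A. (c i j - c j i) * y j)"
      unfolding sum_distrib_left sum.distrib[symmetric]
      by (rule sum.cong[OF refl]) (simp add: a(2) algebra_simps)
    then have "r i = (g i - (\<Sum>j\<in>?A. (a0 i j - a0 j i) * y j)) + y k * (\<Sum>j\<in>?A. (c i j - c j i) * y j)"
      by (simp add: r_def)
    also have "\<dots> \<in> L (Suc k)"
      using a0(2) i mem_adjoin_seq[OF is_ideal_zero, of k "Suc k" y]
      by (intro ideal_add[OF L_ideal] ideal_mult_right[OF L_ideal]) auto
    finally have r1: "r i \<in> adjoin (y k) (L k)" by simp
    have "(\<Sum>j\<in>?A. (a i j - a j i) * y j) \<in> forms (u + 1)"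
      using a(1) y by (intro forms_sum forms_mult forms_diff) auto
    then have r2: "r i \<in> forms (u + 1)" using bspec[OF g i] by (auto simp: r_def intro: forms_diff)
    obtain l b where lb: "l \<in> L k" "b \<in> forms u" "r i = l + y k * b"
      by (rule adjoin_formsE[OF L_homogeneous y r1 r2])
    have "r i \<in> J k"
      unfolding r_def using bspec[OF g i] a(1)
      by (intro ideal_diff[OF J_ideal] ideal_sum[OF J_ideal] ideal_mult_right[OF J_ideal]) auto
    then have "y k * b \<in> J k"
      using ideal_diff[OF J_ideal, of "r i" k l] lb(1,3) L_subset_J by auto
    then have "b \<in> J k" using inj lb(2) by (auto simp: inj_at_def)
    then show ?thesis using lb by (intro exI[of _ b]) (simp add: mult.commute)
  qed
  then have "\<forall>i\<in>?A. \<exists>b. b \<in> J k \<inter> forms u \<and> r i - b * y k \<in> L k" by blast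
  from bchoice[OF this] obtain b0
    where b0: "\<And>i. i \<in> ?A \<Longrightarrow> b0 i \<in> J k \<inter> forms u \<and> r i - b0 i * y k \<in> L k" by blast
  define b where "b i = (if i \<in> ?A then b0 i else 0)" for i
  have b: "b i \<in> J k \<inter> forms u" for i
    using b0 ideal_zero[OF J_ideal] by (simp add: b_def)
  have rb: "r i - b i * y k \<in> L k" if "i \<in> ?A" for i using b0[OF that] that by (simp add: b_def)
  have "(\<Sum>i\<in>?A. y i * g i) - y k * (\<Sum>i\<in>?A. y i * b i) =
      (\<Sum>i\<in>?A. y i * (r i - b i * y k)) + (\<Sum>i\<in>?A. y i * (\<Sum>j\<in>?A. (a i j - a j i) * y j))"
    unfolding r_def sum_distrib_left[of "y k"] sum.distrib[symmetric] sum_subtractf[symmetric]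
    by (rule sum.cong[OF refl]) (simp add: algebra_simps)
  also have "\<dots> \<in> L k"
    unfolding sum_antisymmetric_eq_0 using rb
    by (simp, intro ideal_sum[OF L_ideal] ideal_mult_left[OF L_ideal])
  finally have "(\<Sum>i\<in>?A. y i * g i) - y k * (\<Sum>i\<in>?A. y i * b i) \<in> L k" .
  moreover have "\<forall>i j. a i j \<in> J k \<inter> forms u" "\<forall>i. b i \<in> J k \<inter> forms u"
    using a(1) b by blast+
  moreover have "\<forall>i\<in>?A. g i - (\<Sum>j\<in>?A. (a i j - a j i) * y j) - b i * y k \<in> L k"
    using rb unfolding r_def by blast
  ultimately show ?thesis by (intro exI[of _ a] exI[of _ b] conjI)
qed

lemma sum_split_first: "k < n \<Longrightarrow> (\<Sum>i\<in>{k..<n}. h i) = h k + (\<Sum>i\<in>{Suc k..<n}. h i)"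
  for h :: "nat \<Rightarrow> ('v, 'k) mpoly"
  by (simp add: sum.atLeast_Suc_lessThan)

text \<open>The elements \<open>b i\<close> fill the border of the matrix that belongs to index
  \<open>k\<close>. The equation for \<open>g k\<close> itself comes from regularity, since
  \<open>y k * (g k + (\<Sum>i\<in>{Suc k..<n}. y i * b i))\<close> lies in
  \<open>L k\<close>.\<close>

lemma syz_step:
  assumes k: "k < n" and syz: "syz_at (Suc k) u" and inj: "inj_at k u"
  shows "syz_at k u"
  unfolding syz_at_def
proof (intro allI impI)
  let ?A = "{Suc k..<n}"
  fix g assume g: "\<forall>i\<in>{k..<n}. g i \<in> J k \<inter> forms (Suc u)"
    and sum: "(\<Sum>i\<in>{k..<n}. y i * g i) \<in> L k"
  have gA: "\<forall>i\<in>?A. g i \<in> J k \<inter> forms (Suc u)" using g by auto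
  have "(\<Sum>i\<in>?A. y i * g i) = (\<Sum>i\<in>{k..<n}. y i * g i) + y k * (- g k)"
    by (simp add: sum_split_first[OF k])
  also have "\<dots> \<in> L (Suc k)" using sum by (simp only: adjoinI adjoin_seq.simps)
  finally have sum': "(\<Sum>i\<in>?A. y i * g i) \<in> L (Suc k)" .
  from syz_reduce[OF k syz inj gA sum']
  obtain a b where ab: "\<forall>i j. a i j \<in> J k \<inter> forms u" "\<forall>i. b i \<in> J k \<inter> forms u"
    and 1: "\<forall>i\<in>?A. g i - (\<Sum>j\<in>?A. (a i j - a j i) * y j) - b i * y k \<in> L k"
    and 2: "(\<Sum>i\<in>?A. y i * g i) - y k * (\<Sum>i\<in>?A. y i * b i) \<in> L k"
    by (elim exE conjE)
  \<comment> \<open>Only the column \<open>k\<close> receives \<open>b\<close>; the row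
    \<open>k\<close> is zero, since antisymmetrization produces the opposite sign there.\<close>
  define a' where "a' i j = (if k < i \<and> k < j then a i j else if k < i \<and> j = k then b i else 0)" for i j
  have "y k * (g k + (\<Sum>i\<in>?A. y i * b i)) = (\<Sum>i\<in>{k..<n}. y i * g i) -
      ((\<Sum>i\<in>?A. y i * g i) - y k * (\<Sum>i\<in>?A. y i * b i))"
    by (simp add: sum_split_first[OF k] algebra_simps)
  also have "\<dots> \<in> L k" using sum 2 by (rule ideal_diff[OF L_ideal])
  finally have 3: "g k + (\<Sum>i\<in>?A. y i * b i) \<in> L k" by (rule regular[OF k])
  have "g i - (\<Sum>j\<in>{k..<n}. (a' i j - a' j i) * y j) \<in> L k" if i: "i \<in> {k..<n}" for i
  proof (cases "i = k")
    case True
    have "(\<Sum>j\<in>?A. (a' i j - a' j i) * y j) = (\<Sum>j\<in>?A. - (y j * b j))"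
      by (rule sum.cong) (auto simp: True a'_def)
    then have "(\<Sum>j\<in>{k..<n}. (a' i j - a' j i) * y j) = - (\<Sum>i\<in>?A. y i * b i)"
      by (simp add: sum_split_first[OF k] True sum_negf)
    then show ?thesis using 3 True by simp
  next
    case False
    then have iA: "i \<in> ?A" using i by auto
    have "(\<Sum>j\<in>?A. (a' i j - a' j i) * y j) = (\<Sum>j\<in>?A. (a i j - a j i) * y j)"
      using iA by (intro sum.cong) (auto simp: a'_def)
    moreover have "a' i k - a' k i = b i" using iA by (auto simp: a'_def)
    ultimately have "(\<Sum>j\<in>{k..<n}. (a' i j - a' j i) * y j) = b i * y k + (\<Sum>j\<in>?A. (a i j - a j i) * y j)"
      by (simp add: sum_split_first[OF k])
    then have eq: "g i - (\<Sum>j\<in>{k..<n}. (a' i j - a' j i) * y j) =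
        g i - (\<Sum>j\<in>?A. (a i j - a j i) * y j) - b i * y k" by simp
    show ?thesis unfolding eq by (rule bspec[OF 1 iA])
  qed
  moreover have "a' i j \<in> J k \<inter> forms u" for i j
    using ab ideal_zero[OF J_ideal] by (simp add: a'_def)
  ultimately show "\<exists>a. (\<forall>i j. a i j \<in> J k \<inter> forms u) \<and>
       (\<forall>i\<in>{k..<n}. g i - (\<Sum>j\<in>{k..<n}. (a i j - a j i) * y j) \<in> L k)"
    by (intro exI[of _ a']) blast
qed

lemma syz_top: "n \<le> k \<Longrightarrow> syz_at k u"
  using ideal_zero[OF J_ideal] by (auto simp: syz_at_def intro!: exI[of _ "\<lambda>_ _. 0"])

text \<open>The part of \<open>y k * f\<close> in \<open>I\<close> is written as
  \<open>(\<Sum>i<n. y i * g i)\<close> by \<open>generated\<close>. Terms with \<open>i < k\<close>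
  belong to \<open>L k\<close>, the term \<open>i = k\<close> is moved to the left, and the others
  form a relation modulo \<open>L (Suc k)\<close> to which \<open>syz_reduce\<close> applies.
  Cancelling \<open>y k\<close> by regularity expresses \<open>f\<close> modulo \<open>L k\<close>
  through \<open>g k\<close> and the \<open>b i\<close>, all in \<open>J k\<close>.\<close>

lemma inj_step:
  assumes k: "k < n" and u: "d \<le> u" and syz: "syz_at (Suc k) u" and inj: "inj_at k u"
  shows "inj_at k (Suc u)"
  unfolding inj_at_def
proof (intro ballI impI)
  let ?A = "{Suc k..<n}"
  fix f assume f: "f \<in> forms (Suc u)" "y k * f \<in> J k"
  have yf: "y k * f \<in> forms (Suc (Suc u))" using forms_mult[OF y f(1)] by simp
  obtain a l where al: "a \<in> I" "l \<in> L k" "y k * f = a + l"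
    using adjoin_seq_split[OF homogeneous_is_ideal[OF I] f(2)] by blast
  have eq: "y k * f = hcomp (Suc (Suc u)) a + hcomp (Suc (Suc u)) l"
    using yf al(3) by (metis hcomp_add hcomp_forms)
  obtain g where g: "\<And>i. g i \<in> I \<inter> forms (Suc u)" "hcomp (Suc (Suc u)) a = (\<Sum>i<n. y i * g i)"
    using generated[of "Suc u" "hcomp (Suc (Suc u)) a"] u homogeneous_hcomp[OF I al(1)] by auto
  define l' where "l' = hcomp (Suc (Suc u)) l + (\<Sum>i<k. y i * g i)"
  have l': "l' \<in> L k"
    unfolding l'_def using homogeneous_hcomp[OF L_homogeneous al(2)]
    by (auto intro!: ideal_add[OF L_ideal] simp: adjoin_seq_zero_iff[of "\<Sum>i<k. y i * g i"])
  have "(\<Sum>i<n. y i * g i) = (\<Sum>i<k. y i * g i) + (\<Sum>i\<in>{k..<n}. y i * g i)"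
    using k by (simp add: lessThan_atLeast0 sum.atLeastLessThan_concat)
  then have yf: "y k * f = l' + y k * g k + (\<Sum>i\<in>?A. y i * g i)"
    using eq g(2) by (simp add: l'_def sum_split_first[OF k])
  have gA: "\<forall>i\<in>?A. g i \<in> J k \<inter> forms (Suc u)" using g(1) subset_adjoin_seq by blast
  have "(\<Sum>i\<in>?A. y i * g i) = (- l') + y k * (f - g k)" using yf by (simp add: algebra_simps)
  also have "\<dots> \<in> L (Suc k)" using ideal_uminus[OF L_ideal l'] by (simp only: adjoinI adjoin_seq.simps)
  finally have sum': "(\<Sum>i\<in>?A. y i * g i) \<in> L (Suc k)" .
  from syz_reduce[OF k syz inj gA sum']
  obtain b where ab: "\<forall>i. b i \<in> J k \<inter> forms u"
    and 2: "(\<Sum>i\<in>?A. y i * g i) - y k * (\<Sum>i\<in>?A. y i * b i) \<in> L k"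
    by (elim exE conjE)
  have "y k * (f - g k - (\<Sum>i\<in>?A. y i * b i)) = l' + ((\<Sum>i\<in>?A. y i * g i) - y k * (\<Sum>i\<in>?A. y i * b i))"
    using yf by (simp add: algebra_simps)
  also have "\<dots> \<in> L k" using l' 2 by (rule ideal_add[OF L_ideal])
  finally have "f - g k - (\<Sum>i\<in>?A. y i * b i) \<in> J k" using regular[OF k] L_subset_J by blast
  moreover have "(\<Sum>i\<in>?A. y i * b i) \<in> J k"
    using ab by (intro ideal_sum[OF J_ideal] ideal_mult_left[OF J_ideal]) auto
  ultimately have "f - g k \<in> J k" by (rule ideal_diff_cancel[OF J_ideal])
  moreover have "g k \<in> J k" using g(1)[of k] subset_adjoin_seq by blast
  ultimately show "f \<in> J k" by (rule ideal_diff_cancel[OF J_ideal])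
qed

text \<open>A criterion of Bayer and Stillman for regularity, in dimension two.\<close>

lemma inj_all:
  assumes n: "2 \<le> n" and inj0: "inj_at 0 d" and inj1: "inj_at 1 d"
    and forms_full: "\<And>u. d \<le> u \<Longrightarrow> forms u \<subseteq> J 2"
  shows "d \<le> u \<Longrightarrow> inj_at 0 u" "d \<le> u \<Longrightarrow> inj_at 1 u"
proof -
  \<comment> \<open>From level two on injectivity is vacuous, as \<open>J k\<close> contains
    \<open>J 2\<close> and with it all forms of degree \<open>u\<close>. The induction descends from
    the levels \<open>k \<ge> n\<close>, where no index is left.\<close>
  have syz2: "syz_at k u" if "d \<le> u" "2 \<le> k" for k u
    using \<open>2 \<le> k\<close>
  proof (induction "n - k" arbitrary: k)
    case 0
    then show ?case by (simp add: syz_top)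
  next
    case (Suc m)
    have "J 2 \<subseteq> J k"
      using Suc(3)
    proof (induction k rule: dec_induct)
      case (step j)
      then show ?case using subset_adjoin[of "J j" "y j"] by simp
    qed simp
    then have "forms u \<subseteq> J k" using forms_full[OF \<open>d \<le> u\<close>] by (rule subset_trans[rotated])
    then have "inj_at k u" unfolding inj_at_def by blast
    moreover have "syz_at (Suc k) u"
      by (rule Suc(1)) (use Suc(2,3) in linarith)+
    moreover have "k < n" using Suc(2) by linarith
    ultimately show ?case using syz_step by blast
  qed
  \<comment> \<open>Degree \<open>Suc u\<close> at level one needs syzygies of level two in degree
    \<open>u\<close>; level zero likewise needs those of level one, which rest on the present
    claim.\<close>
  have inj1': "inj_at 1 u" if "d \<le> u" for u
    using that
  proof (induction u rule: dec_induct)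
    case (step u)
    then show ?case using inj_step[of 1 u] syz2[of u "Suc 1"] n by fastforce
  qed (rule inj1)
  have syz1: "syz_at 1 u" if "d \<le> u" for u
    using syz_step[of 1 u] inj1'[OF that] syz2[OF that, of "Suc 1"] n by fastforce
  have inj0': "inj_at 0 u" if "d \<le> u" for u
    using that
  proof (induction u rule: dec_induct)
    case (step u)
    then show ?case using inj_step[of 0 u] syz1[of u] n by fastforce
  qed (rule inj0)
  show "d \<le> u \<Longrightarrow> inj_at 0 u" "d \<le> u \<Longrightarrow> inj_at 1 u" by (fact inj0' inj1')+
qed

end

section \<open>Evaluation and linear changes of coordinates\<close>

definition mon_eval :: "('v \<Rightarrow> 'r::comm_ring_1) \<Rightarrow> ('v \<Rightarrow>\<^sub>0 nat) \<Rightarrow> 'r" where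
  "mon_eval \<sigma> m = (\<Prod>v\<in>Poly_Mapping.keys m. \<sigma> v ^ Poly_Mapping.lookup m v)"

lemma mon_eval_superset:
  "finite A \<Longrightarrow> Poly_Mapping.keys m \<subseteq> A \<Longrightarrow> mon_eval \<sigma> m = (\<Prod>v\<in>A. \<sigma> v ^ Poly_Mapping.lookup m v)"
  unfolding mon_eval_def by (rule prod.mono_neutral_left) (auto simp: in_keys_iff)

lemma mon_eval_add: "mon_eval \<sigma> (m + n) = mon_eval \<sigma> m * mon_eval \<sigma> n"
proof -
  let ?A = "Poly_Mapping.keys m \<union> Poly_Mapping.keys n"
  have "mon_eval \<sigma> (m + n) = (\<Prod>v\<in>?A. \<sigma> v ^ Poly_Mapping.lookup (m + n) v)"
    by (rule mon_eval_superset) (auto simp: keys_add)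
  then show ?thesis
    using mon_eval_superset[of ?A m \<sigma>] mon_eval_superset[of ?A n \<sigma>]
    by (simp add: lookup_add power_add prod.distrib)
qed

lemma mon_eval_simps [simp]: "mon_eval \<sigma> 0 = 1" "mon_eval \<sigma> (Poly_Mapping.single v k) = \<sigma> v ^ k"
  by (simp_all add: mon_eval_def)

text \<open>Coefficients are mapped by \<open>h\<close> and variables by \<open>\<sigma>\<close>.
  One definition serves evaluation at a point, substitution of polynomials, and restriction to a
  line.\<close>

definition poly_eval ::
  "('k \<Rightarrow> 'r::comm_ring_1) \<Rightarrow> ('v \<Rightarrow> 'r) \<Rightarrow> ('v, 'k::comm_ring_1) mpoly \<Rightarrow> 'r" where
  "poly_eval h \<sigma> f = (\<Sum>m\<in>Poly_Mapping.keys f. h (Poly_Mapping.lookup f m) * mon_eval \<sigma> m)"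

lemma eval_poly_eq: "eval_poly a f = poly_eval (\<lambda>c. c) a f"
  by (simp add: eval_poly_def poly_eval_def mon_eval_def)

locale poly_evaluation =
  fixes h :: "'k::comm_ring_1 \<Rightarrow> 'r::comm_ring_1"
  assumes h0: "h 0 = 0" and h1: "h 1 = 1"
    and h_add: "h (a + b) = h a + h b" and h_mult: "h (a * b) = h a * h b"
begin

lemma poly_eval_superset:
  "finite A \<Longrightarrow> Poly_Mapping.keys f \<subseteq> A \<Longrightarrow>
    poly_eval h \<sigma> f = (\<Sum>m\<in>A. h (Poly_Mapping.lookup f m) * mon_eval \<sigma> m)"
  unfolding poly_eval_def by (rule sum.mono_neutral_left) (auto simp: in_keys_iff h0)

lemma poly_eval_add: "poly_eval h \<sigma> (f + g) = poly_eval h \<sigma> f + poly_eval h \<sigma> g"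
proof -
  let ?A = "Poly_Mapping.keys f \<union> Poly_Mapping.keys g"
  have "poly_eval h \<sigma> (f + g) = (\<Sum>m\<in>?A. h (Poly_Mapping.lookup (f + g) m) * mon_eval \<sigma> m)"
    by (rule poly_eval_superset) (auto simp: keys_add)
  then show ?thesis
    using poly_eval_superset[of ?A f \<sigma>] poly_eval_superset[of ?A g \<sigma>]
    by (simp add: lookup_add h_add distrib_right sum.distrib)
qed

lemma poly_eval_zero [simp]: "poly_eval h \<sigma> 0 = 0"
  by (simp add: poly_eval_def)

lemma poly_eval_sum: "poly_eval h \<sigma> (sum f A) = (\<Sum>x\<in>A. poly_eval h \<sigma> (f x))"
  by (induction A rule: infinite_finite_induct) (auto simp: poly_eval_add)

lemma poly_eval_single [simp]: "poly_eval h \<sigma> (Poly_Mapping.single m c) = h c * mon_eval \<sigma> m"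
  using poly_eval_superset[of "{m}" "Poly_Mapping.single m c" \<sigma>] by simp

lemma poly_eval_mult: "poly_eval h \<sigma> (f * g) = poly_eval h \<sigma> f * poly_eval h \<sigma> g"
proof -
  have "poly_eval h \<sigma> (f * g) = (\<Sum>m\<in>Poly_Mapping.keys f. \<Sum>n\<in>Poly_Mapping.keys g.
      h (Poly_Mapping.lookup f m) * mon_eval \<sigma> m * (h (Poly_Mapping.lookup g n) * mon_eval \<sigma> n))"
    by (subst mult_as_sum[of "Poly_Mapping.keys f" f "Poly_Mapping.keys g" g])
      (simp_all add: poly_eval_sum h_mult mon_eval_add mult_ac)
  then show ?thesis by (simp add: poly_eval_def sum_product)
qed

lemma poly_eval_const [simp]: "poly_eval h \<sigma> (const_poly c) = h c"
  by (simp add: const_poly_def)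

lemma poly_eval_one [simp]: "poly_eval h \<sigma> 1 = 1"
  using poly_eval_const[of \<sigma> 1] by (simp add: const_poly_def h1)

lemma poly_eval_var [simp]: "poly_eval h \<sigma> (var_poly v) = \<sigma> v"
  by (simp add: var_poly_def h1)

lemma poly_eval_uminus: "poly_eval h \<sigma> (- f) = - poly_eval h \<sigma> f"
  using poly_eval_add[of \<sigma> f "-f"] by (simp add: eq_neg_iff_add_eq_0 add.commute)

lemma poly_eval_diff: "poly_eval h \<sigma> (f - g) = poly_eval h \<sigma> f - poly_eval h \<sigma> g"
  using poly_eval_add[of \<sigma> f "-g"] by (simp add: poly_eval_uminus)

lemmas poly_eval_simps = poly_eval_add poly_eval_sum poly_eval_mult poly_eval_uminus poly_eval_diff

end

lemma mpoly_as_sum: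
  fixes f :: "('v, 'k::comm_ring_1) mpoly"
  shows "f = (\<Sum>m\<in>Poly_Mapping.keys f. const_poly (Poly_Mapping.lookup f m) * mon_eval var_poly m)"
proof -
  have "mon_eval var_poly m = Poly_Mapping.single m (1::'k)" for m :: "'v \<Rightarrow>\<^sub>0 nat"
  proof -
    have "(\<Prod>v\<in>A. Poly_Mapping.single (Poly_Mapping.single v (Poly_Mapping.lookup m v)) (1::'k)) =
        Poly_Mapping.single (\<Sum>v\<in>A. Poly_Mapping.single v (Poly_Mapping.lookup m v)) 1" for A
      by (induction A rule: infinite_finite_induct) (simp_all add: mult_single)
    then show ?thesis
      using poly_mapping_sum_single[of "Poly_Mapping.keys m" m]
      by (simp add: mon_eval_def var_power)
  qed
  then show ?thesis
    using poly_mapping_sum_single[of "Poly_Mapping.keys f" f]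
    by (simp add: const_poly_def mult_single)
qed

interpretation subst: poly_evaluation const_poly
  by unfold_locales (simp_all add: const_poly_simps)

abbreviation subst_poly :: "('v \<Rightarrow> ('w, 'k) mpoly) \<Rightarrow> ('v, 'k::comm_ring_1) mpoly \<Rightarrow> ('w, 'k) mpoly" where
  "subst_poly \<equiv> poly_eval const_poly"

lemma subst_poly_power: "subst_poly \<sigma> (f ^ k) = subst_poly \<sigma> f ^ k"
  by (induction k) (simp_all add: subst.poly_eval_mult)

lemma subst_poly_prod: "subst_poly \<sigma> (prod f A) = (\<Prod>x\<in>A. subst_poly \<sigma> (f x))"
  by (induction A rule: infinite_finite_induct) (simp_all add: subst.poly_eval_mult)

lemma subst_poly_inverse:
  assumes "\<And>v. subst_poly Y (\<Psi> v) = var_poly v"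
  shows "subst_poly Y (subst_poly \<Psi> f) = f"
proof -
  have "subst_poly Y (subst_poly \<Psi> f) =
      (\<Sum>m\<in>Poly_Mapping.keys f. const_poly (Poly_Mapping.lookup f m) * mon_eval var_poly m)"
    unfolding poly_eval_def[of const_poly \<Psi> f] mon_eval_def
    by (simp add: subst.poly_eval_sum subst.poly_eval_mult subst_poly_prod subst_poly_power assms)
  then show ?thesis using mpoly_as_sum[of f] by simp
qed

lemma lookup_var_mult_nonzero:
  assumes "Poly_Mapping.lookup (var_poly v * g) m \<noteq> 0"
  shows "Poly_Mapping.lookup m v \<noteq> 0"
proof -
  have "m \<in> Poly_Mapping.keys (var_poly v * g)" using assms by (simp add: in_keys_iff)
  then obtain n where "m = Poly_Mapping.single v 1 + n"
    using keys_mult[of "var_poly v" g] by (auto simp: var_poly_def)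
  then show ?thesis by (simp add: lookup_add)
qed

text \<open>Compare coefficients at \<open>w\<close> times a monomial \<open>m\<close> of
  \<open>f\<close>: some \<open>v\<close> in \<open>S\<close> divides this product, and
  \<open>v \<noteq> w\<close> forces \<open>v\<close> to divide \<open>m\<close>.\<close>

lemma variables_regular:
  fixes f :: "('v, 'k::comm_ring_1) mpoly"
  assumes S: "finite S" "w \<notin> S" and f: "var_poly w * f = (\<Sum>v\<in>S. var_poly v * c v)"
  obtains c' where "f = (\<Sum>v\<in>S. var_poly v * c' v)"
proof -
  let ?I = "{g :: ('v, 'k) mpoly. \<exists>c. g = (\<Sum>v\<in>S. var_poly v * c v)}"
  have I: "is_ideal ?I"
    unfolding is_ideal_iff
  proof (intro conjI ballI allI)
    show "0 \<in> ?I" by (auto intro!: exI[of _ "\<lambda>_. 0"])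
    fix x assume "x \<in> ?I"
    then obtain c where c: "x = (\<Sum>v\<in>S. var_poly v * c v)" by blast
    have "b * x = (\<Sum>v\<in>S. var_poly v * (b * c v))" for b
      by (simp add: c sum_distrib_left mult.left_commute)
    then show "b * x \<in> ?I" for b by (auto intro!: exI[of _ "\<lambda>v. b * c v"])
    fix y assume "y \<in> ?I"
    then obtain c' where c': "y = (\<Sum>v\<in>S. var_poly v * c' v)" by blast
    have "x + y = (\<Sum>v\<in>S. var_poly v * (c v + c' v))"
      by (simp add: c c' distrib_left sum.distrib)
    then show "x + y \<in> ?I" by (auto intro!: exI[of _ "\<lambda>v. c v + c' v"])
  qed
  have "Poly_Mapping.single m (Poly_Mapping.lookup f m) \<in> ?I" if m: "m \<in> Poly_Mapping.keys f" for m
  proof -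
    have "Poly_Mapping.lookup (var_poly w * f) (Poly_Mapping.single w 1 + m) = Poly_Mapping.lookup f m"
      unfolding var_poly_def by (subst mult_single_lookup) simp
    then have "(\<Sum>v\<in>S. Poly_Mapping.lookup (var_poly v * c v) (Poly_Mapping.single w 1 + m)) \<noteq> 0"
      using m by (simp add: f lookup_sum in_keys_iff)
    then obtain v where v: "v \<in> S" "Poly_Mapping.lookup (var_poly v * c v) (Poly_Mapping.single w 1 + m) \<noteq> 0"
      by (rule sum.not_neutral_contains_not_neutral)
    from lookup_var_mult_nonzero[OF v(2)] v(1) S(2) have mv: "Poly_Mapping.lookup m v \<noteq> 0"
      by (auto simp: lookup_add lookup_single when_def split: if_splits)
    have "m = Poly_Mapping.single v 1 + (m - Poly_Mapping.single v 1)"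
      by (rule poly_mapping_eqI) (use mv in \<open>auto simp: lookup_add lookup_minus lookup_single when_def\<close>)
    then have eq: "Poly_Mapping.single m (Poly_Mapping.lookup f m) =
        var_poly v * Poly_Mapping.single (m - Poly_Mapping.single v 1) (Poly_Mapping.lookup f m)"
      by (simp add: var_poly_def mult_single)
    have "(\<Sum>u\<in>S. var_poly u * (if u = v then g else 0)) = (\<Sum>u\<in>S. if u = v then var_poly u * g else 0)"
      for g :: "('v, 'k) mpoly"
      by (rule sum.cong) auto
    then have "var_poly v * g = (\<Sum>u\<in>S. var_poly u * (if u = v then g else 0))" for g :: "('v, 'k) mpoly"
      using v(1) S(1) by simp
    from exI[of "\<lambda>c. _ = (\<Sum>u\<in>S. var_poly u * c u)", OF this]
    show ?thesis unfolding eq by (rule CollectI)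
  qed
  then have "(\<Sum>m\<in>Poly_Mapping.keys f. Poly_Mapping.single m (Poly_Mapping.lookup f m)) \<in> ?I"
    by (rule ideal_sum[OF I])
  then have "f \<in> ?I" using poly_mapping_sum_single[of "Poly_Mapping.keys f" f] by simp
  then show ?thesis by (elim CollectE exE) (rule that)
qed

text \<open>The substitution \<open>\<Psi>\<close> carries the forms \<open>Y v\<close> to the
  variables, where regularity is a matter of monomials; substituting \<open>Y\<close> carries the
  conclusion back.\<close>

lemma coordinates_regular:
  fixes Y \<Psi> :: "'v \<Rightarrow> ('v, 'k::comm_ring_1) mpoly"
  assumes inv: "\<And>v. subst_poly \<Psi> (Y v) = var_poly v" "\<And>v. subst_poly Y (\<Psi> v) = var_poly v"
    and e: "inj_on e {..<n}" and k: "k < n"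
    and f: "Y (e k) * f \<in> adjoin_seq (\<lambda>i. Y (e i)) {0} k"
  shows "f \<in> adjoin_seq (\<lambda>i. Y (e i)) {0} k"
proof -
  obtain c where c: "Y (e k) * f = (\<Sum>i<k. Y (e i) * c i)" using f by (auto simp: adjoin_seq_zero_iff)
  have inj: "inj_on e {..<k}" using e k by (auto intro: inj_on_subset)
  define c' where "c' v = subst_poly \<Psi> (c (the_inv_into {..<k} e v))" for v
  have "var_poly (e k) * subst_poly \<Psi> f = subst_poly \<Psi> (Y (e k) * f)"
    by (simp add: subst.poly_eval_mult inv)
  also have "\<dots> = (\<Sum>i<k. var_poly (e i) * c' (e i))"
    unfolding c
    by (simp add: subst.poly_eval_sum subst.poly_eval_mult inv c'_def the_inv_into_f_f[OF inj])
  also have "\<dots> = (\<Sum>v\<in>e ` {..<k}. var_poly v * c' v)" by (simp add: sum.reindex[OF inj])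
  finally have eq: "var_poly (e k) * subst_poly \<Psi> f = (\<Sum>v\<in>e ` {..<k}. var_poly v * c' v)" .
  have "e k \<notin> e ` {..<k}"
  proof
    assume "e k \<in> e ` {..<k}"
    then obtain i where "i < k" "e k = e i" by blast
    then show False using inj_onD[OF e, of k i] k by simp
  qed
  then obtain b where b: "subst_poly \<Psi> f = (\<Sum>v\<in>e ` {..<k}. var_poly v * b v)"
    using variables_regular[OF _ _ eq] by auto
  have "f = subst_poly Y (subst_poly \<Psi> f)" using subst_poly_inverse[OF inv(2)] by simp
  also have "\<dots> = (\<Sum>i<k. Y (e i) * subst_poly Y (b (e i)))"
    unfolding b by (simp add: subst.poly_eval_sum subst.poly_eval_mult sum.reindex[OF inj])
  finally show ?thesis by (auto simp: adjoin_seq_zero_iff intro!: exI[of _ "\<lambda>i. subst_poly Y (b (e i))"])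
qed

text \<open>The forms are in echelon shape: \<open>x\<close> does not involve \<open>v1\<close>, and
  both pivots are one. The change of variables is therefore triangular and can be inverted by hand.
  The last conclusion later makes the new coordinates generate the irrelevant ideal.\<close>

lemma exists_coordinates:
  fixes \<alpha> \<beta> :: "'v::finite \<Rightarrow> 'k::comm_ring_1"
  assumes v: "v1 \<noteq> v2"
    and l: "l = var_poly v1 + (\<Sum>v\<in>UNIV - {v1}. const_poly (\<alpha> v) * var_poly v)"
    and x: "x = var_poly v2 + (\<Sum>v\<in>UNIV - {v1, v2}. const_poly (\<beta> v) * var_poly v)"
  obtains \<Psi> Y :: "'v \<Rightarrow> ('v, 'k) mpoly" where
    "\<forall>v. subst_poly \<Psi> (Y v) = var_poly v" "\<forall>v. subst_poly Y (\<Psi> v) = var_poly v"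
    "Y v1 = l" "Y v2 = x" "\<forall>v. Y v \<in> forms 1"
    "\<forall>I v. is_ideal I \<longrightarrow> range Y \<subseteq> I \<longrightarrow> var_poly v \<in> I"
proof -
  define Y where "Y v = (if v = v1 then l else if v = v2 then x else var_poly v)" for v
  \<comment> \<open>\<open>\<Phi>\<close> undoes the change at \<open>v2\<close>;
    \<open>\<Psi>\<close> inserts the result when it solves for \<open>v1\<close>.\<close>
  define \<Phi> where "\<Phi> v = (if v = v2 then var_poly v2 - (\<Sum>v\<in>UNIV - {v1, v2}. const_poly (\<beta> v) * var_poly v)
      else var_poly v :: ('v, 'k) mpoly)" for v
  define \<Psi> where "\<Psi> v = (if v = v1 then var_poly v1 - (\<Sum>v\<in>UNIV - {v1}. const_poly (\<alpha> v) * \<Phi> v)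
      else \<Phi> v)" for v
  have Psi_other: "\<Psi> v = var_poly v" "Y v = var_poly v" if "v \<noteq> v1" "v \<noteq> v2" for v
    using that by (simp_all add: \<Psi>_def \<Phi>_def Y_def)
  have Psi2: "\<Psi> v2 = var_poly v2 - (\<Sum>v\<in>UNIV - {v1, v2}. const_poly (\<beta> v) * var_poly v)"
    and Psi1: "\<Psi> v1 = var_poly v1 - (\<Sum>v\<in>UNIV - {v1}. const_poly (\<alpha> v) * \<Psi> v)"
    using v by (simp_all add: \<Psi>_def \<Phi>_def)
  have "subst_poly \<Psi> x = \<Psi> v2 + (\<Sum>v\<in>UNIV - {v1, v2}. const_poly (\<beta> v) * \<Psi> v)"
    by (simp add: x subst.poly_eval_simps)
  also have "(\<Sum>v\<in>UNIV - {v1, v2}. const_poly (\<beta> v) * \<Psi> v) =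
      (\<Sum>v\<in>UNIV - {v1, v2}. const_poly (\<beta> v) * var_poly v)"
    by (rule sum.cong) (auto simp: Psi_other)
  finally have x': "subst_poly \<Psi> x = var_poly v2" by (simp add: Psi2)
  have l': "subst_poly \<Psi> l = var_poly v1"
    by (simp add: l subst.poly_eval_simps Psi1)
  have 1: "subst_poly \<Psi> (Y v) = var_poly v" for v
    using x' l' by (simp add: Y_def Psi_other)
  have "subst_poly Y (\<Psi> v2) = x - (\<Sum>v\<in>UNIV - {v1, v2}. const_poly (\<beta> v) * Y v)"
    using v by (simp add: Psi2 subst.poly_eval_simps) (simp add: Y_def)
  also have "(\<Sum>v\<in>UNIV - {v1, v2}. const_poly (\<beta> v) * Y v) =
      (\<Sum>v\<in>UNIV - {v1, v2}. const_poly (\<beta> v) * var_poly v)"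
    by (rule sum.cong) (auto simp: Psi_other)
  finally have y2: "subst_poly Y (\<Psi> v2) = var_poly v2" by (simp add: x)
  have y3: "subst_poly Y (\<Psi> v) = var_poly v" if "v \<noteq> v1" for v
    using y2 that by (cases "v = v2") (simp_all add: Psi_other)
  have "subst_poly Y (\<Psi> v1) = l - (\<Sum>v\<in>UNIV - {v1}. const_poly (\<alpha> v) * subst_poly Y (\<Psi> v))"
    by (simp add: Psi1 subst.poly_eval_simps) (simp add: Y_def)
  also have "(\<Sum>v\<in>UNIV - {v1}. const_poly (\<alpha> v) * subst_poly Y (\<Psi> v)) =
      (\<Sum>v\<in>UNIV - {v1}. const_poly (\<alpha> v) * var_poly v)"
    by (rule sum.cong) (auto simp: y3)
  finally have "subst_poly Y (\<Psi> v1) = var_poly v1" by (simp add: l)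
  then have 2: "subst_poly Y (\<Psi> v) = var_poly v" for v using y3 by (cases "v = v1") simp_all
  have lf: "l \<in> forms 1" "x \<in> forms 1"
    unfolding l x by (auto intro!: forms_add forms_sum forms_const_mult)
  have 3: "Y v \<in> forms 1" for v using lf by (simp add: Y_def)
  have 4: "var_poly v \<in> I" if I: "is_ideal I" and YI: "\<And>v. Y v \<in> I" for I v
  proof -
    have o: "var_poly v \<in> I" if "v \<noteq> v1" "v \<noteq> v2" for v using YI[of v] Psi_other(2)[OF that] by simp
    have "x \<in> I" "l \<in> I" using YI[of v2] YI[of v1] v by (simp_all add: Y_def)
    then have v2: "var_poly v2 \<in> I"
      using ideal_diff[OF I, of x "\<Sum>v\<in>UNIV - {v1, v2}. const_poly (\<beta> v) * var_poly v"] o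
      by (auto simp: x intro!: ideal_sum[OF I] ideal_mult_left[OF I])
    have "(\<Sum>v\<in>UNIV - {v1}. const_poly (\<alpha> v) * var_poly v) \<in> I"
      using o v2 by (intro ideal_sum[OF I] ideal_mult_left[OF I]) (metis DiffD2 insertI1)
    from ideal_diff[OF I \<open>l \<in> I\<close> this] have "var_poly v1 \<in> I" by (simp add: l)
    then show ?thesis using o v2 by metis
  qed
  have Yv: "Y v1 = l" "Y v2 = x" using v by (simp_all add: Y_def)
  have "\<forall>I v. is_ideal I \<longrightarrow> range Y \<subseteq> I \<longrightarrow> var_poly v \<in> I" using 4 by blast
  then show ?thesis using that[of \<Psi> Y] 1 2 3 Yv by blast
qed

section \<open>Truncated ideals\<close>

lemma truncation_ideal_eq:
  assumes I: "homogeneous_ideal I"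
  shows "truncation_ideal d I = ideal_generated {s. \<exists>e\<le>d. s \<in> I \<inter> forms e}"
proof
  let ?S = "{s. \<exists>e\<le>d. s \<in> I \<inter> forms e}"
  show "truncation_ideal d I \<subseteq> ideal_generated ?S"
    unfolding truncation_ideal_def
  proof (rule ideal_generated_minimal[OF _ is_ideal_generated], rule subsetI)
    fix f assume "f \<in> {f \<in> I. \<forall>m\<in>Poly_Mapping.keys f. mon_degree m \<le> d}"
    then have f: "f \<in> I" "f = (\<Sum>t\<in>{..d}. hcomp t f)" by (auto intro!: sum_hcomp)
    have "hcomp t f \<in> ideal_generated ?S" if "t \<le> d" for t
      using that homogeneous_hcomp[OF I f(1), of t] ideal_generated_superset[of ?S] hcomp_in_forms[of t f]
      by blast
    then show "f \<in> ideal_generated ?S"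
      by (subst f(2)) (auto intro!: ideal_sum[OF is_ideal_generated])
  qed
  show "ideal_generated ?S \<subseteq> truncation_ideal d I"
    unfolding truncation_ideal_def by (rule ideal_generated_mono) (auto simp: forms_def)
qed

lemma homogeneous_truncation: "homogeneous_ideal I \<Longrightarrow> homogeneous_ideal (truncation_ideal d I)"
  unfolding truncation_ideal_eq by (rule homogeneous_ideal_generated) blast

lemma truncation_subset: "is_ideal I \<Longrightarrow> truncation_ideal d I \<subseteq> I"
  unfolding truncation_ideal_def by (rule ideal_generated_minimal) auto

lemma truncation_forms:
  assumes I: "homogeneous_ideal I" and "t \<le> d"
  shows "truncation_ideal d I \<inter> forms t = I \<inter> forms t"
proof -
  have "I \<inter> forms t \<subseteq> truncation_ideal d I"
    unfolding truncation_ideal_eq[OF I]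
    by (rule subset_trans[OF _ ideal_generated_superset]) (use assms(2) in auto)
  then show ?thesis using truncation_subset[OF homogeneous_is_ideal[OF I]] by auto
qed

text \<open>A generator has degree \<open>e \<le> d \<le> t\<close>, so in degree
  \<open>Suc t\<close> its multiplier has positive degree and lies in the ideal of the
  \<open>y i\<close>. Splitting the multiplier, not the generator, keeps the new coefficients in the
  truncated ideal.\<close>

lemma truncation_generated:
  fixes I :: "('v::finite, 'k::comm_ring_1) mpoly set"
  assumes I: "homogeneous_ideal I" and y: "\<And>i. y i \<in> forms 1"
    and vars: "\<And>v. var_poly v \<in> adjoin_seq y {0} n" and t: "d \<le> t"
    and f: "f \<in> truncation_ideal d I" "f \<in> forms (Suc t)"
  shows "\<exists>g. (\<forall>i. g i \<in> truncation_ideal d I \<inter> forms t) \<and> f = (\<Sum>i<n. y i * g i)"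
proof -
  let ?T = "truncation_ideal d I"
  have T: "is_ideal ?T" by (simp add: truncation_ideal_def is_ideal_generated)
  \<comment> \<open>The claim is made for a component, because partial sums in the span need not be
    homogeneous.\<close>
  have "\<exists>g. (\<forall>i. g i \<in> ?T \<inter> forms t) \<and> hcomp (Suc t) f = (\<Sum>i<n. y i * g i)"
    using f(1) unfolding truncation_ideal_eq[OF I]
  proof (induction rule: ideal_generated_induct)
    case zero
    show ?case using ideal_zero[OF is_ideal_generated] by (auto intro!: exI[of _ "\<lambda>_. 0"])
  next
    case (step c s f')
    then obtain g where g: "\<And>i. g i \<in> ?T \<inter> forms t" "hcomp (Suc t) f' = (\<Sum>i<n. y i * g i)"
      unfolding truncation_ideal_eq[OF I] by blast
    obtain e where e: "e \<le> d" "s \<in> I" "s \<in> forms e" using step(1) by blast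
    have s: "s \<in> ?T" using truncation_forms[OF I e(1)] e by auto
    obtain cv where cv: "hcomp (Suc (t - e)) c = (\<Sum>v\<in>UNIV. var_poly v * cv v)"
      using forms_Suc_decompose[OF hcomp_in_forms[of "Suc (t - e)" c]] by blast
    have "hcomp (Suc (t - e)) c \<in> adjoin_seq y {0} n"
      unfolding cv using vars is_ideal_adjoin_seq[OF is_ideal_zero, of y n]
      by (intro ideal_sum ideal_mult_right) auto
    then obtain b where b: "hcomp (Suc (t - e)) c = (\<Sum>i<n. y i * b i)"
      by (auto simp: adjoin_seq_zero_iff)
    have "hcomp (Suc (t - e)) (hcomp (Suc (t - e)) c) = hcomp (Suc (t - e)) c"
      by (simp add: hcomp_forms[OF hcomp_in_forms])
    then have b': "hcomp (Suc (t - e)) c = (\<Sum>i<n. y i * hcomp (t - e) (b i))"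
      unfolding b by (simp add: hcomp_sum hcomp_mult_forms[OF y])
    have "hcomp (Suc t) (c * s) = s * hcomp (Suc (t - e)) c"
      using e t by (simp add: mult.commute[of c] hcomp_mult_forms[OF e(3)] Suc_diff_le)
    then have eq: "hcomp (Suc t) (c * s + f') = (\<Sum>i<n. y i * (s * hcomp (t - e) (b i) + g i))"
      by (simp add: hcomp_add b' g(2) sum_distrib_left distrib_left sum.distrib mult.left_commute)
    have "s * hcomp (t - e) (b i) + g i \<in> ?T \<inter> forms t" for i
    proof -
      have "s * hcomp (t - e) (b i) \<in> forms (e + (t - e))" by (rule forms_mult[OF e(3) hcomp_in_forms])
      then show ?thesis
        using g(1)[of i] e t s by (auto intro!: ideal_add[OF T] ideal_mult_right[OF T] forms_add)
    qed
    then show ?case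
      unfolding truncation_ideal_eq[OF I, symmetric] eq
      by (intro exI[of _ "\<lambda>i. s * hcomp (t - e) (b i) + g i"]) blast
  qed
  then show ?thesis using f(2) by (simp add: hcomp_forms)
qed

section \<open>Generic linear forms\<close>

interpretation evaluation: poly_evaluation "\<lambda>c. c"
  by unfold_locales simp_all

lemmas eval_poly_simps = evaluation.poly_eval_simps[folded eval_poly_eq]
  evaluation.poly_eval_const[folded eval_poly_eq] evaluation.poly_eval_var[folded eval_poly_eq]
  evaluation.poly_eval_zero[folded eval_poly_eq] evaluation.poly_eval_one[folded eval_poly_eq]

lemma poly_vars_zero [simp]: "poly_vars 0 = {}"
  by (simp add: poly_vars_def)

lemma poly_vars_one [simp]: "poly_vars 1 = {}"
  by (simp add: poly_vars_def)

lemma poly_vars_add: "poly_vars f \<subseteq> S \<Longrightarrow> poly_vars g \<subseteq> S \<Longrightarrow> poly_vars (f + g) \<subseteq> S"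
proof
  fix v assume fg: "poly_vars f \<subseteq> S" "poly_vars g \<subseteq> S" and "v \<in> poly_vars (f + g)"
  then obtain m where m: "m \<in> Poly_Mapping.keys (f + g)" "v \<in> Poly_Mapping.keys m"
    by (auto simp: poly_vars_def)
  then have "m \<in> Poly_Mapping.keys f \<or> m \<in> Poly_Mapping.keys g" using keys_add[of f g] by blast
  then show "v \<in> S" using fg m(2) by (auto simp: poly_vars_def)
qed

lemma poly_vars_uminus: "poly_vars f \<subseteq> S \<Longrightarrow> poly_vars (- f) \<subseteq> S"
  by (auto simp: poly_vars_def in_keys_iff)

lemma poly_vars_diff: "poly_vars f \<subseteq> S \<Longrightarrow> poly_vars g \<subseteq> S \<Longrightarrow> poly_vars (f - g) \<subseteq> S"
  using poly_vars_add[of f S "-g"] poly_vars_uminus[of g S] by simp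

lemma poly_vars_sum: "(\<And>x. x \<in> A \<Longrightarrow> poly_vars (f x) \<subseteq> S) \<Longrightarrow> poly_vars (sum f A) \<subseteq> S"
  by (induction A rule: infinite_finite_induct) (simp_all add: poly_vars_add)

lemma poly_vars_mult:
  assumes "poly_vars f \<subseteq> S" "poly_vars g \<subseteq> S"
  shows "poly_vars (f * g) \<subseteq> S"
proof
  fix v assume "v \<in> poly_vars (f * g)"
  then obtain m where m: "m \<in> Poly_Mapping.keys (f * g)" "v \<in> Poly_Mapping.keys m"
    by (auto simp: poly_vars_def)
  then obtain a b where ab: "a \<in> Poly_Mapping.keys f" "b \<in> Poly_Mapping.keys g" "m = a + b"
    using keys_mult[of f g] by blast
  then have "v \<in> Poly_Mapping.keys a \<or> v \<in> Poly_Mapping.keys b"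
    using m(2) keys_add[of a b] by blast
  then show "v \<in> S" using assms ab(1,2) by (auto simp: poly_vars_def)
qed

lemma poly_vars_const [simp]: "poly_vars (const_poly c) = {}"
  by (simp add: poly_vars_def const_poly_def)

lemma poly_vars_var: "v \<in> S \<Longrightarrow> poly_vars (var_poly v :: ('v, 'k::comm_ring_1) mpoly) \<subseteq> S"
  by (simp add: poly_vars_def var_poly_def)

text \<open>Two nonvanishing conditions are compared on the line through two given points.\<close>

lemma eval_poly_nonzero_both:
  fixes F G :: "('i, 'k::field_char_0) mpoly"
  assumes F: "eval_poly a F \<noteq> 0" and G: "eval_poly b G \<noteq> 0"
  obtains c where "eval_poly c F \<noteq> 0" "eval_poly c G \<noteq> 0"
proof -
  interpret line: poly_evaluation "\<lambda>c::'k. [:c:]"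
    by unfold_locales (simp_all add: one_pCons)
  define P where "P H = poly_eval (\<lambda>c. [:c:]) (\<lambda>i. [:a i, b i - a i:]) H" for H :: "('i, 'k) mpoly"
  have P: "poly (P H) t = eval_poly (\<lambda>i. a i + t * (b i - a i)) H" for H t
  proof -
    have "poly (mon_eval (\<lambda>i. [:a i, b i - a i:]) m) t = mon_eval (\<lambda>i. a i + t * (b i - a i)) m" for m
      by (simp add: mon_eval_def poly_prod poly_power)
    then show ?thesis by (simp add: P_def eval_poly_eq poly_eval_def poly_sum)
  qed
  have "P F \<noteq> 0" using P[of F 0] F by auto
  moreover have "P G \<noteq> 0" using P[of G 1] G by auto
  ultimately have "finite {t. poly (P F * P G) t = 0}" by (intro poly_roots_finite) simp
  then obtain t where "poly (P F * P G) t \<noteq> 0"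
    using infinite_UNIV_char_0[where 'a = 'k] by (metis (mono_tags, lifting) UNIV_eq_I mem_Collect_eq)
  then have "eval_poly (\<lambda>i. a i + t * (b i - a i)) F \<noteq> 0" "eval_poly (\<lambda>i. a i + t * (b i - a i)) G \<noteq> 0"
    by (simp_all add: P)
  then show ?thesis by (rule that)
qed

lemma holds_generically_conj:
  fixes P Q :: "('i \<Rightarrow> 'k::field_char_0) \<Rightarrow> bool"
  assumes "holds_generically S P" "holds_generically S Q"
  shows "holds_generically S (\<lambda>a. P a \<and> Q a)"
proof -
  obtain F a where F: "poly_vars F \<subseteq> S" "eval_poly a F \<noteq> 0" "\<And>a. eval_poly a F \<noteq> 0 \<Longrightarrow> P a"
    using assms(1) unfolding holds_generically_def by blast
  obtain G b where G: "poly_vars G \<subseteq> S" "eval_poly b G \<noteq> 0" "\<And>a. eval_poly a G \<noteq> 0 \<Longrightarrow> Q a"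
    using assms(2) unfolding holds_generically_def by blast
  obtain c where "eval_poly c F \<noteq> 0" "eval_poly c G \<noteq> 0"
    using eval_poly_nonzero_both[OF F(2) G(2)] by blast
  then show ?thesis
    unfolding holds_generically_def using F G poly_vars_mult[OF F(1) G(1)]
    by (intro exI[of _ "F * G"]) (auto simp: eval_poly_simps)
qed

lemma holds_generically_mono:
  "holds_generically S P \<Longrightarrow> (\<And>a. P a \<Longrightarrow> Q a) \<Longrightarrow> holds_generically S Q"
  unfolding holds_generically_def by blast

lemma holds_generically_exists: "holds_generically S P \<Longrightarrow> \<exists>a. P a"
  unfolding holds_generically_def by blast

lemma holds_generically_True: "holds_generically S (\<lambda>a. True)"
  unfolding holds_generically_def by (intro exI[of _ "const_poly 1"]) (simp add: eval_poly_simps)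

lemma holds_generically_ball:
  fixes P :: "'b \<Rightarrow> ('i \<Rightarrow> 'k::field_char_0) \<Rightarrow> bool"
  assumes "finite A" "\<And>x. x \<in> A \<Longrightarrow> holds_generically S (P x)"
  shows "holds_generically S (\<lambda>a. \<forall>x\<in>A. P x a)"
  using assms
proof (induction A rule: finite_induct)
  case empty show ?case by (simp add: holds_generically_True)
next
  case (insert x A)
  have "holds_generically S (\<lambda>a. P x a \<and> (\<forall>x\<in>A. P x a))"
    by (rule holds_generically_conj) (use insert in auto)
  then show ?case by simp
qed

text \<open>Gaussian elimination with polynomial entries: the pivot entries multiply to the polynomial
  that defines the open set.\<close>

lemma full_rank_open:
  fixes W :: "('c \<Rightarrow> ('i, 'k::field) mpoly) set"
  assumes "finite C" and "\<And>w c. w \<in> W \<Longrightarrow> c \<in> C \<Longrightarrow> poly_vars (w c) \<subseteq> S"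
    and "\<And>\<mu> c. (\<And>w. w \<in> W \<Longrightarrow> (\<Sum>c\<in>C. \<mu> c * eval_poly a0 (w c)) = 0) \<Longrightarrow> c \<in> C \<Longrightarrow> \<mu> c = 0"
  shows "\<exists>F. poly_vars F \<subseteq> S \<and> eval_poly a0 F \<noteq> 0 \<and> (\<forall>a. eval_poly a F \<noteq> 0 \<longrightarrow>
    (\<forall>\<mu>. (\<forall>w\<in>W. (\<Sum>c\<in>C. \<mu> c * eval_poly a (w c)) = 0) \<longrightarrow> (\<forall>c\<in>C. \<mu> c = 0)))"
  using assms
proof (induction C arbitrary: W rule: finite_induct)
  case empty
  show ?case by (intro exI[of _ "const_poly 1"]) (simp add: eval_poly_simps)
next
  case (insert x C)
  \<comment> \<open>A pivot exists: if the column \<open>x\<close> vanished at \<open>a0\<close>,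
    the indicator of \<open>x\<close> would be a nonzero solution.\<close>
  have "\<exists>w\<in>W. eval_poly a0 (w x) \<noteq> 0"
  proof (rule ccontr)
    assume no: "\<not> (\<exists>w\<in>W. eval_poly a0 (w x) \<noteq> 0)"
    define \<mu> where "\<mu> c = (if c = x then 1 else 0 :: 'k)" for c
    have "(\<Sum>c\<in>insert x C. \<mu> c * eval_poly a0 (w c)) = 0" if "w \<in> W" for w
    proof -
      have "(\<Sum>c\<in>C. \<mu> c * eval_poly a0 (w c)) = 0"
        by (rule sum.neutral) (use insert(2) in \<open>auto simp: \<mu>_def\<close>)
      then show ?thesis using insert(1,2) no that by simp
    qed
    from insert(5)[of \<mu> x, OF this] show False by (simp add: \<mu>_def)
  qed
  then obtain w0 where w0: "w0 \<in> W" "eval_poly a0 (w0 x) \<noteq> 0" by blast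
  \<comment> \<open>Elimination by cross multiplication avoids division, so that the reduced rows
    stay polynomial.\<close>
  define red where "red w c = w0 x * w c - w x * w0 c" for w c
  have red: "(\<Sum>c\<in>C. \<mu> c * eval_poly a (red w c)) =
      eval_poly a (w0 x) * (\<Sum>c\<in>C. \<mu> c * eval_poly a (w c)) -
      eval_poly a (w x) * (\<Sum>c\<in>C. \<mu> c * eval_poly a (w0 c))" for \<mu> a w
    by (simp add: red_def eval_poly_simps sum_distrib_left sum_subtractf[symmetric] algebra_simps)
  have "\<exists>F. poly_vars F \<subseteq> S \<and> eval_poly a0 F \<noteq> 0 \<and> (\<forall>a. eval_poly a F \<noteq> 0 \<longrightarrow>
    (\<forall>\<mu>. (\<forall>w\<in>red ` W. (\<Sum>c\<in>C. \<mu> c * eval_poly a (w c)) = 0) \<longrightarrow> (\<forall>c\<in>C. \<mu> c = 0)))"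
  proof (rule insert(3))
    fix w c assume "w \<in> red ` W" "c \<in> C"
    then obtain w' where "w' \<in> W" "w = red w'" by blast
    then show "poly_vars (w c) \<subseteq> S"
      using \<open>c \<in> C\<close> w0(1)
      by (simp add: red_def) (intro poly_vars_diff poly_vars_mult insert(4); simp)
  next
    fix \<mu> c
    assume mu: "\<And>w. w \<in> red ` W \<Longrightarrow> (\<Sum>c\<in>C. \<mu> c * eval_poly a0 (w c)) = 0" and c: "c \<in> C"
    \<comment> \<open>The value at \<open>x\<close> solves the equation of the pivot row
      \<open>w0\<close>, so that a solution of the reduced system extends to the full one.\<close>
    define \<nu> where "\<nu> = \<mu>(x := - (\<Sum>c\<in>C. \<mu> c * eval_poly a0 (w0 c)) / eval_poly a0 (w0 x))"
    have "(\<Sum>c\<in>insert x C. \<nu> c * eval_poly a0 (w c)) = 0" if w: "w \<in> W" for w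
    proof -
      have "(\<Sum>c\<in>C. \<nu> c * eval_poly a0 (w c)) = (\<Sum>c\<in>C. \<mu> c * eval_poly a0 (w c))"
        by (rule sum.cong) (use insert(2) in \<open>auto simp: \<nu>_def\<close>)
      then have "(\<Sum>c\<in>insert x C. \<nu> c * eval_poly a0 (w c)) =
          \<nu> x * eval_poly a0 (w x) + (\<Sum>c\<in>C. \<mu> c * eval_poly a0 (w c))"
        using insert(1,2) by simp
      also have "eval_poly a0 (w0 x) * \<dots> = (\<Sum>c\<in>C. \<mu> c * eval_poly a0 (red w c))"
        unfolding red using w0(2) by (simp add: \<nu>_def field_simps)
      also have "\<dots> = 0" using mu w by blast
      finally show ?thesis using w0(2) by simp
    qed
    from insert(5)[of \<nu> c, OF this] c show "\<mu> c = 0"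
      using insert(2) by (auto simp: \<nu>_def split: if_splits)
  qed
  then obtain F where F: "poly_vars F \<subseteq> S" "eval_poly a0 F \<noteq> 0"
    "\<And>a \<mu>. eval_poly a F \<noteq> 0 \<Longrightarrow> \<forall>w\<in>red ` W. (\<Sum>c\<in>C. \<mu> c * eval_poly a (w c)) = 0 \<Longrightarrow> \<forall>c\<in>C. \<mu> c = 0"
    by blast
  have "\<forall>c\<in>insert x C. \<mu> c = 0"
    if a: "eval_poly a (F * w0 x) \<noteq> 0"
      and mu: "\<forall>w\<in>W. (\<Sum>c\<in>insert x C. \<mu> c * eval_poly a (w c)) = 0" for a \<mu>
  proof -
    have mu': "(\<Sum>c\<in>C. \<mu> c * eval_poly a (w c)) = - (\<mu> x * eval_poly a (w x))" if "w \<in> W" for w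
      using mu that insert(1,2) by (simp add: eq_neg_iff_add_eq_0 add.commute)
    have "\<forall>c\<in>C. \<mu> c = 0"
    proof (rule F(3))
      show "eval_poly a F \<noteq> 0" using a by (auto simp: eval_poly_simps)
      show "\<forall>w\<in>red ` W. (\<Sum>c\<in>C. \<mu> c * eval_poly a (w c)) = 0"
        using mu' w0(1) by (auto simp: red)
    qed
    moreover from this have "\<mu> x * eval_poly a (w0 x) = 0" using mu'[OF w0(1)] by simp
    then have "\<mu> x = 0" using a by (auto simp: eval_poly_simps)
    ultimately show ?thesis by simp
  qed
  moreover have "poly_vars (F * w0 x) \<subseteq> S" using F(1) insert(4)[OF w0(1)] by (intro poly_vars_mult) auto
  moreover have "eval_poly a0 (F * w0 x) \<noteq> 0" using F(2) w0(2) by (simp add: eval_poly_simps)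
  ultimately show ?case by blast
qed

lemma vector_space_field: "vector_space ((*) :: 'k::field \<Rightarrow> 'k \<Rightarrow> 'k)"
  by unfold_locales (simp_all add: algebra_simps)

text \<open>A linear certificate for not lying in an ideal: a basis of \<open>V\<close> is enlarged
  by \<open>e\<close>, and the functional is prescribed on the larger set. It turns containments
  into linear equations on coefficients.\<close>

lemma exists_functional:
  fixes V :: "('v, 'k::field) mpoly set"
  assumes V: "is_ideal V" and "e \<notin> V"
  obtains \<phi> :: "('v, 'k) mpoly \<Rightarrow> 'k" where "\<And>f g. \<phi> (f + g) = \<phi> f + \<phi> g"
    "\<And>c f. \<phi> (const_poly c * f) = c * \<phi> f" "\<And>f. f \<in> V \<Longrightarrow> \<phi> f = 0" "\<phi> e = 1"
proof -
  interpret vector_space_pair "scale_poly :: 'k \<Rightarrow> ('v, 'k) mpoly \<Rightarrow> _" "(*) :: 'k \<Rightarrow> 'k \<Rightarrow> 'k"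
    by (rule vector_space_pair.intro) (rule vector_space_mpoly vector_space_field)+
  have sub: "vs1.subspace V"
    using V by (intro vs1.subspaceI) (auto simp: scale_poly_def intro: ideal_zero ideal_add ideal_mult_left)
  obtain B where B: "B \<subseteq> V" "vs1.independent B" "V \<subseteq> vs1.span B"
    using vs1.maximal_independent_subset[of V] by blast
  have "vs1.span B \<subseteq> V" by (rule vs1.span_minimal[OF B(1) sub])
  then have "e \<notin> vs1.span B" using assms(2) by blast
  then have "vs1.independent (insert e B)" using B(2) by (intro vs1.independent_insertI)
  then obtain \<phi> where phi: "Vector_Spaces.linear scale_poly (*) \<phi>"
    "\<forall>x\<in>insert e B. \<phi> x = (if x = e then 1 else 0)"
    using linear_independent_extend[of "insert e B" "\<lambda>x. if x = e then 1 else 0"] by blast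
  interpret p: Vector_Spaces.linear scale_poly "(*)" \<phi> by (rule phi(1))
  have "\<phi> f = 0" if "f \<in> V" for f
  proof (rule p.eq_0_on_span)
    show "f \<in> vs1.span B" using B(3) that by blast
    show "\<And>x. x \<in> B \<Longrightarrow> \<phi> x = 0" using phi(2) B(1) assms(2) by auto
  qed
  then show ?thesis using that[of \<phi>] phi(2) p.add p.scale by (auto simp: scale_poly_def)
qed

lemma functional_sum:
  assumes "\<And>f g. \<phi> (f + g) = \<phi> f + \<phi> g"
  shows "\<phi> (sum f A) = (\<Sum>x\<in>A. \<phi> (f x) :: 'k::field)"
proof -
  have "\<phi> 0 = 0" using assms[of 0 0] by (metis add.right_neutral add_left_cancel)
  then show ?thesis by (induction A rule: infinite_finite_induct) (simp_all add: assms)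
qed

lemma linear_form_forms: "linear_form c \<in> forms 1"
  unfolding linear_form_def by (auto intro!: forms_sum forms_const_mult)

text \<open>A functional vanishing on \<open>P\<close> but not on some variable, applied to the
  linear form, gives a nonzero linear polynomial in the coefficients. Its nonvanishing is
  sufficient, and \<open>P\<close> may have any residue field.\<close>

lemma linear_form_avoids_generically:
  fixes P :: "('v::finite, 'k::field_char_0) mpoly set" and i s :: nat
  assumes P: "P \<in> Proj_points" and i: "i < s"
  shows "holds_generically ({..<s} \<times> UNIV) (\<lambda>a. linear_form (\<lambda>v. a (i, v)) \<notin> P)"
proof -
  obtain v0 where v0: "var_poly v0 \<notin> P" using P by (auto simp: Proj_points_iff)
  obtain \<phi> :: "('v, 'k) mpoly \<Rightarrow> 'k" where phi: "\<And>f g. \<phi> (f + g) = \<phi> f + \<phi> g"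
    "\<And>c f. \<phi> (const_poly c * f) = c * \<phi> f" "\<And>f. f \<in> P \<Longrightarrow> \<phi> f = 0" "\<phi> (var_poly v0) = 1"
    using exists_functional[OF Proj_ideal[OF P] v0] by blast
  define F :: "(nat \<times> 'v, 'k) mpoly" where
    "F = (\<Sum>v\<in>UNIV. const_poly (\<phi> (var_poly v)) * var_poly (i, v))"
  have eval: "eval_poly a F = \<phi> (linear_form (\<lambda>v. a (i, v)))" for a
    unfolding F_def linear_form_def eval_poly_simps functional_sum[OF phi(1)] phi(2)
    by (rule sum.cong[OF refl]) (rule mult.commute)
  have "poly_vars F \<subseteq> {..<s} \<times> UNIV"
    unfolding F_def using i by (intro poly_vars_sum poly_vars_mult poly_vars_var) auto
  moreover have "eval_poly (\<lambda>(j, v). if v = v0 then 1 else 0) F \<noteq> 0"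
  proof -
    have "linear_form (\<lambda>v. if v = v0 then 1 else 0) = (\<Sum>v\<in>UNIV. if v = v0 then var_poly v else 0 :: ('v, 'k) mpoly)"
      unfolding linear_form_def by (rule sum.cong) auto
    then show ?thesis by (simp add: eval phi(4))
  qed
  moreover have "linear_form (\<lambda>v. a (i, v)) \<notin> P" if "eval_poly a F \<noteq> 0" for a
    using that phi(3) by (auto simp: eval)
  ultimately show ?thesis unfolding holds_generically_def by blast
qed

section \<open>General linear sections and the invariant \<open>r_inv\<close>\<close>

abbreviation section_ideal ::
  "nat \<Rightarrow> ('v::finite, 'k::field) mpoly set \<Rightarrow> (nat \<times> 'v \<Rightarrow> 'k) \<Rightarrow> ('v, 'k) mpoly set" where
  "section_ideal s I a \<equiv> ideal_generated (I \<union> (\<lambda>i. linear_form (\<lambda>v. a (i, v))) ` {..<s})"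

text \<open>All forms of degree \<open>k\<close> lie in the section iff no nonzero functional on
  them annihilates the section. This is a full rank condition on a matrix whose entries are
  polynomials in \<open>a\<close>, hence open by \<open>full_rank_open\<close>.\<close>

lemma section_forms_generically:
  fixes I :: "('v::finite, 'k::field_char_0) mpoly set"
  assumes I: "homogeneous_ideal I" and a0: "forms k \<subseteq> section_ideal s I a0"
  shows "holds_generically ({..<s} \<times> UNIV) (\<lambda>a. forms k \<subseteq> section_ideal s I a)"
proof -
  \<comment> \<open>Columns are the monomials of degree \<open>k\<close>. The rows \<open>W1\<close>
    come from \<open>I\<close> and are constant in \<open>a\<close>; the row \<open>w2 q j\<close>
    holds the coefficients of the monomial \<open>q\<close> times the form number \<open>j\<close>
    and is linear in \<open>a\<close>.\<close>
  define C where "C = {m :: 'v \<Rightarrow>\<^sub>0 nat. mon_degree m = k}"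
  have C: "finite C" by (simp add: C_def finite_monomials)
  define W1 :: "(('v \<Rightarrow>\<^sub>0 nat) \<Rightarrow> (nat \<times> 'v, 'k) mpoly) set" where
    "W1 = (\<lambda>f m. const_poly (Poly_Mapping.lookup f m)) ` I"
  define w2 :: "('v \<Rightarrow>\<^sub>0 nat) \<Rightarrow> nat \<Rightarrow> ('v \<Rightarrow>\<^sub>0 nat) \<Rightarrow> (nat \<times> 'v, 'k) mpoly" where
    "w2 q j m = (\<Sum>v\<in>UNIV. if q + Poly_Mapping.single v 1 = m then var_poly (j, v) else 0)" for q j m
  define W where "W = W1 \<union> {w2 q j | q j. j < s}"
  have lookup_eq: "Poly_Mapping.lookup (Poly_Mapping.single q 1 * linear_form (\<lambda>v. a (j, v))) m = eval_poly a (w2 q j m)"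
    for q j m a
  proof -
    have "Poly_Mapping.single q 1 * linear_form (\<lambda>v. a (j, v)) =
        (\<Sum>v\<in>UNIV. Poly_Mapping.single (q + Poly_Mapping.single v 1) (a (j, v)))"
      by (simp add: linear_form_def sum_distrib_left const_poly_def var_poly_def mult_single)
    moreover have "eval_poly a (w2 q j m) = (\<Sum>v\<in>UNIV. if q + Poly_Mapping.single v 1 = m then a (j, v) else 0)"
      unfolding w2_def by (simp add: eval_poly_simps if_distrib cong: if_cong)
    ultimately show ?thesis by (simp add: lookup_sum lookup_single when_def)
  qed
  have rank: "\<mu> m = 0" if sub: "forms k \<subseteq> section_ideal s I a" and m: "m \<in> C"
    and mu: "\<And>w. w \<in> W \<Longrightarrow> (\<Sum>m\<in>C. \<mu> m * eval_poly a (w m)) = 0" for \<mu> a m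
  proof -
    define \<phi> where "\<phi> f = (\<Sum>m\<in>C. \<mu> m * Poly_Mapping.lookup f m)" for f :: "('v, 'k) mpoly"
    have phi_add: "\<phi> (f + g) = \<phi> f + \<phi> g" for f g
      by (simp add: \<phi>_def lookup_add distrib_left sum.distrib)
    have phi_const: "\<phi> (const_poly c * f) = c * \<phi> f" for c f
      by (simp add: \<phi>_def lookup_const_poly_mult sum_distrib_left mult.left_commute)
    have phi_I: "\<phi> f = 0" if "f \<in> I" for f
      using mu[of "\<lambda>m. const_poly (Poly_Mapping.lookup f m)"] that
      by (simp add: \<phi>_def W_def W1_def eval_poly_simps)
    have phi_l: "\<phi> (Poly_Mapping.single q 1 * linear_form (\<lambda>v. a (j, v))) = 0" if "j < s" for q j
      unfolding \<phi>_def lookup_eq using that by (intro mu) (auto simp: W_def)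
    have "\<phi> f = 0" if "f \<in> section_ideal s I a" for f
      using that
    proof (induction rule: ideal_generated_induct)
      case zero show ?case by (simp add: \<phi>_def)
    next
      case (step c x f)
      from step(1) have "\<phi> (c * x) = 0"
      proof
        assume "x \<in> I"
        then show ?thesis by (intro phi_I ideal_mult_left[OF homogeneous_is_ideal[OF I]])
      next
        assume "x \<in> (\<lambda>i. linear_form (\<lambda>v. a (i, v))) ` {..<s}"
        then obtain j where j: "j < s" "x = linear_form (\<lambda>v. a (j, v))" by auto
        have "c * x = (\<Sum>q\<in>Poly_Mapping.keys c. const_poly (Poly_Mapping.lookup c q) *
            (Poly_Mapping.single q 1 * linear_form (\<lambda>v. a (j, v))))"
          using poly_mapping_sum_single[of "Poly_Mapping.keys c" c]
          by (simp add: const_poly_def mult.assoc[symmetric] mult_single sum_distrib_right[symmetric] j(2))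
        then show ?thesis using j(1) by (simp add: functional_sum[OF phi_add] phi_const phi_l)
      qed
      then show ?case using step(2) by (simp add: phi_add)
    qed
    moreover have "Poly_Mapping.single m 1 \<in> forms k" using m by (auto simp: C_def intro: forms_single)
    ultimately have "\<phi> (Poly_Mapping.single m 1) = 0" using sub by blast
    then show ?thesis using m C by (simp add: \<phi>_def lookup_single when_def if_distrib cong: if_cong)
  qed
  have "\<exists>F. poly_vars F \<subseteq> {..<s} \<times> UNIV \<and> eval_poly a0 F \<noteq> 0 \<and> (\<forall>a. eval_poly a F \<noteq> 0 \<longrightarrow>
    (\<forall>\<mu>. (\<forall>w\<in>W. (\<Sum>c\<in>C. \<mu> c * eval_poly a (w c)) = 0) \<longrightarrow> (\<forall>c\<in>C. \<mu> c = 0)))"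
  proof (rule full_rank_open[OF C])
    fix w c assume "w \<in> W"
    then consider f where "w = (\<lambda>m. const_poly (Poly_Mapping.lookup f m))"
      | q j where "j < s" "w = w2 q j"
      unfolding W_def W1_def by blast
    then show "poly_vars (w c) \<subseteq> {..<s} \<times> UNIV"
    proof cases
      case 1 then show ?thesis by simp
    next
      case (2 q j)
      have "poly_vars (if q + Poly_Mapping.single v 1 = c then var_poly (j, v) else 0 :: (nat \<times> 'v, 'k) mpoly)
          \<subseteq> {..<s} \<times> UNIV" for v
        using 2(1) by (simp add: poly_vars_var)
      then show ?thesis unfolding 2(2) w2_def by (rule poly_vars_sum)
    qed
  next
    fix \<mu> c assume "\<And>w. w \<in> W \<Longrightarrow> (\<Sum>c\<in>C. \<mu> c * eval_poly a0 (w c)) = 0" "c \<in> C"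
    then show "\<mu> c = 0" using rank[OF a0] by blast
  qed
  then obtain F where F: "poly_vars F \<subseteq> {..<s} \<times> UNIV" "eval_poly a0 F \<noteq> 0"
    "\<And>a \<mu>. eval_poly a F \<noteq> 0 \<Longrightarrow> \<forall>w\<in>W. (\<Sum>c\<in>C. \<mu> c * eval_poly a (w c)) = 0 \<Longrightarrow> \<forall>c\<in>C. \<mu> c = 0"
    by blast
  have "forms k \<subseteq> section_ideal s I a" if a: "eval_poly a F \<noteq> 0" for a
  proof (rule ccontr)
    assume "\<not> forms k \<subseteq> section_ideal s I a"
    then obtain e where e: "e \<in> forms k" "e \<notin> section_ideal s I a" by blast
    obtain \<phi> :: "('v, 'k) mpoly \<Rightarrow> 'k" where phi: "\<And>f g. \<phi> (f + g) = \<phi> f + \<phi> g"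
      "\<And>c f. \<phi> (const_poly c * f) = c * \<phi> f" "\<And>f. f \<in> section_ideal s I a \<Longrightarrow> \<phi> f = 0" "\<phi> e = 1"
      using exists_functional[OF is_ideal_generated e(2)] by blast
    define \<mu> where "\<mu> m = \<phi> (Poly_Mapping.single m 1)" for m
    have mu: "(\<Sum>m\<in>C. \<mu> m * Poly_Mapping.lookup f m) = \<phi> (hcomp k f)" for f
    proof -
      have "hcomp k f = (\<Sum>m\<in>C. Poly_Mapping.single m (Poly_Mapping.lookup (hcomp k f) m))"
        by (rule poly_mapping_sum_single[OF C]) (auto simp: C_def in_keys_iff lookup_hcomp split: if_splits)
      also have "\<dots> = (\<Sum>m\<in>C. const_poly (Poly_Mapping.lookup f m) * Poly_Mapping.single m 1)"
        by (rule sum.cong) (auto simp: const_poly_def mult_single C_def lookup_hcomp)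
      finally have eq: "hcomp k f = (\<Sum>m\<in>C. const_poly (Poly_Mapping.lookup f m) * Poly_Mapping.single m 1)" .
      show ?thesis
        unfolding eq functional_sum[OF phi(1)] phi(2) \<mu>_def
        by (rule sum.cong[OF refl]) (rule mult.commute)
    qed
    \<comment> \<open>The rows may stem from polynomials not of degree \<open>k\<close>; homogeneity
      keeps their components of degree \<open>k\<close> in the section ideal, where
      \<open>\<phi>\<close> vanishes.\<close>
    have hom: "homogeneous_ideal (section_ideal s I a)"
    proof -
      have "section_ideal s I a = ideal_generated ((I \<inter> (\<Union>t. forms t)) \<union> (\<lambda>i. linear_form (\<lambda>v. a (i, v))) ` {..<s})"
        (is "_ = ideal_generated ?G")
      proof
        have "I \<subseteq> ideal_generated ?G"
          using ideal_generated_mono[of "I \<inter> (\<Union>t. forms t)" ?G] I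
          unfolding homogeneous_ideal_def by (metis Un_upper1)
        moreover have "(\<lambda>i. linear_form (\<lambda>v. a (i, v))) ` {..<s} \<subseteq> ideal_generated ?G"
          using ideal_generated_superset[of ?G] by blast
        ultimately show "section_ideal s I a \<subseteq> ideal_generated ?G"
          by (intro ideal_generated_minimal is_ideal_generated) blast
        show "ideal_generated ?G \<subseteq> section_ideal s I a" by (rule ideal_generated_mono) blast
      qed
      moreover have "homogeneous_ideal (ideal_generated ?G)"
        by (rule homogeneous_ideal_generated) (use linear_form_forms in blast)
      ultimately show ?thesis by simp
    qed
    have "\<forall>w\<in>W. (\<Sum>m\<in>C. \<mu> m * eval_poly a (w m)) = 0"
    proof
      fix w assume "w \<in> W"
      then consider f where "f \<in> I" "w = (\<lambda>m. const_poly (Poly_Mapping.lookup f m))"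
        | q j where "j < s" "w = w2 q j"
        unfolding W_def W1_def by blast
      then show "(\<Sum>m\<in>C. \<mu> m * eval_poly a (w m)) = 0"
      proof cases
        case (1 f)
        have "f \<in> section_ideal s I a"
          using 1(1) by (intro subsetD[OF ideal_generated_superset] UnI1)
        then have "\<phi> (hcomp k f) = 0" by (intro phi(3) homogeneous_hcomp[OF hom])
        then show ?thesis by (simp add: 1(2) eval_poly_simps mu)
      next
        case (2 q j)
        have "linear_form (\<lambda>v. a (j, v)) \<in> section_ideal s I a"
          using 2(1) by (intro subsetD[OF ideal_generated_superset] UnI2 imageI) simp
        then have "Poly_Mapping.single q 1 * linear_form (\<lambda>v. a (j, v)) \<in> section_ideal s I a"
          by (rule ideal_mult_left[OF is_ideal_generated])
        then have "\<phi> (hcomp k (Poly_Mapping.single q 1 * linear_form (\<lambda>v. a (j, v)))) = 0"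
          by (intro phi(3) homogeneous_hcomp[OF hom])
        then show ?thesis by (simp add: 2(2) lookup_eq[symmetric] mu)
      qed
    qed
    then have "\<forall>m\<in>C. \<mu> m = 0" by (rule F(3)[OF a])
    then have "\<phi> e = 0" using mu[of e] e(1) by (simp add: hcomp_forms)
    then show False using phi(4) by simp
  qed
  then show ?thesis unfolding holds_generically_def using F(1,2) by blast
qed

text \<open>Let \<open>k0\<close> be the least degree filled by the section for some choice of
  forms. By openness a general choice fills it too, and no choice fills a smaller degree, so
  \<open>k0 - 1\<close> is the generic value; two generic values agree since generic conditions have
  a common solution. The assumption \<open>proper\<close> makes \<open>k0\<close> positive, so that
  \<open>k0 - 1\<close> is a genuine predecessor.\<close>

lemma r_inv_forms:
  fixes I :: "('v::finite, 'k::field_char_0) mpoly set"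
  assumes I: "homogeneous_ideal I" and proper: "\<And>a. \<not> forms 0 \<subseteq> section_ideal s I a"
    and ex: "forms k \<subseteq> section_ideal s I a1" and d: "r_inv s I < d"
  shows "holds_generically ({..<s} \<times> UNIV) (\<lambda>a. forms d \<subseteq> section_ideal s I a)"
proof -
  define k0 where "k0 = (LEAST k. \<exists>a. forms k \<subseteq> section_ideal s I a)"
  obtain a0 where a0: "forms k0 \<subseteq> section_ideal s I a0"
    unfolding k0_def using LeastI_ex[of "\<lambda>k. \<exists>a. forms k \<subseteq> section_ideal s I a"] ex by blast
  have least: "\<not> forms j \<subseteq> section_ideal s I a" if "j < k0" for j a
    using not_less_Least[of j "\<lambda>k. \<exists>a. forms k \<subseteq> section_ideal s I a"] that unfolding k0_def by blast
  have k0: "k0 \<noteq> 0" using a0 proper by metis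
  have gen: "holds_generically ({..<s} \<times> UNIV) (\<lambda>a. forms k0 \<subseteq> section_ideal s I a)"
    by (rule section_forms_generically[OF I a0])
  define R where "R r a \<longleftrightarrow> (let J = (\<lambda>i. linear_form (\<lambda>v. a (i, v))) ` {..<s};
            N = {k. hilbert_fun (ideal_generated (I \<union> J)) k \<noteq> 0}
        in r \<in> N \<and> (\<forall>k\<in>N. k \<le> r))" for r and a :: "nat \<times> 'v \<Rightarrow> 'k"
  have R_iff: "R r a \<longleftrightarrow> \<not> forms r \<subseteq> section_ideal s I a \<and>
      (\<forall>k. \<not> forms k \<subseteq> section_ideal s I a \<longrightarrow> k \<le> r)" for r a
    by (simp add: R_def Let_def hilbert_fun_eq_0_iff[OF is_ideal_generated])
  have R1: "holds_generically ({..<s} \<times> UNIV) (R (k0 - 1))"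
  proof (rule holds_generically_mono[OF gen])
    fix a assume a: "forms k0 \<subseteq> section_ideal s I a"
    have "k \<le> k0 - 1" if "\<not> forms k \<subseteq> section_ideal s I a" for k
      using forms_subset_mono[OF is_ideal_generated a, of k] that by fastforce
    then show "R (k0 - 1) a" unfolding R_iff using least[of "k0 - 1" a] k0 by auto
  qed
  have "r_inv s I = k0 - 1"
    unfolding r_inv_def R_def[symmetric]
  proof (rule the_equality)
    show "holds_generically ({..<s} \<times> UNIV) (R (k0 - 1))" by (rule R1)
    fix r assume "holds_generically ({..<s} \<times> UNIV) (R r)"
    then obtain a where "R r a" "R (k0 - 1) a"
      using holds_generically_exists[OF holds_generically_conj[OF R1]] by blast
    then have "r \<le> k0 - 1" "k0 - 1 \<le> r" unfolding R_iff by simp_all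
    then show "r = k0 - 1" by simp
  qed
  then have "k0 \<le> d" using d by simp
  then show ?thesis
    by (intro holds_generically_mono[OF gen]) (rule forms_subset_mono[OF is_ideal_generated])
qed

text \<open>First differences become dimensions of a hyperplane section. Degree zero fits the
  convention of \<open>delta_hilbert\<close> because \<open>l\<close> has positive degree and adds
  nothing there.\<close>

lemma delta_hilbert_nonzerodivisor:
  fixes I :: "('v::finite, 'k::field) mpoly set"
  assumes I: "homogeneous_ideal I" and l: "l \<in> forms 1"
    and nzd: "\<And>t f. f \<in> forms t \<Longrightarrow> l * f \<in> I \<Longrightarrow> f \<in> I"
  shows "delta_hilbert I t = int (hilbert_fun (adjoin l I) t)"
proof (cases t)
  case 0
  have "adjoin l I \<inter> forms 0 = I \<inter> forms 0"
  proof
    show "adjoin l I \<inter> forms 0 \<subseteq> I \<inter> forms 0"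
    proof
      fix f assume f: "f \<in> adjoin l I \<inter> forms 0"
      then obtain a b where ab: "a \<in> I" "f = a + l * b" by (auto elim: adjoinE)
      have "f = hcomp 0 f" using IntD2[OF f] by (simp add: hcomp_forms)
      also have "\<dots> = hcomp 0 a" by (simp add: ab(2) hcomp_add hcomp_mult_forms[OF l])
      finally show "f \<in> I \<inter> forms 0" using homogeneous_hcomp[OF I ab(1), of 0] f by simp
    qed
    show "I \<inter> forms 0 \<subseteq> adjoin l I \<inter> forms 0" using subset_adjoin[of I l] by blast
  qed
  from hilbert_fun_cong[OF this] show ?thesis by (simp add: delta_hilbert_def 0)
next
  case (Suc u)
  then show ?thesis
    using hilbert_fun_nonzerodivisor[OF I l nzd, of u] by (simp add: delta_hilbert_def)
qed

lemma nonzerodivisor_forms: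
  assumes I: "homogeneous_ideal I" and l: "l \<in> forms e"
    and nzd: "\<And>t f. f \<in> forms t \<Longrightarrow> l * f \<in> I \<Longrightarrow> f \<in> I"
    and f: "l * f \<in> I"
  shows "f \<in> I"
proof (rule ideal_mem_hcompI[OF homogeneous_is_ideal[OF I]])
  fix t
  have "hcomp (t + e) (l * f) \<in> I" by (rule homogeneous_hcomp[OF I f])
  then have "l * hcomp t f \<in> I" by (simp add: hcomp_mult_forms[OF l])
  then show "hcomp t f \<in> I" by (rule nzd[OF hcomp_in_forms])
qed

lemma hcomp_0_eq: "hcomp 0 f = const_poly (Poly_Mapping.lookup f 0)"
  by (rule poly_mapping_eqI)
    (auto simp: lookup_hcomp const_poly_def lookup_single when_def mon_degree_eq_0_iff)

text \<open>This proper ideal contains all linear forms and, by \<open>Proj_no_constant\<close>,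
  every point; it shows that sections of a nonempty set of points are nonzero in degree
  zero.\<close>

lemma is_ideal_no_constant: "is_ideal {f :: ('v, 'k::comm_ring_1) mpoly. hcomp 0 f = 0}"
  unfolding is_ideal_iff
proof (intro conjI ballI allI)
  fix f :: "('v, 'k) mpoly" and c assume f: "f \<in> {f. hcomp 0 f = 0}"
  obtain N where N: "f = (\<Sum>t\<le>N. hcomp t f)" using exists_sum_hcomp by blast
  have "hcomp 0 (f * c) = (\<Sum>t\<le>N. hcomp 0 (hcomp t f * c))"
    by (subst N) (simp add: sum_distrib_right hcomp_sum)
  also have "\<dots> = 0"
    by (rule sum.neutral) (use f in \<open>auto simp: hcomp_mult_forms[OF hcomp_in_forms]\<close>)
  finally show "c * f \<in> {f. hcomp 0 f = 0}" by (simp add: mult.commute)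
qed (simp_all add: hcomp_add)

lemma Proj_no_constant:
  fixes P :: "('v, 'k::field) mpoly set"
  assumes P: "P \<in> Proj_points" and f: "f \<in> P"
  shows "hcomp 0 f = 0"
proof (rule ccontr)
  assume "hcomp 0 f \<noteq> 0"
  then have "Poly_Mapping.lookup f 0 \<noteq> 0" by (auto simp: hcomp_0_eq)
  moreover have "const_poly (Poly_Mapping.lookup f 0) * 1 \<in> P"
    using homogeneous_hcomp[OF Proj_homogeneous[OF P] f, of 0] by (simp add: hcomp_0_eq)
  ultimately have "1 \<in> P" by (rule ideal_const_cancel[OF Proj_ideal[OF P]])
  then show False using Proj_one_notin[OF P] by simp
qed

lemma linear_form_remove:
  "linear_form c = const_poly (c w) * var_poly w + (\<Sum>v\<in>UNIV - {w}. const_poly (c v) * var_poly v)"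
  unfolding linear_form_def by (rule sum.remove) auto

text \<open>Two general linear forms are brought into echelon shape by scaling and one elimination
  step, which does not change the ideal they generate. The pivot of the first exists because it
  avoids a point, that of the second because of \<open>nonzero\<close>.\<close>

lemma exists_linear_section:
  fixes Z :: "('v::finite, 'k::field_char_0) mpoly set set"
  assumes Z: "finite Z" "Z \<subseteq> closed_points" "Z \<noteq> {}"
    and d: "r_inv 2 (points_ideal Z) < d"
    and nonzero: "\<forall>l\<in>forms 1. (\<forall>p\<in>Z. l \<notin> p) \<longrightarrow> \<not> forms d \<subseteq> adjoin l (points_ideal Z)"
  obtains v1 v2 l \<alpha> x \<beta> where "v1 \<noteq> v2"
    "l = var_poly v1 + (\<Sum>v\<in>UNIV - {v1}. const_poly (\<alpha> v) * var_poly v)"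
    "x = var_poly v2 + (\<Sum>v\<in>UNIV - {v1, v2}. const_poly (\<beta> v) * var_poly v)"
    "\<forall>p\<in>Z. l \<notin> p" "forms d \<subseteq> adjoin x (adjoin l (points_ideal Z))"
proof -
  let ?I = "points_ideal Z"
  have I: "homogeneous_ideal ?I" by (rule homogeneous_points_ideal[OF Z(2)])
  note I' = homogeneous_is_ideal[OF I]
  have avoid: "holds_generically ({..<2} \<times> UNIV) (\<lambda>a. \<forall>p\<in>Z. linear_form (\<lambda>v. a (0::nat, v)) \<notin> p)"
    using Z(1)
  proof (rule holds_generically_ball)
    fix p assume "p \<in> Z"
    then have "p \<in> Proj_points" using Z(2) closed_points_Proj by blast
    then show "holds_generically ({..<2} \<times> UNIV) (\<lambda>a. linear_form (\<lambda>v. a (0::nat, v)) \<notin> p)"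
      by (rule linear_form_avoids_generically) simp
  qed
  have proper: "\<not> forms 0 \<subseteq> section_ideal 2 ?I a" for a
  proof
    assume sub: "forms 0 \<subseteq> section_ideal 2 ?I a"
    obtain p where p: "p \<in> Z" using Z(3) by blast
    then have Pp: "p \<in> Proj_points" using Z(2) closed_points_Proj by blast
    have "?I \<subseteq> {f. hcomp 0 f = 0}"
      using Proj_no_constant[OF Pp] p unfolding points_ideal_def by blast
    moreover have "(\<lambda>i. linear_form (\<lambda>v. a (i, v))) ` {..<2} \<subseteq> {f. hcomp 0 f = 0}"
      using hcomp_forms[OF linear_form_forms, of 0] by auto
    ultimately have "section_ideal 2 ?I a \<subseteq> {f. hcomp 0 f = 0}"
      by (intro ideal_generated_minimal is_ideal_no_constant) blast
    moreover have "(1 :: ('v, 'k) mpoly) \<in> forms 0" by simp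
    ultimately have "hcomp 0 (1 :: ('v, 'k) mpoly) = 0" using sub by blast
    then show False by (simp add: hcomp_forms[OF forms_one])
  qed
  \<comment> \<open>A single form avoiding \<open>Z\<close> already fills some degree, which shows
    that the set of degrees defining \<open>k0\<close> in \<open>r_inv_forms\<close> is
    inhabited.\<close>
  obtain a1 :: "nat \<times> 'v \<Rightarrow> 'k" where a1: "\<forall>p\<in>Z. linear_form (\<lambda>v. a1 (0, v)) \<notin> p"
    using holds_generically_exists[OF avoid] by blast
  obtain N where N: "forms N \<subseteq> adjoin (linear_form (\<lambda>v. a1 (0, v))) ?I"
    by (rule points_forms[OF Z(1,2) linear_form_forms]) (use a1 in auto)
  have "?I \<subseteq> section_ideal 2 ?I a1"
    by (rule subset_trans[OF _ ideal_generated_superset]) simp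
  moreover have "linear_form (\<lambda>v. a1 (0, v)) \<in> section_ideal 2 ?I a1"
    by (intro subsetD[OF ideal_generated_superset] UnI2 rev_image_eqI[of "0::nat"]) simp_all
  ultimately have "adjoin (linear_form (\<lambda>v. a1 (0, v))) ?I \<subseteq> section_ideal 2 ?I a1"
    by (intro adjoin_minimal[OF is_ideal_generated])
  then have "forms N \<subseteq> section_ideal 2 ?I a1" using N by (rule subset_trans[rotated])
  from holds_generically_conj[OF avoid r_inv_forms[OF I proper this d]]
  obtain a where a: "\<And>p. p \<in> Z \<Longrightarrow> linear_form (\<lambda>v. a (0, v)) \<notin> p"
    "forms d \<subseteq> section_ideal 2 ?I a"
    using holds_generically_exists by blast
  have "\<exists>v1. a (0, v1) \<noteq> 0"
  proof (rule ccontr)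
    assume "\<nexists>v1. a (0, v1) \<noteq> 0"
    then have "linear_form (\<lambda>v. a (0, v)) = 0" by (simp add: linear_form_def)
    moreover obtain p where "p \<in> Z" using Z(3) by blast
    ultimately show False using a(1)[of p] ideal_zero[OF Proj_ideal[OF closed_points_Proj]] Z(2) by auto
  qed
  then obtain v1 where v1: "a (0, v1) \<noteq> 0" by blast
  define \<alpha> where "\<alpha> v = a (0, v) / a (0, v1)" for v
  define l where "l = var_poly v1 + (\<Sum>v\<in>UNIV - {v1}. const_poly (\<alpha> v) * var_poly v)"
  have l0: "linear_form (\<lambda>v. a (0, v)) = const_poly (a (0, v1)) * l"
    unfolding linear_form_remove[of _ v1] l_def distrib_left sum_distrib_left
    using v1 by (simp add: \<alpha>_def mult.assoc[symmetric] const_poly_mult[symmetric])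
  have lf: "l \<in> forms 1" unfolding l_def by (intro forms_add forms_sum forms_const_mult forms_var)
  have lZ: "l \<notin> p" if "p \<in> Z" for p
    using a(1)[OF that] l0 ideal_mult_left[OF Proj_ideal[OF closed_points_Proj], of p l] that Z(2) by auto
  \<comment> \<open>Coefficients of the second form after \<open>v1\<close> has been eliminated with
    \<open>l\<close>.\<close>
  define b where "b v = a (1, v) - a (1, v1) * \<alpha> v" for v
  have l1: "linear_form (\<lambda>v. a (1, v)) = const_poly (a (1, v1)) * l +
      (\<Sum>v\<in>UNIV - {v1}. const_poly (b v) * var_poly v)"
  proof -
    have "(\<Sum>v\<in>UNIV - {v1}. const_poly (a (1, v)) * var_poly v) =
        (\<Sum>v\<in>UNIV - {v1}. const_poly (a (1, v1)) * (const_poly (\<alpha> v) * var_poly v)) +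
        (\<Sum>v\<in>UNIV - {v1}. const_poly (b v) * var_poly v)"
      unfolding sum.distrib[symmetric]
      by (rule sum.cong[OF refl])
        (simp add: b_def const_poly_diff const_poly_mult left_diff_distrib mult.assoc)
    then show ?thesis
      unfolding linear_form_remove[of _ v1] l_def distrib_left sum_distrib_left
      by (simp add: add.assoc)
  qed
  have section_sub: "section_ideal 2 ?I a \<subseteq> Q" if "is_ideal Q" "?I \<subseteq> Q"
    "linear_form (\<lambda>v. a (0, v)) \<in> Q" "linear_form (\<lambda>v. a (1, v)) \<in> Q" for Q
  proof (rule ideal_generated_minimal[OF _ that(1)])
    have "linear_form (\<lambda>v. a (i, v)) \<in> Q" if "i < 2" for i
    proof -
      have "i = 0 \<or> i = 1" using that by linarith
      then show ?thesis using \<open>linear_form (\<lambda>v. a (0, v)) \<in> Q\<close> \<open>linear_form (\<lambda>v. a (1, v)) \<in> Q\<close> by auto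
    qed
    then show "?I \<union> (\<lambda>i. linear_form (\<lambda>v. a (i, v))) ` {..<2} \<subseteq> Q" using that(2) by auto
  qed
  have A: "is_ideal (adjoin l ?I)" by (rule is_ideal_adjoin[OF I'])
  have lA: "l \<in> adjoin l ?I" by (rule mem_adjoin_self[OF I'])
  \<comment> \<open>Otherwise the second form is a multiple of \<open>l\<close>, and
    \<open>I + (l)\<close> alone would contain all forms of degree \<open>d\<close>.\<close>
  have "\<exists>v2. v2 \<noteq> v1 \<and> b v2 \<noteq> 0"
  proof (rule ccontr)
    assume b0: "\<nexists>v2. v2 \<noteq> v1 \<and> b v2 \<noteq> 0"
    have "(\<Sum>v\<in>UNIV - {v1}. const_poly (b v) * var_poly v) = (0 :: ('v, 'k) mpoly)"
      by (rule sum.neutral) (use b0 in auto)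
    then have "linear_form (\<lambda>v. a (1, v)) \<in> adjoin l ?I"
      unfolding l1 using ideal_mult_left[OF A lA] by simp
    moreover have "linear_form (\<lambda>v. a (0, v)) \<in> adjoin l ?I"
      unfolding l0 by (rule ideal_mult_left[OF A lA])
    ultimately have "section_ideal 2 ?I a \<subseteq> adjoin l ?I"
      by (intro section_sub A subset_adjoin)
    then show False using a(2) nonzero lf lZ by blast
  qed
  then obtain v2 where v2: "v2 \<noteq> v1" "b v2 \<noteq> 0" by blast
  define \<beta> where "\<beta> v = b v / b v2" for v
  define x where "x = var_poly v2 + (\<Sum>v\<in>UNIV - {v1, v2}. const_poly (\<beta> v) * var_poly v)"
  have bx: "(\<Sum>v\<in>UNIV - {v1}. const_poly (b v) * var_poly v) = const_poly (b v2) * x"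
  proof -
    have "(\<Sum>v\<in>UNIV - {v1}. const_poly (b v) * var_poly v) =
        const_poly (b v2) * var_poly v2 + (\<Sum>v\<in>UNIV - {v1} - {v2}. const_poly (b v) * var_poly v)"
      using v2(1) by (intro sum.remove) auto
    also have "UNIV - {v1} - {v2} = UNIV - {v1, v2}" by auto
    finally show ?thesis
      unfolding x_def distrib_left sum_distrib_left using v2(2)
      by (simp add: \<beta>_def mult.assoc[symmetric] const_poly_mult[symmetric])
  qed
  let ?B = "adjoin x (adjoin l ?I)"
  have B: "is_ideal ?B" by (rule is_ideal_adjoin[OF A])
  have "l \<in> ?B" using lA subset_adjoin by blast
  moreover have "x \<in> ?B" by (rule mem_adjoin_self[OF A])
  ultimately have "linear_form (\<lambda>v. a (0, v)) \<in> ?B" "linear_form (\<lambda>v. a (1, v)) \<in> ?B"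
    unfolding l0 l1 bx by (auto intro: ideal_add[OF B] ideal_mult_left[OF B])
  moreover have "?I \<subseteq> ?B" using subset_adjoin by blast
  ultimately have "section_ideal 2 ?I a \<subseteq> ?B" by (intro section_sub B)
  then have "forms d \<subseteq> ?B" using a(2) by (rule subset_trans[rotated])
  then show ?thesis using that[OF v2(1)[symmetric] l_def x_def] lZ by blast
qed

section \<open>Linear growth of the Hilbert function\<close>

text \<open>Polynomials agreeing at infinitely many integers coincide, which settles uniqueness in
  the description operator.\<close>

lemma hilbert_poly_linear:
  fixes I :: "('v::finite, 'k::field) mpoly set"
  assumes H: "\<And>t. d \<le> t \<Longrightarrow> hilbert_fun I t = c + s * (t - d)"
  shows "hilbert_poly I = [:of_nat c - of_nat s * of_nat d, of_nat s:]"
  unfolding hilbert_poly_def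
proof (rule the_equality)
  let ?p = "[:of_nat c - of_nat s * of_nat d, of_nat s:] :: rat poly"
  have p: "of_nat (hilbert_fun I t) = poly ?p (of_nat t)" if dt: "d \<le> t" for t
  proof -
    obtain u where "t = d + u" using le_Suc_ex[OF dt] by blast
    then show ?thesis by (simp add: H algebra_simps)
  qed
  then show "\<forall>\<^sub>F t in sequentially. of_nat (hilbert_fun I t) = poly ?p (of_nat t)"
    unfolding eventually_sequentially by blast
  fix q :: "rat poly" assume "\<forall>\<^sub>F t in sequentially. of_nat (hilbert_fun I t) = poly q (of_nat t)"
  then obtain N where N: "\<And>t. N \<le> t \<Longrightarrow> of_nat (hilbert_fun I t) = poly q (of_nat t)"
    unfolding eventually_sequentially by blast
  show "q = ?p"
  proof (rule ccontr)
    assume "q \<noteq> ?p"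
    then have fin: "finite {x. poly (q - ?p) x = 0}" by (intro poly_roots_finite) simp
    have "of_nat ` {max N d..} \<subseteq> {x. poly (q - ?p) x = 0}"
    proof
      fix x :: rat assume "x \<in> of_nat ` {max N d..}"
      then obtain t where t: "x = of_nat t" "N \<le> t" "d \<le> t" by auto
      then show "x \<in> {x. poly (q - ?p) x = 0}" using N[OF t(2)] p[OF t(3)] by simp
    qed
    then have "finite (of_nat ` {max N d..} :: rat set)" using fin by (rule finite_subset)
    then have "finite {max N d..}" by (rule finite_imageD) (simp add: inj_on_def)
    then show False using infinite_Ici by blast
  qed
qed

lemma strict_points_form:
  assumes P: "P \<in> Proj_points" and Q: "Q \<in> Proj_points" and PQ: "P \<subset> Q"
  obtains e f where "f \<in> forms e" "f \<in> Q" "f \<notin> P"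
proof -
  obtain g where g: "g \<in> Q" "g \<notin> P" using PQ by blast
  then obtain e where "hcomp e g \<notin> P" using ideal_mem_hcompI[OF Proj_ideal[OF P]] by blast
  then show ?thesis using that[of "hcomp e g" e] homogeneous_hcomp[OF Proj_homogeneous[OF Q] g(1)] by simp
qed

text \<open>Modulo the prime \<open>P\<close> the form \<open>f\<close> is a nonzerodivisor, and
  \<open>R/Q\<close> is a quotient of \<open>R/(P, f)\<close>.\<close>

lemma hilbert_fun_growth:
  fixes P Q :: "('v::finite, 'k::field) mpoly set"
  assumes P: "P \<in> Proj_points" and Q: "Q \<in> Proj_points" and "P \<subseteq> Q"
    and f: "f \<in> forms e" "f \<in> Q" "f \<notin> P"
  shows "hilbert_fun P t + hilbert_fun Q (t + e) \<le> hilbert_fun P (t + e)"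
proof -
  have "hilbert_fun P (t + e) = hilbert_fun P t + hilbert_fun (adjoin f P) (t + e)"
    by (rule hilbert_fun_nonzerodivisor[OF Proj_homogeneous[OF P] f(1)])
      (use prime_mult[OF Proj_prime[OF P]] f(3) in blast)
  moreover have "hilbert_fun Q (t + e) \<le> hilbert_fun (adjoin f P) (t + e)"
    by (intro hilbert_fun_antimono is_ideal_adjoin Proj_ideal[OF P] Proj_ideal[OF Q]
        adjoin_minimal f(2) assms(3))
  ultimately show ?thesis by simp
qed

lemma hilbert_fun_Proj_pos:
  fixes P :: "('v::finite, 'k::field) mpoly set"
  assumes P: "P \<in> Proj_points"
  shows "1 \<le> hilbert_fun P t"
  using hilbert_fun_eq_0_iff[OF Proj_ideal[OF P], of t] Proj_forms_not_subset[OF P, of t] by linarith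

text \<open>Along a chain of three points the Hilbert function is at least one at the top, grows at
  least linearly in the middle and quadratically at the bottom, which exceeds the linear bound from
  \<open>I\<close>.\<close>

lemma no_chain_if_linear_growth:
  fixes I :: "('v::finite, 'k::field) mpoly set"
  assumes I: "is_ideal I" and H: "\<And>t. d \<le> t \<Longrightarrow> hilbert_fun I t = c + s * (t - d)"
  shows "\<not> has_chain (support I) 2"
proof
  assume "has_chain (support I) 2"
  then obtain p where p: "\<And>i. i \<le> 2 \<Longrightarrow> p i \<in> support I" "\<And>i. i < 2 \<Longrightarrow> p i \<subset> p (Suc i)"
    unfolding has_chain_def by blast
  have P: "p 0 \<in> Proj_points" "p 1 \<in> Proj_points" "p 2 \<in> Proj_points" and Ip: "I \<subseteq> p 0"
    using p(1)[of 0] p(1)[of 1] p(1)[of 2] by (auto simp: support_def)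
  have c: "p 0 \<subset> p 1" "p 1 \<subset> p 2" using p(2)[of 0] p(2)[of 1] by (auto simp: numeral_2_eq_2)
  obtain e f where f: "f \<in> forms e" "f \<in> p 1" "f \<notin> p 0" by (rule strict_points_form[OF P(1,2) c(1)])
  obtain e' f' where f': "f' \<in> forms e'" "f' \<in> p 2" "f' \<notin> p 1" by (rule strict_points_form[OF P(2,3) c(2)])
  \<comment> \<open>For \<open>e = 0\<close> the growth inequality would make the positive value at
    the larger point zero.\<close>
  have "e \<noteq> 0"
    using hilbert_fun_growth[OF P(1,2) _ f, of 0] hilbert_fun_Proj_pos[OF P(2), of 0] c by fastforce
  moreover have "e' \<noteq> 0"
    using hilbert_fun_growth[OF P(2,3) _ f', of 0] hilbert_fun_Proj_pos[OF P(3), of 0] c by fastforce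
  ultimately have E0: "e * e' > 0" by simp
  \<comment> \<open>Powers bring both forms to a common degree, so that the two estimates run along
    the same multiples of \<open>E\<close>.\<close>
  define E where "E = e * e'"
  have E: "1 \<le> E" using E0 by (simp add: E_def)
  have g: "f ^ e' \<in> forms E" "f ^ e' \<notin> p 0" "f' ^ e \<in> forms E" "f' ^ e \<notin> p 1"
    using forms_power[OF f(1), of e'] forms_power[OF f'(1), of e]
      prime_power[OF Proj_prime[OF P(1)], of f e'] prime_power[OF Proj_prime[OF P(2)], of f' e] f(3) f'(3)
    by (auto simp: E_def mult.commute)
  have g': "f ^ e' \<in> p 1" "f' ^ e \<in> p 2"
  proof -
    have "f ^ Suc j \<in> p 1" "f' ^ Suc j \<in> p 2" for j
      using ideal_mult_right[OF Proj_ideal[OF P(2)] f(2)] ideal_mult_right[OF Proj_ideal[OF P(3)] f'(2)]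
      by simp_all
    moreover have "e' = Suc (e' - 1)" "e = Suc (e - 1)" using \<open>e \<noteq> 0\<close> \<open>e' \<noteq> 0\<close> by auto
    ultimately show "f ^ e' \<in> p 1" "f' ^ e \<in> p 2" by metis+
  qed
  have H1: "k \<le> hilbert_fun (p 1) (k * E)" for k
  proof (induction k)
    case (Suc k)
    have "hilbert_fun (p 1) (k * E) + hilbert_fun (p 2) (k * E + E) \<le> hilbert_fun (p 1) (k * E + E)"
      by (rule hilbert_fun_growth[OF P(2,3) _ g(3) g'(2) g(4)]) (use c in auto)
    then show ?case using Suc hilbert_fun_Proj_pos[OF P(3), of "k * E + E"] by (simp add: add.commute)
  qed simp
  have H0: "k * (k + 1) \<le> 2 * hilbert_fun (p 0) (k * E)" for k
  proof (induction k)
    case (Suc k)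
    have "hilbert_fun (p 0) (k * E) + hilbert_fun (p 1) (k * E + E) \<le> hilbert_fun (p 0) (k * E + E)"
      by (rule hilbert_fun_growth[OF P(1,2) _ g(1) g'(1) g(2)]) (use c in auto)
    moreover have "Suc k \<le> hilbert_fun (p 1) (k * E + E)" using H1[of "Suc k"] by (simp add: add.commute)
    ultimately show ?case using Suc by (simp add: add.commute)
  qed simp
  \<comment> \<open>Large enough for \<open>d \<le> k * E\<close>, and \<open>k + 1\<close> exceeds
    \<open>2 * s * E\<close> by \<open>2 * c + d + 2\<close>, so that \<open>k * (k + 1)\<close>
    beats \<open>2 * c + k * (2 * s * E)\<close>.\<close>
  define k where "k = 2 * c + 2 * s * E + d + 1"
  have "k * 1 \<le> k * E" using E by (rule mult_le_mono2)
  then have dk: "d \<le> k * E" by (simp add: k_def)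
  have "hilbert_fun (p 0) (k * E) \<le> hilbert_fun I (k * E)"
    by (rule hilbert_fun_antimono[OF I Proj_ideal[OF P(1)] Ip])
  also have "\<dots> = c + s * (k * E - d)" by (rule H[OF dk])
  also have "\<dots> \<le> c + s * (k * E)" by simp
  finally have "k * (k + 1) \<le> 2 * c + k * (2 * s * E)" using H0[of k] by (simp add: mult_ac)
  moreover have "k * (k + 1) = k * (2 * c + d + 2) + k * (2 * s * E)"
    unfolding k_def by (simp add: algebra_simps)
  moreover have "2 * c < k * (2 * c + d + 2)"
  proof -
    have "1 * (2 * c + d + 2) \<le> k * (2 * c + d + 2)" by (rule mult_le_mono1) (simp add: k_def)
    then show ?thesis by simp
  qed
  ultimately show False by linarith
qed

section \<open>The ideal generated in degrees up to \<open>d\<close>\<close>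

text \<open>All genericity is condensed here: \<open>y 0\<close> and \<open>y 1\<close> are the two
  general forms, completed to coordinates by the others. \<open>hd0\<close> and \<open>hd1\<close>
  are the two equal entries of the h-vector read off the hyperplane section, and
  \<open>artinian\<close> is what \<open>d > r_inv 2 I\<close> provides.\<close>

locale points_section =
  fixes Z :: "('v::finite, 'k::field) mpoly set set" and d s n :: nat
    and y :: "nat \<Rightarrow> ('v, 'k) mpoly"
  assumes finite_Z: "finite Z" and closed_Z: "Z \<subseteq> closed_points"
    and uniform: "uniform_position Z"
    and s: "s \<noteq> 0" and d: "1 \<le> d" and n: "2 \<le> n"
    and y: "\<And>i. y i \<in> forms 1"
    and regular: "\<And>k f. k < n \<Longrightarrow> y k * f \<in> adjoin_seq y {0} k \<Longrightarrow> f \<in> adjoin_seq y {0} k"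
    and vars: "\<And>v. var_poly v \<in> adjoin_seq y {0} n"
    and avoid: "\<And>p. p \<in> Z \<Longrightarrow> y 0 \<notin> p"
    and hd0: "hilbert_fun (adjoin (y 0) (points_ideal Z)) d = s"
    and hd1: "hilbert_fun (adjoin (y 0) (points_ideal Z)) (d + 1) = s"
    and artinian: "forms d \<subseteq> adjoin (y 1) (adjoin (y 0) (points_ideal Z))"
begin

abbreviation "I \<equiv> points_ideal Z"
abbreviation "T \<equiv> truncation_ideal d I"
abbreviation "l \<equiv> y 0"
abbreviation "x \<equiv> y 1"

lemma I_hom: "homogeneous_ideal I" and I_ideal: "is_ideal I"
  using homogeneous_points_ideal[OF closed_Z] by (simp_all add: homogeneous_is_ideal)

lemma T_hom: "homogeneous_ideal T" and T_ideal: "is_ideal T"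
  using homogeneous_truncation[OF I_hom] by (simp_all add: homogeneous_is_ideal)

lemma T_subset: "T \<subseteq> I"
  by (rule truncation_subset[OF I_ideal])

lemma T_forms: "t \<le> d \<Longrightarrow> f \<in> forms t \<Longrightarrow> f \<in> T \<longleftrightarrow> f \<in> I"
  using truncation_forms[OF I_hom, of t d] by blast

lemma lT_hom: "homogeneous_ideal (adjoin l T)" and lT_ideal: "is_ideal (adjoin l T)"
  using homogeneous_adjoin[OF T_hom y] by (simp_all add: homogeneous_is_ideal)

lemma lI_hom: "homogeneous_ideal (adjoin l I)" and lI_ideal: "is_ideal (adjoin l I)"
  using homogeneous_adjoin[OF I_hom y] by (simp_all add: homogeneous_is_ideal)

lemma lT_forms:
  assumes "t \<le> d"
  shows "adjoin l T \<inter> forms t = adjoin l I \<inter> forms t"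
proof
  show "adjoin l T \<inter> forms t \<subseteq> adjoin l I \<inter> forms t" using adjoin_mono[OF T_subset] by blast
  show "adjoin l I \<inter> forms t \<subseteq> adjoin l T \<inter> forms t"
  proof
    fix f assume f: "f \<in> adjoin l I \<inter> forms t"
    obtain a b where "a \<in> I" "a \<in> forms t" "f = a + l * b"
      by (rule adjoin_forms_repE[OF I_hom y IntD1[OF f] IntD2[OF f]])
    then show "f \<in> adjoin l T \<inter> forms t" using f T_forms[OF assms] by (auto intro: adjoinI)
  qed
qed

lemma l_nzd_I: "l * f \<in> I \<Longrightarrow> f \<in> I"
  by (rule points_nonzerodivisor[OF closed_Z avoid])

sublocale koszul y n d T
proof
  show "\<exists>g. (\<forall>i. g i \<in> T \<inter> forms t) \<and> f = (\<Sum>i<n. y i * g i)"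
    if "d \<le> t" "f \<in> T" "f \<in> forms (Suc t)" for t f
    by (rule truncation_generated[OF I_hom y vars that])
qed (fact T_hom y regular)+

lemma J_1: "adjoin_seq y T 1 = adjoin l T" and J_2: "adjoin_seq y T 2 = adjoin x (adjoin l T)"
  by (simp_all add: numeral_2_eq_2)

text \<open>The product has degree \<open>d + 1\<close>, where only \<open>T \<subseteq> I\<close>
  is available; that suffices because \<open>f\<close> has degree \<open>d\<close>, where both
  ideals agree.\<close>

lemma inj0: "inj_at 0 d"
  unfolding inj_at_def
proof (intro ballI impI)
  fix f assume f: "f \<in> forms d" "l * f \<in> adjoin_seq y T 0"
  then have "f \<in> I" using l_nzd_I T_subset by auto
  then show "f \<in> adjoin_seq y T 0" using T_forms[OF order_refl f(1)] by simp
qed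

text \<open>Multiplication by the second linear form is onto from degree \<open>d\<close> to \<open>d + 1\<close>, and the two
  dimensions are equal.\<close>

lemma inj1: "inj_at 1 d"
  unfolding inj_at_def J_1
proof (intro ballI impI)
  fix f assume f: "f \<in> forms d" "x * f \<in> adjoin l T"
  have "forms (d + 1) \<subseteq> adjoin x (adjoin l I)"
    using forms_subset_mono[OF is_ideal_adjoin[OF lI_ideal] artinian] by simp
  then have "hilbert_fun (adjoin x (adjoin l I)) (d + 1) = 0"
    using hilbert_fun_eq_0_iff[OF is_ideal_adjoin[OF lI_ideal]] by blast
  then have eq: "hilbert_fun (adjoin l I) d = hilbert_fun (colon (adjoin l I) x) d"
    using hilbert_fun_colon[OF lI_hom y, of d 1] hd0 hd1 by simp
  have "x * f \<in> adjoin l I" using f(2) adjoin_mono[OF T_subset] by blast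
  then have "f \<in> colon (adjoin l I) x" by (simp add: colon_def)
  then have "f \<in> adjoin l I"
    using hilbert_fun_eq_imp_subset[OF lI_ideal is_ideal_colon[OF lI_ideal] subset_colon[OF lI_ideal] eq] f(1)
    by blast
  then show "f \<in> adjoin l T" using lT_forms[OF order_refl] f(1) by blast
qed

lemma artinian_T: "d \<le> u \<Longrightarrow> forms u \<subseteq> adjoin x (adjoin l T)"
proof -
  have "forms d \<subseteq> adjoin x (adjoin l T)"
  proof
    fix f :: "('v, 'k) mpoly" assume f: "f \<in> forms d"
    obtain a b where ab: "a \<in> adjoin l I" "a \<in> forms d" "f = a + x * b"
      by (rule adjoin_forms_repE[OF lI_hom y _ f]) (use artinian f in auto)
    then have "a \<in> adjoin l T" using lT_forms[OF order_refl] by blast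
    then show "f \<in> adjoin x (adjoin l T)" unfolding ab(3) by (rule adjoinI)
  qed
  then show "d \<le> u \<Longrightarrow> forms u \<subseteq> adjoin x (adjoin l T)"
    by (rule forms_subset_mono[OF is_ideal_adjoin[OF lT_ideal]])
qed

text \<open>The Koszul criterion covers degrees from \<open>d\<close> on; below, membership in
  \<open>T\<close> and in \<open>I\<close> is the same, and \<open>l\<close> lies in no point of
  \<open>Z\<close>.\<close>

lemma l_nzd_forms:
  assumes f: "f \<in> forms t" "l * f \<in> T"
  shows "f \<in> T"
proof (cases "d \<le> t")
  case True
  have "inj_at 0 t" by (rule inj_all(1)[OF n inj0 inj1 _ True]) (unfold J_2, rule artinian_T)
  then show ?thesis using f by (simp add: inj_at_def)
next
  case False
  then have "f \<in> I" using f(2) T_subset l_nzd_I by blast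
  then show ?thesis using T_forms[of t f] f(1) False by simp
qed

lemma l_nzd: "l * f \<in> T \<Longrightarrow> f \<in> T"
  by (rule nonzerodivisor_forms[OF T_hom y l_nzd_forms])

lemma x_nzd:
  assumes "d \<le> t" "f \<in> forms t" "x * f \<in> adjoin l T"
  shows "f \<in> adjoin l T"
proof -
  have "inj_at 1 t" by (rule inj_all(2)[OF n inj0 inj1 _ assms(1)]) (unfold J_2, rule artinian_T)
  then show ?thesis using assms by (simp add: inj_at_def)
qed

lemma x_power_nzd:
  assumes "d \<le> t" "f \<in> forms t" "x ^ k * f \<in> adjoin l T"
  shows "f \<in> adjoin l T"
  using assms(3)
proof (induction k)
  case (Suc k)
  have "x ^ k * f \<in> forms (k + t)" by (intro forms_mult forms_power_1 y assms)
  then have "x ^ k * f \<in> adjoin l T"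
    using x_nzd[of "k + t" "x ^ k * f"] Suc(2) assms(1) by (simp add: mult.assoc)
  then show ?case by (rule Suc(1))
qed simp

text \<open>From degree \<open>d\<close> on, multiplication by \<open>x\<close> is bijective between
  consecutive degrees of \<open>R/(T + (l))\<close>: injective by \<open>x_nzd\<close>, onto by
  \<open>artinian_T\<close>.\<close>

lemma hilbert_lT: "d \<le> t \<Longrightarrow> hilbert_fun (adjoin l T) t = s"
proof (induction t rule: dec_induct)
  case base
  then show ?case using hilbert_fun_cong[OF lT_forms[OF order_refl]] hd0 by simp
next
  case (step t)
  have "hilbert_fun (adjoin l T) (t + 1) =
      hilbert_fun (adjoin l T) t + hilbert_fun (adjoin x (adjoin l T)) (t + 1)"
    by (rule hilbert_fun_nonzerodivisor[OF lT_hom y x_nzd[OF step(1)]])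
  moreover have "hilbert_fun (adjoin x (adjoin l T)) (t + 1) = 0"
    using hilbert_fun_eq_0_iff[OF is_ideal_adjoin[OF lT_ideal]] artinian_T[of "t + 1"] step(1) by simp
  ultimately show ?case using step by simp
qed

lemma delta_T: "delta_hilbert T t = int (hilbert_fun (adjoin l T) t)"
  by (rule delta_hilbert_nonzerodivisor[OF T_hom y l_nzd])

lemma delta_I: "delta_hilbert I t = int (hilbert_fun (adjoin l I) t)"
  by (rule delta_hilbert_nonzerodivisor[OF I_hom y l_nzd_I])

lemma delta_eq: "t \<le> d + 1 \<Longrightarrow> delta_hilbert T t = delta_hilbert I t"
proof (cases "t \<le> d")
  case True
  from hilbert_fun_cong[OF lT_forms[OF this]] show ?thesis by (simp add: delta_T delta_I)
next
  case False
  assume "t \<le> d + 1"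
  then have "t = d + 1" using False by simp
  then show ?thesis using hilbert_lT[of t] hd1 by (simp add: delta_T delta_I)
qed

lemma hilbert_T:
  assumes "d \<le> t"
  shows "hilbert_fun T t = hilbert_fun T d + s * (t - d)"
proof -
  have "hilbert_fun T (d + u) = hilbert_fun T d + s * u" for u
  proof (induction u)
    case (Suc u)
    have "int (hilbert_fun T (Suc (d + u))) - int (hilbert_fun T (d + u)) = int s"
      using delta_T[of "Suc (d + u)"] hilbert_lT[of "Suc (d + u)"] by (simp add: delta_hilbert_def)
    then have "hilbert_fun T (Suc (d + u)) = hilbert_fun T (d + u) + s" by linarith
    then show ?case using Suc by simp
  qed simp
  from this[of "t - d"] show ?thesis using assms by simp
qed

text \<open>Since \<open>s \<noteq> 0\<close>, the Hilbert polynomial has degree exactly one, so the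
  factorial is one and \<open>s\<close> is its leading coefficient.\<close>

lemma degree_T: "scheme_degree T = of_nat s"
  using hilbert_poly_linear[OF hilbert_T] s by (simp add: scheme_degree_def)

lemma irrelevant_avoids: "l \<notin> P \<Longrightarrow> is_ideal P \<Longrightarrow> \<exists>v. var_poly v \<notin> P"
proof (rule ccontr)
  assume P: "l \<notin> P" "is_ideal P" "\<nexists>v. var_poly v \<notin> P"
  have "l \<in> forms (Suc 0)" using y[of 0] by simp
  then obtain g where "l = (\<Sum>v\<in>UNIV. var_poly v * g v)" by (rule forms_Suc_decompose)
  moreover have "(\<Sum>v\<in>UNIV. var_poly v * g v) \<in> P"
    using P(3) by (intro ideal_sum[OF P(2)] ideal_mult_right[OF P(2)]) simp
  ultimately show False using P(1) by simp
qed

lemma l_irrelevant: "l \<in> irrelevant_ideal"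
proof (rule ccontr)
  have ideal: "is_ideal (irrelevant_ideal :: ('v, 'k) mpoly set)"
    by (simp add: irrelevant_ideal_def is_ideal_generated)
  assume "l \<notin> irrelevant_ideal"
  from irrelevant_avoids[OF this ideal] irrelevant_subset_iff[OF ideal] show False by blast
qed

lemma closed_T: "closed_subscheme T"
  unfolding closed_subscheme_def saturated_def
proof (intro conjI allI impI)
  show "homogeneous_ideal T" by (rule T_hom)
  fix f assume "\<forall>g\<in>irrelevant_ideal. f * g \<in> T"
  then have "l * f \<in> T" using l_irrelevant by (auto simp: mult.commute)
  then show "f \<in> T" by (rule l_nzd)
qed

text \<open>A power of \<open>x\<close> in the ideal would annihilate the section, whereas powers of
  \<open>x\<close> act injectively from degree \<open>d\<close> on; degree \<open>d\<close> would
  vanish although its dimension is \<open>s\<close>.\<close>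

lemma x_power_notin: "x ^ k \<notin> adjoin l T"
proof
  assume k: "x ^ k \<in> adjoin l T"
  have "forms d \<subseteq> adjoin l T"
  proof
    fix f :: "('v, 'k) mpoly" assume f: "f \<in> forms d"
    have "x ^ k * f \<in> adjoin l T" by (rule ideal_mult_right[OF lT_ideal k])
    then show "f \<in> adjoin l T" by (rule x_power_nzd[OF order_refl f])
  qed
  then show False using hilbert_fun_eq_0_iff[OF lT_ideal, of d] hilbert_lT[OF order_refl] s by simp
qed

lemma l_power_nzd: "l ^ k * f \<in> T \<Longrightarrow> f \<in> T"
  by (induction k) (auto simp: mult.assoc dest: l_nzd)

text \<open>A prime \<open>P\<close> over \<open>T\<close> avoiding the multiplicative set
  \<open>M\<close> omits \<open>l\<close>, and \<open>(P, l)\<close> contains no power of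
  \<open>x\<close>. If such a \<open>P\<close> were closed, \<open>(P, l)\<close> would contain all
  forms of some degree. Hence a further point lies strictly above \<open>P\<close>.\<close>

lemma exists_chain: "has_chain (support T) 1"
proof -
  define M where "M = {l ^ a * (x ^ k + l * b) | a k b. True}"
  have MI: "l ^ a * (x ^ k + l * b) \<in> M" for a k b by (auto simp: M_def)
  obtain P where P: "prime_ideal P" "homogeneous_ideal P" "T \<subseteq> P" "P \<inter> M = {}"
  proof (rule exists_prime_avoiding[OF T_hom])
    show "1 \<in> M" using MI[of 0 0 0] by simp
    fix f g assume "f \<in> M" "g \<in> M"
    then obtain a k b a' k' b' where fg: "f = l ^ a * (x ^ k + l * b)" "g = l ^ a' * (x ^ k' + l * b')"
      by (auto simp: M_def)
    have "f * g = l ^ (a + a') * (x ^ (k + k') + l * (x ^ k * b' + b * x ^ k' + l * b * b'))"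
      by (simp add: fg power_add algebra_simps)
    then show "f * g \<in> M" by (simp only: MI)
  next
    show "T \<inter> M = {}"
    proof (rule ccontr)
      assume "T \<inter> M \<noteq> {}"
      then obtain a k b where "l ^ a * (x ^ k + l * b) \<in> T" by (auto simp: M_def)
      then have *: "x ^ k + l * b \<in> T" by (rule l_power_nzd)
      have "x ^ k = (x ^ k + l * b) + l * (- b)" by simp
      also have "\<dots> \<in> adjoin l T" using * by (rule adjoinI)
      finally show False using x_power_notin by blast
    qed
  qed
  have lP: "l \<notin> P" using MI[of 1 0 0] P(4) by auto
  have PP: "P \<in> Proj_points"
    unfolding Proj_points_iff using P(1,2) irrelevant_avoids[OF lP prime_is_ideal[OF P(1)]] by blast
  have "P \<notin> closed_points"
  proof
    assume "P \<in> closed_points"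
    then obtain N where N: "forms N \<subseteq> adjoin l P" by (rule closed_point_forms[OF _ y lP])
    have "x ^ N \<in> forms N" by (rule forms_power_1[OF y])
    then obtain p b where pb: "p \<in> P" "x ^ N = p + l * b" using N by (blast elim: adjoinE)
    then have "p = l ^ 0 * (x ^ N + l * (- b))" by simp
    then have "p \<in> M" using MI[of 0 N "- b"] by simp
    then show False using pb(1) P(4) by blast
  qed
  then obtain Q where Q: "Q \<in> Proj_points" "P \<subseteq> Q" "Q \<noteq> P" using PP by (auto simp: closed_points_def)
  have "\<forall>i\<le>1. (if i = (0::nat) then P else Q) \<in> support T"
    using PP Q P(3) by (auto simp: support_def)
  moreover have "\<forall>i<1. (if i = (0::nat) then P else Q) \<subset> (if Suc i = 0 then P else Q)"
    using Q by auto
  ultimately show ?thesis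
    unfolding has_chain_def by (intro exI[of _ "\<lambda>i. if i = 0 then P else Q"] conjI)
qed

lemma dimension_T: "has_dimension T 1"
  using exists_chain no_chain_if_linear_growth[OF T_ideal hilbert_T]
  by (simp add: has_dimension_def numeral_2_eq_2)

section \<open>The colon ideal \<open>T : P\<close> and associated closed points\<close>

definition residual :: "('v, 'k) mpoly set \<Rightarrow> ('v, 'k) mpoly set" where
  "residual P = {h. \<forall>g\<in>P. g * h \<in> T}"

lemma is_ideal_residual: "is_ideal (residual P)"
  unfolding is_ideal_iff residual_def
  using T_ideal by (auto simp: distrib_left ideal_zero ideal_add mult.left_commute ideal_mult_left)

lemma residual_homogeneous:
  assumes P: "homogeneous_ideal P"
  shows "homogeneous_ideal (residual P)"
  unfolding homogeneous_ideal_iff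
proof (intro conjI ballI allI is_ideal_residual)
  fix h t assume h: "h \<in> residual P"
  have "hcomp i g * hcomp t h \<in> T" if "g \<in> P" for i g
  proof -
    have "hcomp i g * h \<in> T" using h homogeneous_hcomp[OF P that] by (auto simp: residual_def)
    then have "hcomp (i + t) (hcomp i g * h) \<in> T" by (rule homogeneous_hcomp[OF T_hom])
    then show ?thesis by (simp add: hcomp_mult_forms[OF hcomp_in_forms])
  qed
  then have "g * hcomp t h \<in> T" if g: "g \<in> P" for g
  proof -
    obtain N where N: "g = (\<Sum>i\<le>N. hcomp i g)" using exists_sum_hcomp by blast
    have "(\<Sum>i\<le>N. hcomp i g * hcomp t h) \<in> T"
      using \<open>\<And>i g. g \<in> P \<Longrightarrow> hcomp i g * hcomp t h \<in> T\<close>[OF g] by (intro ideal_sum[OF T_ideal])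
    then show ?thesis by (subst N) (simp add: sum_distrib_right)
  qed
  then show "hcomp t h \<in> residual P" by (simp add: residual_def)
qed

text \<open>Outside \<open>l\<close> the closed point gives \<open>x ^ N = p + l * b\<close> with
  \<open>p\<close> in \<open>P\<close>. As \<open>p * h\<close> lies in \<open>T\<close>, the power
  of \<open>x\<close> maps \<open>h\<close> into \<open>T + (l)\<close>, and from degree
  \<open>d\<close> on it can be cancelled. The quotient \<open>h'\<close> remains in
  \<open>T : P\<close> because \<open>l\<close> is a nonzerodivisor modulo \<open>T\<close>.\<close>

lemma residual_reduce:
  assumes P: "P \<in> closed_points" and lP: "l \<notin> P"
    and h: "h \<in> residual P" "h \<in> forms t" and t: "d \<le> t"
  obtains i h' where "i \<in> T" "h' \<in> residual P" "h' \<in> forms (t - 1)" "h = i + l * h'"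
proof -
  obtain N where N: "forms N \<subseteq> adjoin l P" by (rule closed_point_forms[OF P y lP])
  have "x ^ N \<in> forms N" by (rule forms_power_1[OF y])
  then obtain p b where pb: "p \<in> P" "x ^ N = p + l * b" using N by (blast elim: adjoinE)
  have "x ^ N * h = p * h + l * (b * h)" by (simp only: pb(2) distrib_right mult.assoc)
  also have "\<dots> \<in> adjoin l T" using h(1) pb(1) by (intro adjoinI) (simp add: residual_def)
  finally have "h \<in> adjoin l T" by (rule x_power_nzd[OF t h(2)])
  moreover have "h \<in> forms (t - 1 + 1)" using h(2) t d by simp
  ultimately obtain i h' where i: "i \<in> T" "h' \<in> forms (t - 1)" "h = i + l * h'"
    using adjoin_formsE[OF T_hom y] by blast
  have "g * h' \<in> T" if g: "g \<in> P" for g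
  proof (rule l_nzd)
    have "l * (g * h') = g * h - g * i" by (simp add: i(3) algebra_simps)
    also have "\<dots> \<in> T"
    proof (rule ideal_diff[OF T_ideal])
      show "g * h \<in> T" using h(1) g by (simp add: residual_def)
      show "g * i \<in> T" by (rule ideal_mult_left[OF T_ideal i(1)])
    qed
    finally show "l * (g * h') \<in> T" .
  qed
  then have "h' \<in> residual P" by (simp add: residual_def)
  then show ?thesis using that i by blast
qed

text \<open>A zero-dimensional component lying outside the curve part is a point of \<open>Z\<close> with a
  separator of small degree; by uniform position every point of \<open>Z\<close> then behaves like this one,
  and the points impose independent conditions too early for \<open>s\<close> to be nonzero.\<close>

lemma no_closed_associated: "associated_primes T \<inter> closed_points = {}"
proof (rule ccontr)
  assume "associated_primes T \<inter> closed_points \<noteq> {}"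
  then obtain P f where P: "P \<in> closed_points" and f: "P = {g. g * f \<in> T}"
    by (auto simp: associated_primes_def)
  note PP = closed_points_Proj[OF P]
  note P_ideal = Proj_ideal[OF PP]
  have res_hom: "homogeneous_ideal (residual P)" by (rule residual_homogeneous[OF Proj_homogeneous[OF PP]])
  note res_ideal = is_ideal_residual[of P]
  have f_res: "f \<in> residual P" using f by (auto simp: residual_def)
  have "f \<notin> T" using Proj_one_notin[OF PP] f by auto
  then obtain e0 where e0: "hcomp e0 f \<notin> T" using ideal_mem_hcompI[OF T_ideal] by blast
  have lP: "l \<notin> P"
  proof
    assume "l \<in> P"
    then have "l * f \<in> T" using f by auto
    then show False using l_nzd \<open>f \<notin> T\<close> by blast
  qed
  \<comment> \<open>Division by \<open>l\<close> lowers the degree while it is at least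
    \<open>d\<close> and never leads into \<open>T\<close>, as \<open>h = i + l * h'\<close> would
    then lie in \<open>T\<close>.\<close>
  have "\<exists>e<d. \<exists>h\<in>residual P. h \<in> forms e \<and> h \<notin> T"
    if "h \<in> residual P" "h \<in> forms e" "h \<notin> T" for e h
    using that
  proof (induction e arbitrary: h rule: less_induct)
    case (less e)
    show ?case
    proof (cases "e < d")
      case True
      then show ?thesis using less(2-4) by blast
    next
      case False
      then have de: "d \<le> e" by simp
      obtain i h' where i: "i \<in> T" "h' \<in> residual P" "h' \<in> forms (e - 1)" "h = i + l * h'"
        by (rule residual_reduce[OF P lP less(2,3) de])
      have "h' \<notin> T" using less(4) i ideal_add[OF T_ideal i(1) ideal_mult_left[OF T_ideal]] by auto
      then show ?thesis using less(1)[of "e - 1" h'] i(2,3) de d by simp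
    qed
  qed
  from this[OF homogeneous_hcomp[OF res_hom f_res] hcomp_in_forms e0]
  obtain e h where h: "e < d" "h \<in> residual P" "h \<in> forms e" "h \<notin> T" by blast
  \<comment> \<open>Below degree \<open>d\<close> the ideals \<open>T\<close> and \<open>I\<close>
    agree, so some \<open>q\<close> in \<open>Z\<close> misses \<open>h\<close>; as \<open>P\<close>
    multiplies \<open>h\<close> into \<open>I\<close>, it is contained in \<open>q\<close>.\<close>
  have "h \<notin> I" using T_forms[of e h] h by simp
  then obtain q where q: "q \<in> Z" "h \<notin> q" by (auto simp: points_ideal_def)
  have qP: "q \<in> Proj_points" using q(1) closed_Z closed_points_Proj by blast
  have "P \<subseteq> q"
  proof
    fix g assume "g \<in> P"
    then have "g * h \<in> I" using h(2) T_subset by (auto simp: residual_def)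
    then have "g * h \<in> q" using q(1) by (auto simp: points_ideal_def)
    then show "g \<in> q" using prime_mult[OF Proj_prime[OF qP]] q(2) by blast
  qed
  then have "q = P" by (rule closed_points_eqI[OF P qP])
  then have PZ: "P \<in> Z" and hP: "h \<notin> P" using q by auto
  have others_hom: "homogeneous_ideal (points_ideal (Z - {q}))" for q
    by (rule homogeneous_points_ideal) (use closed_Z in blast)
  \<comment> \<open>Any other point of \<open>Z\<close> fails to contain \<open>P\<close>, hence
    contains all of \<open>T : P\<close>: elements of the latter vanish away from
    \<open>P\<close>.\<close>
  have res_sub: "residual P \<subseteq> points_ideal (Z - {P})"
  proof
    fix g assume g: "g \<in> residual P"
    have "g \<in> r" if r: "r \<in> Z - {P}" for r
    proof -
      have rP: "r \<in> Proj_points" using r closed_Z closed_points_Proj by blast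
      have "\<not> P \<subseteq> r" using closed_points_eqI[OF P rP] r by blast
      then obtain a where a: "a \<in> P" "a \<notin> r" by blast
      have "a * g \<in> I" using g a(1) T_subset by (auto simp: residual_def)
      then have "a * g \<in> r" using r by (auto simp: points_ideal_def)
      then show ?thesis using prime_mult[OF Proj_prime[OF rP]] a(2) by blast
    qed
    then show "g \<in> points_ideal (Z - {P})" by (auto simp: points_ideal_def)
  qed
  let ?S = "ideal_plus (residual P) P"
  have S: "is_ideal ?S" by (rule is_ideal_plus[OF res_ideal P_ideal])
  obtain N where N: "forms N \<subseteq> adjoin h P" by (rule closed_point_forms[OF P h(3) hP])
  have "adjoin h P \<subseteq> ?S"
    using h(2) ideal_plus_upper[OF res_ideal P_ideal] by (intro adjoin_minimal[OF S]) auto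
  with N have "forms N \<subseteq> ?S" by blast
  then have NS: "forms (max N (d - 1)) \<subseteq> ?S" by (rule forms_subset_mono[OF S]) simp
  \<comment> \<open>For \<open>g\<close> of degree \<open>t\<close>, decompose \<open>l * g\<close>
    and divide its part in \<open>T : P\<close> by \<open>l\<close>. This requires
    \<open>d \<le> Suc t\<close>, so the descent ends exactly at \<open>d - 1\<close>.\<close>
  have descend: "forms (d - 1) \<subseteq> ?S" if "d - 1 \<le> t" "forms t \<subseteq> ?S" for t
    using that
  proof (induction t rule: dec_induct)
    case (step t)
    have "forms t \<subseteq> ?S"
    proof
      fix g :: "('v, 'k) mpoly" assume g: "g \<in> forms t"
      have lg: "l * g \<in> forms (Suc t)" using forms_mult[OF y g] by simp
      then have "l * g \<in> ?S" using step(4) by blast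
      then obtain a b where ab: "a \<in> residual P" "a \<in> forms (Suc t)" "b \<in> P" "l * g = a + b"
        using ideal_plus_formsE[OF res_hom Proj_homogeneous[OF PP] _ lg] by blast
      have "d \<le> Suc t" using step(1) by simp
      then obtain i a' where a': "i \<in> T" "a' \<in> residual P" "a = i + l * a'"
        using residual_reduce[OF P lP ab(1,2)] by blast
      have "l * (g - a') = i + b" using ab(4) a'(3) by (simp add: algebra_simps)
      also have "\<dots> \<in> P"
        using a'(1) ab(3) T_subset PZ by (intro ideal_add[OF P_ideal]) (auto simp: points_ideal_def)
      finally have "g - a' \<in> P" using prime_mult[OF Proj_prime[OF PP]] lP by blast
      then have "a' + (g - a') \<in> ?S" using a'(2) unfolding ideal_plus_def by blast
      then show "g \<in> ?S" by simp
    qed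
    then show ?case by (rule step(3))
  qed simp
  have S1: "forms (d - 1) \<subseteq> ?S" by (rule descend[OF _ NS]) simp
  \<comment> \<open>One more division: modulo \<open>P\<close>, a form of degree \<open>d\<close>
    equals an element of \<open>T : P\<close>, which is a multiple of \<open>l\<close> modulo
    \<open>T \<subseteq> P\<close>.\<close>
  have Pd: "forms d \<subseteq> adjoin l P"
  proof
    fix g :: "('v, 'k) mpoly" assume g: "g \<in> forms d"
    then have "g \<in> ?S" using forms_subset_mono[OF S S1, of d] by auto
    then obtain a b where ab: "a \<in> residual P" "a \<in> forms d" "b \<in> P" "g = a + b"
      using ideal_plus_formsE[OF res_hom Proj_homogeneous[OF PP] _ g] by blast
    obtain i a' where a': "i \<in> T" "a' \<in> residual P" "a = i + l * a'"
      using residual_reduce[OF P lP ab(1,2) order_refl] by blast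
    have "i + b \<in> P"
      using a'(1) ab(3) T_subset PZ by (intro ideal_add[OF P_ideal]) (auto simp: points_ideal_def)
    then have "(i + b) + l * a' \<in> adjoin l P" by (rule adjoinI)
    then show "g \<in> adjoin l P" by (simp add: ab(4) a'(3) algebra_simps)
  qed
  \<comment> \<open>This and \<open>modular_eq\<close> express the two containments found at
    \<open>P\<close> through the Hilbert functions of \<open>q\<close>, \<open>Z - {q}\<close> and
    \<open>Z\<close> alone. These are the data that uniform position carries from \<open>P\<close>
    to any other point.\<close>
  have section_eq: "hilbert_fun q d = hilbert_fun q (d - 1) + hilbert_fun (adjoin l q) d" if "q \<in> Z" for q
  proof -
    have qP: "q \<in> Proj_points" using that closed_Z closed_points_Proj by blast
    have "hilbert_fun q (d - 1 + 1) = hilbert_fun q (d - 1) + hilbert_fun (adjoin l q) (d - 1 + 1)"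
      by (rule hilbert_fun_nonzerodivisor[OF Proj_homogeneous[OF qP] y])
        (use prime_mult[OF Proj_prime[OF qP]] avoid[OF that] in blast)
    then show ?thesis using d by simp
  qed
  have modular_eq: "hilbert_fun I (d - 1) + hilbert_fun (ideal_plus (points_ideal (Z - {q})) q) (d - 1) =
      hilbert_fun (points_ideal (Z - {q})) (d - 1) + hilbert_fun q (d - 1)" if "q \<in> Z" for q
  proof -
    have qP: "q \<in> Proj_points" using that closed_Z closed_points_Proj by blast
    have "points_ideal (Z - {q}) \<inter> q = I" using that by (auto simp: points_ideal_def)
    then show ?thesis using hilbert_fun_modular[OF others_hom Proj_homogeneous[OF qP], of q "d - 1"] by simp
  qed
  have PZ0: "hilbert_fun (ideal_plus (points_ideal (Z - {P})) P) (d - 1) = 0"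
  proof -
    have "forms (d - 1) \<subseteq> ideal_plus (points_ideal (Z - {P})) P"
      using S1 ideal_plus_mono[OF res_sub order_refl] by (rule subset_trans)
    then show ?thesis
      using hilbert_fun_eq_0_iff[OF is_ideal_plus[OF homogeneous_is_ideal[OF others_hom] P_ideal]] by blast
  qed
  have P0: "hilbert_fun (adjoin l P) d = 0"
    using Pd hilbert_fun_eq_0_iff[OF is_ideal_adjoin[OF P_ideal]] by blast
  \<comment> \<open>Interpolation at one point: modulo \<open>q\<close>, the form \<open>g\<close>
    is \<open>l * b\<close> with \<open>b\<close> of degree \<open>d - 1\<close>, and
    \<open>b\<close> may be replaced by a \<open>c\<close> vanishing at all other points.\<close>
  have key: "\<exists>a. a \<in> points_ideal (Z - {q}) \<and> g - l * a \<in> q"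
    if q: "q \<in> Z" and g: "g \<in> forms d" for q g
  proof -
    have qP: "q \<in> Proj_points" using q closed_Z closed_points_Proj by blast
    have upp: "hilbert_fun (points_ideal A) = hilbert_fun (points_ideal B)"
      if "A \<subseteq> Z" "B \<subseteq> Z" "card A = card B" for A B
      using uniform that unfolding uniform_position_def by blast
    have 1: "hilbert_fun q = hilbert_fun P"
      using upp[of "{q}" "{P}"] q PZ by (simp add: points_ideal_def)
    have "card (Z - {q}) = card (Z - {P})" using q PZ finite_Z by simp
    then have 2: "hilbert_fun (points_ideal (Z - {q})) = hilbert_fun (points_ideal (Z - {P}))"
      by (intro upp) auto
    have "hilbert_fun (adjoin l q) d = 0" using section_eq[OF q] section_eq[OF PZ] P0 1 by simp
    then have "forms d \<subseteq> adjoin l q" using hilbert_fun_eq_0_iff[OF is_ideal_adjoin[OF Proj_ideal[OF qP]]] by blast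
    moreover have "g \<in> forms (d - 1 + 1)" using g d by simp
    ultimately obtain a b where ab: "a \<in> q" "b \<in> forms (d - 1)" "g = a + l * b"
      using adjoin_formsE[OF Proj_homogeneous[OF qP] y, of g 0 "d - 1"] g by blast
    have "hilbert_fun (ideal_plus (points_ideal (Z - {q})) q) (d - 1) = 0"
      using modular_eq[OF q] modular_eq[OF PZ] PZ0 1 2 by simp
    then have "forms (d - 1) \<subseteq> ideal_plus (points_ideal (Z - {q})) q"
      using hilbert_fun_eq_0_iff[OF is_ideal_plus[OF homogeneous_is_ideal[OF others_hom] Proj_ideal[OF qP]]] by blast
    then obtain c c' where c: "c \<in> points_ideal (Z - {q})" "c' \<in> q" "b = c + c'"
      using ab(2) unfolding ideal_plus_def by blast
    have "g - l * c = a + l * c'" by (simp add: ab(3) c(3) algebra_simps)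
    also have "\<dots> \<in> q" using ab(1) c(2) by (intro ideal_add ideal_mult_left Proj_ideal[OF qP])
    finally show ?thesis using c(1) by blast
  qed
  have "forms d \<subseteq> adjoin l I"
  proof
    fix g :: "('v, 'k) mpoly" assume g: "g \<in> forms d"
    \<comment> \<open>The local solutions do not disturb each other, so \<open>l\<close> times their
      sum agrees with \<open>g\<close> at every point of \<open>Z\<close>, as in the Chinese
      remainder theorem.\<close>
    have "\<forall>q\<in>Z. \<exists>a. a \<in> points_ideal (Z - {q}) \<and> g - l * a \<in> q" using key[OF _ g] by blast
    from bchoice[OF this] obtain a
      where a: "\<And>q. q \<in> Z \<Longrightarrow> a q \<in> points_ideal (Z - {q}) \<and> g - l * a q \<in> q" by blast
    have "g - l * (\<Sum>q\<in>Z. a q) \<in> r" if r: "r \<in> Z" for r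
    proof -
      have r_ideal: "is_ideal r" using r closed_Z closed_points_Proj Proj_ideal by blast
      have "(\<Sum>q\<in>Z - {r}. a q) \<in> r"
        using a r by (intro ideal_sum[OF r_ideal]) (auto simp: points_ideal_def)
      then have "(g - l * a r) - l * (\<Sum>q\<in>Z - {r}. a q) \<in> r"
        using a[OF r] ideal_diff[OF r_ideal _ ideal_mult_left[OF r_ideal]] by blast
      moreover have "(\<Sum>q\<in>Z. a q) = a r + (\<Sum>q\<in>Z - {r}. a q)" by (rule sum.remove[OF finite_Z r])
      ultimately show ?thesis by (simp add: algebra_simps)
    qed
    then have "g - l * (\<Sum>q\<in>Z. a q) \<in> I" by (auto simp: points_ideal_def)
    then have "(g - l * (\<Sum>q\<in>Z. a q)) + l * (\<Sum>q\<in>Z. a q) \<in> adjoin l I" by (rule adjoinI)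
    then show "g \<in> adjoin l I" by simp
  qed
  then show False using hilbert_fun_eq_0_iff[OF lI_ideal, of d] hd0 s by simp
qed

lemma unmixed_T: "unmixed_curve T"
  using closed_T dimension_T no_closed_associated by (simp add: unmixed_curve_def)

end

theorem theorem5p2:
  fixes Z :: "('v::finite, 'k::field_char_0) mpoly set set"
    and d s :: nat
  assumes "CARD('v) \<ge> 3"
    and "finite Z" and "Z \<subseteq> closed_points"
    and "uniform_position Z"
    and "delta_hilbert (points_ideal Z) d = int s"
    and "delta_hilbert (points_ideal Z) (d + 1) = int s"
    and "s \<noteq> 0"
    and "d > r_inv 2 (points_ideal Z)"
  shows "\<exists>I\<^sub>C :: ('v, 'k) mpoly set.
           unmixed_curve I\<^sub>C \<and> scheme_degree I\<^sub>C = of_nat s \<and>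
           I\<^sub>C \<subseteq> points_ideal Z \<and>
           I\<^sub>C = truncation_ideal d (points_ideal Z) \<and>
           (\<forall>t \<le> d + 1. delta_hilbert I\<^sub>C t = delta_hilbert (points_ideal Z) t)"
proof -
  let ?I = "points_ideal Z"
  have I: "homogeneous_ideal ?I" by (rule homogeneous_points_ideal[OF assms(3)])
  have section_eq: "delta_hilbert ?I t = int (hilbert_fun (adjoin l ?I) t)"
    if "l \<in> forms 1" "\<And>p. p \<in> Z \<Longrightarrow> l \<notin> p" for l t
    by (rule delta_hilbert_nonzerodivisor[OF I that(1)]) (rule points_nonzerodivisor[OF assms(3) that(2)])
  \<comment> \<open>The empty set has the unit ideal, whose first differences vanish.\<close>
  have ne: "Z \<noteq> {}"
  proof
    assume "Z = {}"
    then have "?I = UNIV" by (simp add: points_ideal_def)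
    then show False using assms(5,7) by (simp add: delta_hilbert_def hilbert_fun_UNIV split: if_splits)
  qed
  have nonzero: "\<forall>l\<in>forms 1. (\<forall>p\<in>Z. l \<notin> p) \<longrightarrow> \<not> forms d \<subseteq> adjoin l ?I"
  proof (intro ballI impI)
    fix l assume "l \<in> forms 1" "\<forall>p\<in>Z. l \<notin> p"
    then have "hilbert_fun (adjoin l ?I) d = s" using section_eq[of l d] assms(5) by simp
    then show "\<not> forms d \<subseteq> adjoin l ?I"
      using assms(7) hilbert_fun_eq_0_iff[OF is_ideal_adjoin[OF homogeneous_is_ideal[OF I]], of l d] by simp
  qed
  obtain v1 v2 l \<alpha> x \<beta> where v: "v1 \<noteq> v2"
    and l: "l = var_poly v1 + (\<Sum>v\<in>UNIV - {v1}. const_poly (\<alpha> v) * var_poly v)"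
    and x: "x = var_poly v2 + (\<Sum>v\<in>UNIV - {v1, v2}. const_poly (\<beta> v) * var_poly v)"
    and lZ: "\<forall>p\<in>Z. l \<notin> p" and full: "forms d \<subseteq> adjoin x (adjoin l ?I)"
    by (rule exists_linear_section[OF assms(2,3) ne assms(8) nonzero])
  obtain \<Psi> Y :: "'v \<Rightarrow> ('v, 'k) mpoly" where
    inv: "\<forall>v. subst_poly \<Psi> (Y v) = var_poly v" "\<forall>v. subst_poly Y (\<Psi> v) = var_poly v"
    and Y: "Y v1 = l" "Y v2 = x" "\<forall>v. Y v \<in> forms 1"
    and gen: "\<forall>I v. is_ideal I \<longrightarrow> range Y \<subseteq> I \<longrightarrow> var_poly v \<in> I"
    by (rule exists_coordinates[OF v l x])
  define m where "m = card (UNIV - {v1, v2})"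
  obtain h where h: "bij_betw h {0..<m} (UNIV - {v1, v2})"
    using ex_bij_betw_nat_finite[of "UNIV - {v1, v2}"] unfolding m_def by auto
  define n where "n = m + 2"
  \<comment> \<open>The enumeration puts \<open>v1\<close> and \<open>v2\<close> in front, so that
    \<open>y 0 = l\<close> and \<open>y 1 = x\<close>.\<close>
  define e where "e i = (if i = 0 then v1 else if i = 1 then v2 else h (i - 2))" for i :: nat
  have e01: "e 0 = v1" "e 1 = v2" by (simp_all add: e_def)
  have e2: "bij_betw e {2..<n} (UNIV - {v1, v2})"
  proof -
    have "bij_betw (\<lambda>i. i - 2) {2..<n} {0..<m}"
      by (rule bij_betw_byWitness[where f' = "\<lambda>i. i + 2"]) (auto simp: n_def)
    then have "bij_betw (h \<circ> (\<lambda>i. i - 2)) {2..<n} (UNIV - {v1, v2})" using h by (rule bij_betw_trans)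
    then show ?thesis by (rule bij_betw_cong[THEN iffD1, rotated]) (auto simp: e_def)
  qed
  have "bij_betw e ({0, 1} \<union> {2..<n}) ({v1, v2} \<union> (UNIV - {v1, v2}))"
  proof (rule bij_betw_combine[OF _ e2])
    show "bij_betw e {0, 1} {v1, v2}" using v e01 by (simp add: bij_betw_def)
  qed auto
  moreover have "{0, 1} \<union> {2..<n} = {..<n}" by (auto simp: n_def)
  moreover have "{v1, v2} \<union> (UNIV - {v1, v2}) = UNIV" by auto
  ultimately have "bij_betw e {..<n} UNIV" by (simp only:)
  then have e: "inj_on e {..<n}" "e ` {..<n} = UNIV" by (simp_all add: bij_betw_def)
  define y where "y i = Y (e i)" for i
  have l_form: "l \<in> forms 1" using Y(1,3) by auto
  interpret points_section Z d s n y
  proof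
    show "hilbert_fun (adjoin (y 0) ?I) d = s" "hilbert_fun (adjoin (y 0) ?I) (d + 1) = s"
      using section_eq[OF l_form, of d] section_eq[OF l_form, of "d + 1"] lZ assms(5,6)
      by (simp_all add: y_def e01 Y(1))
    show "2 \<le> n" by (simp add: n_def)
    \<comment> \<open>A natural number strictly above \<open>r_inv\<close> is positive.\<close>
    show "1 \<le> d" using assms(8) by simp
    show "f \<in> adjoin_seq y {0} k" if "k < n" "y k * f \<in> adjoin_seq y {0} k" for k f
      using that(2) unfolding y_def
      by (rule coordinates_regular[OF inv[THEN spec] e(1) that(1)])
    show "var_poly v \<in> adjoin_seq y {0} n" for v
    proof -
      have "Y w \<in> adjoin_seq y {0} n" for w
      proof -
        have "w \<in> e ` {..<n}" using e(2) by simp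
        then obtain i where "i < n" "w = e i" by blast
        then show ?thesis using mem_adjoin_seq[OF is_ideal_zero, of i n y] by (simp add: y_def)
      qed
      then have "range Y \<subseteq> adjoin_seq y {0} n" by blast
      then show ?thesis using gen is_ideal_adjoin_seq[OF is_ideal_zero] by blast
    qed
  qed (use assms lZ full Y in \<open>simp_all add: y_def e01[simplified]\<close>)
  show ?thesis
    using unmixed_T degree_T T_subset delta_eq by blast
qed

end
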